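(* Let $d\in\{1,2\}$, $G^d=\mathbb Z^d\dashv\mathbb Z$, $\beta>0$, and let $\mu_n<0$ be any sequence with $\mu_n\to0$. Let $\omega_n$ be the finite volume Gibbs state on $\Lambda_n=X_n\dashv Y_n$ with inverse temperature $\beta$ and chemical potential $\mu_n$. Then there are numbers $k'_n$, vectors $v_n\in\ell^2(V\Lambda_n)$ and sesquilinear forms $C_n$ such that, for all $\xi,\eta\in\mathcal S_0$, $$\omega_n(a^+(\xi)a(\eta))=k'_n\,\langle\eta,v_n\rangle\langle v_n,\xi\rangle+C_n(\xi,\eta),$$ where $k'_n\to+\infty$, $\langle v_n,\eta\rangle\to\langle v,\eta\rangle$ for every $\eta\in\mathcal S_0$, with $v$ the generalized Perron--Frobenius vector of $G^d$ described in the context, and $C_n$ converges (pointwise) to a sesquilinear form whose domain contains $\mathcal S_0$.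
   Context: Comb product: for graphs $G,K$ and a vertex $o\in VK$, $G\dashv(K,o)$ has vertex set $VG\times VK$, with $(g,h)\sim(g',h')$ iff ($g=g'$ and $h\sim h'$) or ($h=h'=o$ and $g\sim g'$). $G^d=\mathbb Z^d\dashv\mathbb Z$ with $o=0$; $A$ is its adjacency operator on $\ell^2(VG^d)=\ell^2(\mathbb Z^d)\otimes\ell^2(\mathbb Z)$. $X_n=(\mathbb Z_{2n+1})^d$ is the discrete torus graph (periodic boundary conditions), $Y_n$ is the path graph on $\{-n,\dots,0,\dots,n\}$, $\Lambda_n=X_n\dashv Y_n$ (with $o=0$), identified as a vertex set with $[-n,n]^d\times[-n,n]\subset VG^d$; $A_{\Lambda_n}$ is its adjacency operator, regarded as an operator on $\ell^2(VG^d)$ (zero outside $\Lambda_n$). The Gibbs state has two-point function $\omega_n(a^+(\xi)a(\eta))=\langle\eta,(e^{\beta H_n}-I)^{-1}\xi\rangle$, with $H_n=(\|A\|-\mu_n)I-A_{\Lambda_n}$. Every $\xi\in\ell^2(VG^d)$ is written $\xi=\sum_{\vec\jmath\in\mathbb Z^d}\delta_{\vec\jmath}\otimes\xi_{\vec\jmath}$ with $\xi_{\vec\jmath}\in\ell^2(\mathbb Z)$; $\mathcal S_0$ is the set of $\xi$ for which $\vec\jmath\mapsto\|\xi_{\vec\jmath}\|$ is rapidly decreasing on $\mathbb Z^d$. The generalized Perron--Frobenius vector is the function $v=u\otimes w$ on $VG^d$, where $u\equiv1$ on $\mathbb Z^d$ and $w=\|R\delta_0\|^{-1}R\delta_0\in\ell^2(\mathbb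 Z)$ with $R=(\|A\|I-A_{\mathbb Z})^{-1}$; for $\xi\in\mathcal S_0$, $\langle v,\xi\rangle=\sum_{\vec\jmath}\langle w,\xi_{\vec\jmath}\rangle$. Inner products are linear in the second variable. *)

theory Defs
  imports
    "HOL-Analysis.Analysis"
    "HOL-Number_Theory.Cong"
    "Graph_Theory.Pair_Digraph"
begin

section \<open>The Hilbert space of square-summable functions\<close>

definition ell2 :: "('a \<Rightarrow> complex) set" where
  "ell2 = {\<xi>. (\<lambda>x. (cmod (\<xi> x))\<^sup>2) summable_on UNIV}"

definition ell2_on :: "'a set \<Rightarrow> ('a \<Rightarrow> complex) set" where
  "ell2_on S = {\<xi> \<in> ell2. \<forall>x. x \<notin> S \<longrightarrow> \<xi> x = 0}"

text \<open>Linear in the second argument.\<close>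

definition ell2_inner :: "('a \<Rightarrow> complex) \<Rightarrow> ('a \<Rightarrow> complex) \<Rightarrow> complex" where
  "ell2_inner \<xi> \<eta> = (\<Sum>\<^sub>\<infinity>x. cnj (\<xi> x) * \<eta> x)"

definition ell2_norm :: "('a \<Rightarrow> complex) \<Rightarrow> real" where
  "ell2_norm \<xi> = sqrt (\<Sum>\<^sub>\<infinity>x. (cmod (\<xi> x))\<^sup>2)"

definition delta :: "'a \<Rightarrow> 'a \<Rightarrow> complex" where
  "delta a = (\<lambda>x. if x = a then 1 else 0)"

section \<open>Bounded operators\<close>

text \<open>An operator on \<open>ell2\<close> is a function on all complex functions of which only the restriction
  to \<open>ell2\<close> matters.\<close>

type_synonym 'a operator = "('a \<Rightarrow> complex) \<Rightarrow> ('a \<Rightarrow> complex)"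

definition op_norm :: "'a operator \<Rightarrow> real" where
  "op_norm T = (SUP \<xi>\<in>{\<xi> \<in> ell2. ell2_norm \<xi> \<le> 1}. ell2_norm (T \<xi>))"

text \<open>For bounded \<open>T\<close> the exponential series converges in operator norm, so the coordinates of
  its value at \<open>\<xi>\<close> are the sums of the coordinate series.\<close>

definition op_exp :: "'a operator \<Rightarrow> 'a operator" where
  "op_exp T \<xi> = (\<lambda>x. \<Sum>k. (T ^^ k) \<xi> x / fact k)"

text \<open>To be applied only to operators that are bijective on \<open>ell2\<close>.\<close>

definition op_inverse :: "'a operator \<Rightarrow> 'a operator" where
  "op_inverse T = inv_into ell2 T"

section \<open>Graphs and their adjacency operators\<close>

text \<open>An undirected simple graph is represented as a digraph with a symmetric, irreflexive set
  of arcs. All graphs below are locally finite, so the sum is finite.\<close>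

definition adj_op :: "'a pair_pre_digraph \<Rightarrow> 'a operator" where
  "adj_op G \<xi> = (\<lambda>x. \<Sum>y | (x, y) \<in> parcs G. \<xi> y)"

definition comb_product ::
  "'a pair_pre_digraph \<Rightarrow> 'b pair_pre_digraph \<Rightarrow> 'b \<Rightarrow> ('a \<times> 'b) pair_pre_digraph" where
  "comb_product G K r =
     \<lparr> pverts = pverts G \<times> pverts K,
       parcs = {((g, h), (g', h')).
                  g = g' \<and> g \<in> pverts G \<and> (h, h') \<in> parcs K \<or>
                  h = r \<and> h' = r \<and> (g, g') \<in> parcs G} \<rparr>"

definition lattice_graph :: "(int ^ 'd::finite) pair_pre_digraph" where
  "lattice_graph =
     \<lparr> pverts = UNIV,
       parcs = {(x, y). \<exists>i. \<bar>x $ i - y $ i\<bar> = 1 \<and> (\<forall>j. j \<noteq> i \<longrightarrow> x $ j = y $ j)} \<rparr>"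

definition line_graph :: "int pair_pre_digraph" where
  "line_graph = \<lparr> pverts = UNIV, parcs = {(h, h'). \<bar>h - h'\<bar> = 1} \<rparr>"

text \<open>The torus with side \<open>2 * n + 1\<close>, with residues represented by \<open>- n, \<dots>, n\<close>. The condition
  \<open>x \<noteq> y\<close> only excludes a loop in the one-point torus \<open>n = 0\<close>.\<close>

definition torus_graph :: "nat \<Rightarrow> (int ^ 'd::finite) pair_pre_digraph" where
  "torus_graph n =
     (let V = {x. \<forall>i. - int n \<le> x $ i \<and> x $ i \<le> int n}
      in \<lparr> pverts = V,
           parcs = {(x, y). x \<in> V \<and> y \<in> V \<and> x \<noteq> y \<and>
             (\<exists>i. ([x $ i = y $ i + 1] (mod (2 * int n + 1)) \<or>
                   [y $ i = x $ i + 1] (mod (2 * int n + 1))) \<and>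
                  (\<forall>j. j \<noteq> i \<longrightarrow> x $ j = y $ j))} \<rparr>)"

definition path_graph :: "nat \<Rightarrow> int pair_pre_digraph" where
  "path_graph n =
     \<lparr> pverts = {- int n..int n},
       parcs = {(h, h'). h \<in> {- int n..int n} \<and> h' \<in> {- int n..int n} \<and> \<bar>h - h'\<bar> = 1} \<rparr>"

definition comb_graph :: "((int ^ 'd::finite) \<times> int) pair_pre_digraph" where
  "comb_graph = comb_product lattice_graph line_graph 0"

definition comb_box :: "nat \<Rightarrow> ((int ^ 'd::finite) \<times> int) pair_pre_digraph" where
  "comb_box n = comb_product (torus_graph n) (path_graph n) 0"

section \<open>The finite volume Gibbs state\<close>

text \<open>Arcs of the box have both ends in the box, so its adjacency operator vanishes outside it,
  where the Hamiltonian is the scalar \<open>\<parallel>A\<parallel> - m\<close>.\<close>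

definition hamiltonian :: "real \<Rightarrow> nat \<Rightarrow> ((int ^ 'd::finite) \<times> int) operator" where
  "hamiltonian m n \<xi> =
     (\<lambda>x. of_real (op_norm (adj_op (comb_graph :: ((int ^ 'd) \<times> int) pair_pre_digraph)) - m) * \<xi> x
          - adj_op (comb_box n) \<xi> x)"

text \<open>The two-point function \<open>\<omega>(a\<^sup>+(\<xi>) a(\<eta>)) = \<langle>\<eta>, (exp (\<beta> H) - I)\<^sup>-\<^sup>1 \<xi>\<rangle>\<close> of the Gibbs state of \<open>H\<close>.\<close>

definition gibbs_two_point ::
  "real \<Rightarrow> 'a operator \<Rightarrow> ('a \<Rightarrow> complex) \<Rightarrow> ('a \<Rightarrow> complex) \<Rightarrow> complex" where
  "gibbs_two_point \<beta> H \<xi> \<eta> =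
     ell2_inner \<eta>
       (op_inverse (\<lambda>\<zeta> x. op_exp (\<lambda>\<phi> y. of_real \<beta> * H \<phi> y) \<zeta> x - \<zeta> x) \<xi>)"

section \<open>Rapidly decreasing vectors and the generalized Perron--Frobenius vector\<close>

definition fiber :: "('a \<times> 'b \<Rightarrow> complex) \<Rightarrow> 'a \<Rightarrow> 'b \<Rightarrow> complex" where
  "fiber \<xi> j = (\<lambda>h. \<xi> (j, h))"

definition rapidly_decreasing :: "(int ^ 'd::finite \<Rightarrow> real) \<Rightarrow> bool" where
  "rapidly_decreasing f \<longleftrightarrow>
     (\<forall>m::nat. \<exists>B. \<forall>j. (1 + real_of_int (\<Sum>i\<in>UNIV. \<bar>j $ i\<bar>)) ^ m * \<bar>f j\<bar> \<le> B)"

definition schwartz_vectors :: "((int ^ 'd::finite) \<times> int \<Rightarrow> complex) set" where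
  "schwartz_vectors = {\<xi> \<in> ell2. rapidly_decreasing (\<lambda>j. ell2_norm (fiber \<xi> j))}"

text \<open>The tooth component \<open>R \<delta>\<^sub>0 / \<parallel>R \<delta>\<^sub>0\<parallel>\<close> with \<open>R = (a I - A)\<^sup>-\<^sup>1\<close>, where \<open>A\<close> is the adjacency
  operator of the line.\<close>

definition tooth_vector :: "real \<Rightarrow> int \<Rightarrow> complex" where
  "tooth_vector a =
     (let r = op_inverse (\<lambda>\<zeta> h. of_real a * \<zeta> h - adj_op line_graph \<zeta> h) (delta 0)
      in (\<lambda>h. r h / of_real (ell2_norm r)))"

text \<open>The tensor product of the constant function 1 with the tooth component. It is not in
  \<open>ell2\<close>, hence the separate pairing.\<close>

definition pf_vector :: "(int ^ 'd::finite) \<times> int \<Rightarrow> complex" where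
  "pf_vector =
     (\<lambda>(j, h). 1 * tooth_vector
        (op_norm (adj_op (comb_graph :: ((int ^ 'd) \<times> int) pair_pre_digraph))) h)"

definition fiber_pairing :: "('a \<times> 'b \<Rightarrow> complex) \<Rightarrow> ('a \<times> 'b \<Rightarrow> complex) \<Rightarrow> complex" where
  "fiber_pairing v \<xi> = (\<Sum>\<^sub>\<infinity>j. ell2_inner (fiber v j) (fiber \<xi> j))"

section \<open>Sesquilinear forms\<close>

definition complex_subspace :: "('a \<Rightarrow> complex) set \<Rightarrow> bool" where
  "complex_subspace D \<longleftrightarrow>
     (\<lambda>x. 0) \<in> D \<and> (\<forall>\<xi>\<in>D. \<forall>\<eta>\<in>D. \<forall>a. (\<lambda>x. a * \<xi> x + \<eta> x) \<in> D)"

text \<open>Linear in the first and antilinear in the second argument, like \<open>\<omega>(a\<^sup>+(\<xi>) a(\<eta>))\<close> as a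
  function of \<open>\<xi>\<close> and \<open>\<eta>\<close>.\<close>

definition sesquilinear_form ::
  "('a \<Rightarrow> complex) set \<Rightarrow> (('a \<Rightarrow> complex) \<Rightarrow> ('a \<Rightarrow> complex) \<Rightarrow> complex) \<Rightarrow> bool" where
  "sesquilinear_form D C \<longleftrightarrow>
     complex_subspace D \<and>
     (\<forall>\<xi>\<in>D. \<forall>\<xi>'\<in>D. \<forall>\<eta>\<in>D. \<forall>a. C (\<lambda>x. a * \<xi> x + \<xi>' x) \<eta> = a * C \<xi> \<eta> + C \<xi>' \<eta>) \<and>
     (\<forall>\<xi>\<in>D. \<forall>\<eta>\<in>D. \<forall>\<eta>'\<in>D. \<forall>a. C \<xi> (\<lambda>x. a * \<eta> x + \<eta>' x) = cnj a * C \<xi> \<eta> + C \<xi> \<eta>')"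

end

theory Submission
  imports Defs "HOL-Complex_Analysis.Complex_Analysis"
begin

text \<open>The Bose function is \<open>1 / (exp (\<beta> * x) - 1) = 1 / (\<beta> * x) + h x\<close> with \<open>h\<close> analytic near the
  real axis. Expanding in powers of the adjacency operator, the contribution of \<open>h\<close> to the two-point
  function converges by dominated convergence, since the finite graphs converge locally. What
  remains is the resolvent of the finite comb. A Schur complement reduces it to the Green kernel
  \<open>K\<close> of the torus at an energy that decreases to \<open>2 * d\<close>, the top of the spectrum. Writing
  \<open>K x = K 0 - (K 0 - K x)\<close>, the constant \<open>K 0\<close> multiplies a rank-one form and tends to infinity
  because the walk on \<open>\<int>\<^sup>d\<close> is recurrent for \<open>d \<le> 2\<close>, while \<open>K 0 - K x\<close> converges and is at most
  quadratic in \<open>x\<close>, hence summable against rapidly decreasing vectors. So the coefficient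
  \<open>k'\<close> collects all low modes of the torus and not only the zero mode, and no assumption on the
  speed of \<open>\<mu> \<longlonglongrightarrow> 0\<close> is needed.\<close>

no_notation fps_nth (infixl "$" 75)

text \<open>Functions of adjacency operators are handled without spectral theory, as power series
  whose coefficients are absolutely summable against powers of a norm bound. This requires the bound
  \<open>comb_norm d\<close> for all boxes and not only for the infinite comb. The Schur test gives
  both from one positive function 1 \<otimes> t^|h|, an eigenfunction of the infinite comb that is
  not square-summable. The main obstacle is that the chemical potential drives the resolvent
  parameter down to this very bound, where the geometric series of the box resolvent has no uniform
  majorant. Removing the backbone edges leaves paths, with norm at most 2 <
  \<open>comb_norm d\<close>, so the teeth keep a gap. All criticality is then concentrated in one
  number, the central resolvent entry g of a tooth. It tends to 1 / (2 * d) but stays strictly below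
  it, since a path has no more walks than the line and the parameter is strictly above
  \<open>comb_norm d\<close>. The value 2 * sqrt (1 + d^2) of the norm is exactly the energy at
  which an infinite tooth has g = 1 / (2 * d).\<close>

lemma infsum_dominated_convergence:
  fixes f :: "nat \<Rightarrow> 'a \<Rightarrow> complex"
  assumes "\<And>x. (\<lambda>n. f n x) \<longlonglongrightarrow> l x" "g summable_on UNIV" "\<And>n x. cmod (f n x) \<le> g x"
  shows "(\<lambda>n. \<Sum>\<^sub>\<infinity>x. f n x) \<longlonglongrightarrow> (\<Sum>\<^sub>\<infinity>x. l x)"
proof -
  have lg: "cmod (l x) \<le> g x" for x
    by (rule Lim_bounded[where M=0, OF tendsto_norm[OF assms(1)[of x]]]) (use assms(3) in auto)
  have sf: "(\<lambda>x. cmod (f n x)) summable_on UNIV" for n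
    by (rule Infinite_Sum.abs_summable_on_comparison_test'[OF assms(2)]) (use assms(3) in auto)
  have sl: "(\<lambda>x. cmod (l x)) summable_on UNIV"
    by (rule Infinite_Sum.abs_summable_on_comparison_test'[OF assms(2)]) (use lg in auto)
  have g0: "g x \<ge> 0" for x using assms(3)[of 0 x] norm_ge_zero[of "f 0 x"] by linarith
  have "(\<lambda>x. norm (g x)) summable_on UNIV" using assms(2) g0 by simp
  \<comment> \<open>For counting measure the sums are Bochner integrals, so Lebesgue's theorem
    applies.\<close>
  then have ig: "integrable (count_space UNIV) g"
    unfolding abs_summable_equivalent Infinite_Set_Sum.abs_summable_on_def .
  have e: "(\<Sum>\<^sub>\<infinity>x. h x) = lebesgue_integral (count_space UNIV) h"
    if "(\<lambda>x. cmod (h x)) summable_on UNIV" for h :: "'a \<Rightarrow> complex"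
    using infsetsum_infsum[of h UNIV] that unfolding abs_summable_equivalent infsetsum_def by simp
  show ?thesis unfolding e[OF sf] e[OF sl]
    by (rule integral_dominated_convergence[where w=g]) (use assms ig in auto)
qed

section \<open>Square-summable functions\<close>

lemma ell2_sum_le:
  assumes "\<xi> \<in> ell2" "finite F"
  shows "(\<Sum>x\<in>F. (cmod (\<xi> x))\<^sup>2) \<le> (ell2_norm \<xi>)\<^sup>2"
proof -
  have "(\<Sum>x\<in>F. (cmod (\<xi> x))\<^sup>2) \<le> (\<Sum>\<^sub>\<infinity>x. (cmod (\<xi> x))\<^sup>2)"
    by (rule finite_sum_le_infsum) (use assms in \<open>auto simp: ell2_def\<close>)
  then show ?thesis unfolding ell2_norm_def
    by (simp add: infsum_nonneg)
qed

lemma ell2_norm_nonneg [simp]: "ell2_norm \<xi> \<ge> 0"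
  by (simp add: ell2_norm_def infsum_nonneg)

lemma ell2I:
  assumes "\<And>F. finite F \<Longrightarrow> (\<Sum>x\<in>F. (cmod (\<xi> x))\<^sup>2) \<le> B\<^sup>2" "B \<ge> 0"
  shows ell2I_mem: "\<xi> \<in> ell2" and ell2I_norm: "ell2_norm \<xi> \<le> B"
proof -
  have s: "(\<lambda>x. (cmod (\<xi> x))\<^sup>2) summable_on UNIV"
    by (rule nonneg_bdd_above_summable_on) (use assms in \<open>auto intro!: bdd_aboveI2\<close>)
  then show "\<xi> \<in> ell2" by (simp add: ell2_def)
  have "(\<Sum>\<^sub>\<infinity>x. (cmod (\<xi> x))\<^sup>2) \<le> B\<^sup>2"
    by (rule infsum_le_finite_sums[OF s]) (use assms in auto)
  then show "ell2_norm \<xi> \<le> B" unfolding ell2_norm_def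
    using assms(2) real_le_lsqrt infsum_nonneg by (metis real_sqrt_le_iff real_sqrt_abs abs_of_nonneg)
qed

lemma L2_set_le_ell2_norm:
  assumes "\<xi> \<in> ell2" "finite F"
  shows "L2_set (\<lambda>x. cmod (\<xi> x)) F \<le> ell2_norm \<xi>"
  unfolding L2_set_def using ell2_sum_le[OF assms]
  by (simp add: real_le_lsqrt sum_nonneg)

lemma ell2I_L2_set:
  assumes "\<And>F. finite F \<Longrightarrow> L2_set (\<lambda>x. cmod (\<xi> x)) F \<le> B"
  shows "\<xi> \<in> ell2" "ell2_norm \<xi> \<le> B"
proof -
  have B: "B \<ge> 0" using assms[of "{}"] by simp
  have "(\<Sum>x\<in>F. (cmod (\<xi> x))\<^sup>2) \<le> B\<^sup>2" if "finite F" for F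
    using assms[OF that] unfolding L2_set_def
    by (metis sum_nonneg zero_le_power2 real_sqrt_le_iff real_sqrt_abs abs_of_nonneg B)
  then show "\<xi> \<in> ell2" "ell2_norm \<xi> \<le> B" using ell2I B by blast+
qed

lemma cmod_le_ell2_norm:
  assumes "\<xi> \<in> ell2" shows "cmod (\<xi> x) \<le> ell2_norm \<xi>"
  using L2_set_le_ell2_norm[OF assms, of "{x}"] by simp

lemma ell2_zero [simp]: "(\<lambda>x. 0) \<in> ell2" "ell2_norm (\<lambda>x. 0) = 0"
  by (auto simp: ell2_def ell2_norm_def)

lemma ell2_scale:
  assumes "\<xi> \<in> ell2"
  shows "(\<lambda>x. a * \<xi> x) \<in> ell2" "ell2_norm (\<lambda>x. a * \<xi> x) = cmod a * ell2_norm \<xi>"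
  using assms
  by (auto simp: ell2_def ell2_norm_def norm_mult power_mult_distrib infsum_cmult_right'
      real_sqrt_mult summable_on_cmult_right)

lemma ell2_add:
  assumes "\<xi> \<in> ell2" "\<eta> \<in> ell2"
  shows "(\<lambda>x. \<xi> x + \<eta> x) \<in> ell2" "ell2_norm (\<lambda>x. \<xi> x + \<eta> x) \<le> ell2_norm \<xi> + ell2_norm \<eta>"
proof -
  have "L2_set (\<lambda>x. cmod (\<xi> x + \<eta> x)) F \<le> ell2_norm \<xi> + ell2_norm \<eta>" if "finite F" for F
  proof -
    have "L2_set (\<lambda>x. cmod (\<xi> x + \<eta> x)) F \<le> L2_set (\<lambda>x. cmod (\<xi> x) + cmod (\<eta> x)) F"
      by (rule L2_set_mono) (auto intro: norm_triangle_ineq)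
    also have "\<dots> \<le> L2_set (\<lambda>x. cmod (\<xi> x)) F + L2_set (\<lambda>x. cmod (\<eta> x)) F"
      by (rule L2_set_triangle_ineq)
    finally show ?thesis using L2_set_le_ell2_norm[OF assms(1) that] L2_set_le_ell2_norm[OF assms(2) that]
      by linarith
  qed
  from ell2I_L2_set[of "\<lambda>x. \<xi> x + \<eta> x", OF this] show "(\<lambda>x. \<xi> x + \<eta> x) \<in> ell2"
    "ell2_norm (\<lambda>x. \<xi> x + \<eta> x) \<le> ell2_norm \<xi> + ell2_norm \<eta>" by blast+
qed

lemma ell2_diff:
  assumes "\<xi> \<in> ell2" "\<eta> \<in> ell2"
  shows "(\<lambda>x. \<xi> x - \<eta> x) \<in> ell2" "ell2_norm (\<lambda>x. \<xi> x - \<eta> x) \<le> ell2_norm \<xi> + ell2_norm \<eta>"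
  using ell2_add[OF assms(1) ell2_scale(1)[OF assms(2), of "-1"]] ell2_scale(2)[OF assms(2), of "-1"]
  by auto

lemma ell2_finite_support:
  assumes "finite S" "\<And>x. x \<notin> S \<Longrightarrow> \<xi> x = 0"
  shows "\<xi> \<in> ell2"
proof -
  have "(\<lambda>x. (cmod (\<xi> x))\<^sup>2) summable_on UNIV \<longleftrightarrow> (\<lambda>x. (cmod (\<xi> x))\<^sup>2) summable_on S"
    by (rule summable_on_cong_neutral) (use assms in auto)
  then show ?thesis using assms by (simp add: ell2_def)
qed

lemma ell2_mono:
  assumes "\<eta> \<in> ell2" "\<And>x. cmod (\<xi> x) \<le> cmod (\<eta> x)"
  shows "\<xi> \<in> ell2" "ell2_norm \<xi> \<le> ell2_norm \<eta>"
proof -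
  have "L2_set (\<lambda>x. cmod (\<xi> x)) F \<le> ell2_norm \<eta>" if "finite F" for F
    using L2_set_mono[of F "\<lambda>x. cmod (\<xi> x)" "\<lambda>x. cmod (\<eta> x)"] assms
      L2_set_le_ell2_norm[OF assms(1) that] by force
  from ell2I_L2_set[of \<xi>, OF this] show "\<xi> \<in> ell2" "ell2_norm \<xi> \<le> ell2_norm \<eta>" by blast+
qed

lemma delta_ell2 [simp]: "delta a \<in> ell2"
  by (rule ell2_finite_support[of "{a}"]) (auto simp: delta_def)

lemma ell2_inner_abs_summable:
  assumes "\<xi> \<in> ell2" "\<eta> \<in> ell2"
  shows "(\<lambda>x. cmod (cnj (\<xi> x) * \<eta> x)) summable_on UNIV"
proof (rule nonneg_bdd_above_summable_on)
  show "bdd_above (sum (\<lambda>x. cmod (cnj (\<xi> x) * \<eta> x)) ` {F. F \<subseteq> UNIV \<and> finite F})"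
  proof (rule bdd_aboveI2)
    fix F :: "'a set" assume "F \<in> {F. F \<subseteq> UNIV \<and> finite F}"
    then have F: "finite F" by simp
    have "(\<Sum>x\<in>F. cmod (cnj (\<xi> x) * \<eta> x)) \<le> L2_set (\<lambda>x. cmod (\<xi> x)) F * L2_set (\<lambda>x. cmod (\<eta> x)) F"
      using L2_set_mult_ineq[of "\<lambda>x. cmod (\<xi> x)" "\<lambda>x. cmod (\<eta> x)" F] by (simp add: norm_mult)
    also have "\<dots> \<le> ell2_norm \<xi> * ell2_norm \<eta>"
      by (intro mult_mono L2_set_le_ell2_norm assms F) auto
    finally show "(\<Sum>x\<in>F. cmod (cnj (\<xi> x) * \<eta> x)) \<le> ell2_norm \<xi> * ell2_norm \<eta>" .
  qed
qed auto

lemma ell2_inner_summable: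
  assumes "\<xi> \<in> ell2" "\<eta> \<in> ell2"
  shows "(\<lambda>x. cnj (\<xi> x) * \<eta> x) summable_on UNIV"
  by (rule Infinite_Sum.abs_summable_summable[OF ell2_inner_abs_summable[OF assms]])

lemma ell2_Cauchy_Schwarz:
  assumes "\<xi> \<in> ell2" "\<eta> \<in> ell2"
  shows "cmod (ell2_inner \<xi> \<eta>) \<le> ell2_norm \<xi> * ell2_norm \<eta>"
proof -
  have "cmod (ell2_inner \<xi> \<eta>) \<le> (\<Sum>\<^sub>\<infinity>x. cmod (cnj (\<xi> x) * \<eta> x))"
    unfolding ell2_inner_def by (rule norm_infsum_bound) (use ell2_inner_abs_summable[OF assms] in auto)
  also have "\<dots> \<le> ell2_norm \<xi> * ell2_norm \<eta>"
  proof (rule infsum_le_finite_sums[OF ell2_inner_abs_summable[OF assms]])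
    fix F :: "'a set" assume F: "finite F"
    have "(\<Sum>x\<in>F. cmod (cnj (\<xi> x) * \<eta> x)) \<le> L2_set (\<lambda>x. cmod (\<xi> x)) F * L2_set (\<lambda>x. cmod (\<eta> x)) F"
      using L2_set_mult_ineq[of "\<lambda>x. cmod (\<xi> x)" "\<lambda>x. cmod (\<eta> x)" F] by (simp add: norm_mult)
    also have "\<dots> \<le> ell2_norm \<xi> * ell2_norm \<eta>"
      by (intro mult_mono L2_set_le_ell2_norm assms F) auto
    finally show "(\<Sum>x\<in>F. cmod (cnj (\<xi> x) * \<eta> x)) \<le> ell2_norm \<xi> * ell2_norm \<eta>" .
  qed
  finally show ?thesis .
qed

lemma ell2_inner_linear_right:
  assumes "\<zeta> \<in> ell2" "\<xi> \<in> ell2" "\<eta> \<in> ell2"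
  shows "ell2_inner \<zeta> (\<lambda>x. a * \<xi> x + \<eta> x) = a * ell2_inner \<zeta> \<xi> + ell2_inner \<zeta> \<eta>"
proof -
  have "ell2_inner \<zeta> (\<lambda>x. a * \<xi> x + \<eta> x) = (\<Sum>\<^sub>\<infinity>x. a * (cnj (\<zeta> x) * \<xi> x) + cnj (\<zeta> x) * \<eta> x)"
    unfolding ell2_inner_def by (simp add: algebra_simps)
  also have "\<dots> = (\<Sum>\<^sub>\<infinity>x. a * (cnj (\<zeta> x) * \<xi> x)) + ell2_inner \<zeta> \<eta>"
    unfolding ell2_inner_def
    by (intro infsum_add summable_on_cmult_right ell2_inner_summable assms)
  finally show ?thesis by (simp add: infsum_cmult_right' ell2_inner_def)
qed

lemma ell2_inner_linear_left:
  assumes "\<zeta> \<in> ell2" "\<xi> \<in> ell2" "\<eta> \<in> ell2"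
  shows "ell2_inner (\<lambda>x. a * \<xi> x + \<eta> x) \<zeta> = cnj a * ell2_inner \<xi> \<zeta> + ell2_inner \<eta> \<zeta>"
proof -
  have "ell2_inner (\<lambda>x. a * \<xi> x + \<eta> x) \<zeta> = (\<Sum>\<^sub>\<infinity>x. cnj a * (cnj (\<xi> x) * \<zeta> x) + cnj (\<eta> x) * \<zeta> x)"
    unfolding ell2_inner_def by (simp add: algebra_simps)
  also have "\<dots> = (\<Sum>\<^sub>\<infinity>x. cnj a * (cnj (\<xi> x) * \<zeta> x)) + ell2_inner \<eta> \<zeta>"
    unfolding ell2_inner_def
    by (intro infsum_add summable_on_cmult_right ell2_inner_summable assms)
  finally show ?thesis by (simp add: infsum_cmult_right' ell2_inner_def)
qed

lemma ell2_inner_add: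
  assumes "\<zeta> \<in> ell2" "\<xi> \<in> ell2" "\<eta> \<in> ell2"
  shows "ell2_inner \<zeta> (\<lambda>x. \<xi> x + \<eta> x) = ell2_inner \<zeta> \<xi> + ell2_inner \<zeta> \<eta>"
  using ell2_inner_linear_right[OF assms, of 1] by simp

lemma ell2_inner_scale:
  "ell2_inner \<zeta> (\<lambda>x. a * \<xi> x) = a * ell2_inner \<zeta> \<xi>"
  unfolding ell2_inner_def by (simp add: infsum_cmult_right' mult.left_commute)

lemma ell2_inner_finite:
  assumes "finite S" "\<And>x. x \<notin> S \<Longrightarrow> cnj (\<xi> x) * \<eta> x = 0"
  shows "ell2_inner \<xi> \<eta> = (\<Sum>x\<in>S. cnj (\<xi> x) * \<eta> x)"
proof -
  have "ell2_inner \<xi> \<eta> = (\<Sum>\<^sub>\<infinity>x\<in>S. cnj (\<xi> x) * \<eta> x)"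
    unfolding ell2_inner_def by (rule infsum_cong_neutral) (use assms in auto)
  then show ?thesis using assms by simp
qed

lemma ell2_inner_cnj: "ell2_inner \<eta> \<xi> = cnj (ell2_inner \<xi> \<eta>)"
  unfolding ell2_inner_def by (simp flip: infsum_cnj add: mult.commute)

lemma ell2_tail_small:
  assumes "\<eta> \<in> ell2" "\<epsilon> > 0"
  obtains F where "finite F" "(\<lambda>x. if x \<in> F then 0 else \<eta> x) \<in> ell2"
    "ell2_norm (\<lambda>x. if x \<in> F then 0 else \<eta> x) \<le> \<epsilon>"
proof -
  have s: "(\<lambda>x. (cmod (\<eta> x))\<^sup>2) summable_on UNIV" using assms by (simp add: ell2_def)
  obtain F where F: "finite F"
    "dist (\<Sum>x\<in>F. (cmod (\<eta> x))\<^sup>2) (\<Sum>\<^sub>\<infinity>x. (cmod (\<eta> x))\<^sup>2) \<le> \<epsilon>\<^sup>2"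
    using infsum_finite_approximation[OF s, of "\<epsilon>\<^sup>2"] assms by auto
  have "(\<Sum>x\<in>G. (cmod (if x \<in> F then 0 else \<eta> x))\<^sup>2) \<le> \<epsilon>\<^sup>2" if G: "finite G" for G
  proof -
    have "(\<Sum>x\<in>G. (cmod (if x \<in> F then 0 else \<eta> x))\<^sup>2) = (\<Sum>x\<in>G - F. (cmod (\<eta> x))\<^sup>2)"
      using G by (intro sum.mono_neutral_cong_right) auto
    also have "\<dots> = (\<Sum>x\<in>G \<union> F. (cmod (\<eta> x))\<^sup>2) - (\<Sum>x\<in>F. (cmod (\<eta> x))\<^sup>2)"
      using G F(1) sum.union_disjoint[of "G - F" F "\<lambda>x. (cmod (\<eta> x))\<^sup>2"]
      by (simp add: Un_Diff_cancel2 Int_commute)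
    also have "\<dots> \<le> (\<Sum>\<^sub>\<infinity>x. (cmod (\<eta> x))\<^sup>2) - (\<Sum>x\<in>F. (cmod (\<eta> x))\<^sup>2)"
      using finite_sum_le_infsum[OF s, of "G \<union> F"] G F by auto
    also have "\<dots> \<le> \<epsilon>\<^sup>2" using F(2) by (auto simp: dist_real_def)
    finally show ?thesis .
  qed
  from ell2I[of "\<lambda>x. if x \<in> F then 0 else \<eta> x" \<epsilon>, OF this] assms(2) F(1)
  show ?thesis by (intro that[of F]) auto
qed

text \<open>The norm bound controls the pairing with the tail of \<open>\<eta>\<close>; on the
  remaining finite set coordinatewise convergence suffices. This upgrades local convergence of
  graphs, which concerns one vertex at a time, to matrix elements between arbitrary vectors.\<close>

lemma ell2_weak_convergence:
  assumes "\<eta> \<in> ell2" "y \<in> ell2" "\<And>n. Y n \<in> ell2" "\<And>n. ell2_norm (Y n) \<le> B"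
    and "\<And>x. (\<lambda>n. Y n x) \<longlonglongrightarrow> y x"
  shows "(\<lambda>n. ell2_inner \<eta> (Y n)) \<longlonglongrightarrow> ell2_inner \<eta> y"
proof (rule LIMSEQ_I)
  fix e :: real assume e: "e > 0"
  \<comment> \<open>\<open>M\<close> bounds the norm of every difference of \<open>Y n\<close> and
    \<open>y\<close>; the summand 1 keeps it positive for the division.\<close>
  define M where "M = B + ell2_norm y + 1"
  have B: "B \<ge> 0" using assms(4)[of 0] ell2_norm_nonneg[of "Y 0"] by linarith
  have M: "M > 0" using B ell2_norm_nonneg[of y] unfolding M_def by linarith
  obtain F where F: "finite F" "(\<lambda>x. if x \<in> F then 0 else \<eta> x) \<in> ell2"
    "ell2_norm (\<lambda>x. if x \<in> F then 0 else \<eta> x) \<le> e / (2 * M)"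
    using ell2_tail_small[OF assms(1), of "e / (2 * M)"] e M by auto
  let ?t = "\<lambda>x. if x \<in> F then 0 else \<eta> x" and ?f = "\<lambda>x. if x \<in> F then \<eta> x else 0"
  have f: "?f \<in> ell2" by (rule ell2_finite_support[OF F(1)]) auto
  have split: "ell2_inner \<eta> z = (\<Sum>x\<in>F. cnj (\<eta> x) * z x) + ell2_inner ?t z" if "z \<in> ell2" for z
  proof -
    have "\<eta> = (\<lambda>x. 1 * ?f x + ?t x)" by auto
    then have "ell2_inner \<eta> z = ell2_inner ?f z + ell2_inner ?t z"
      using ell2_inner_linear_left[OF that f F(2), of 1] by simp
    moreover have "ell2_inner ?f z = (\<Sum>x\<in>F. cnj (\<eta> x) * z x)"
      by (subst ell2_inner_finite[OF F(1)]) auto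
    ultimately show ?thesis by simp
  qed
  have "(\<lambda>n. \<Sum>x\<in>F. cnj (\<eta> x) * (Y n x - y x)) \<longlonglongrightarrow> (\<Sum>x\<in>F. cnj (\<eta> x) * (y x - y x))"
    by (intro tendsto_intros assms)
  then obtain N where N: "\<And>n. n \<ge> N \<Longrightarrow> cmod (\<Sum>x\<in>F. cnj (\<eta> x) * (Y n x - y x)) < e / 2"
    using LIMSEQ_D[of _ 0 "e/2"] e by auto
  show "\<exists>N. \<forall>n\<ge>N. norm (ell2_inner \<eta> (Y n) - ell2_inner \<eta> y) < e"
  proof (intro exI allI impI)
    fix n assume n: "n \<ge> N"
    have d: "(\<lambda>x. Y n x - y x) \<in> ell2" "ell2_norm (\<lambda>x. Y n x - y x) \<le> M"
      using ell2_diff[OF assms(3)[of n] assms(2)] assms(4)[of n] unfolding M_def by auto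
    have "ell2_inner \<eta> (\<lambda>x. Y n x - y x) = ell2_inner \<eta> (Y n) - ell2_inner \<eta> y"
      using ell2_inner_linear_right[OF assms(1,2) assms(3)[of n], of "-1"] by simp
    then have "ell2_inner \<eta> (Y n) - ell2_inner \<eta> y =
        (\<Sum>x\<in>F. cnj (\<eta> x) * (Y n x - y x)) + ell2_inner ?t (\<lambda>x. Y n x - y x)"
      using split[OF d(1)] by simp
    moreover have "cmod (ell2_inner ?t (\<lambda>x. Y n x - y x)) \<le> e / (2 * M) * M"
      by (rule order_trans[OF ell2_Cauchy_Schwarz[OF F(2) d(1)]])
         (use F(3) d(2) e M in \<open>intro mult_mono; auto\<close>)
    ultimately show "norm (ell2_inner \<eta> (Y n) - ell2_inner \<eta> y) < e"
      using N[OF n] M norm_triangle_ineq[of "\<Sum>x\<in>F. cnj (\<eta> x) * (Y n x - y x)"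
          "ell2_inner ?t (\<lambda>x. Y n x - y x)"] by auto
  qed
qed

text \<open>Completeness for absolutely convergent series, with the sum taken in coordinates: the
  norm bound passes to the limit on finite sets of coordinates, and then the partial sums converge
  weakly, being bounded and coordinatewise convergent.\<close>

lemma ell2_suminf:
  fixes y :: "nat \<Rightarrow> 'a \<Rightarrow> complex"
  assumes y: "\<And>m. y m \<in> ell2" "\<And>m. ell2_norm (y m) \<le> s m" and s: "summable s"
  shows "(\<lambda>x. \<Sum>m. y m x) \<in> ell2" "ell2_norm (\<lambda>x. \<Sum>m. y m x) \<le> suminf s"
    "summable (\<lambda>m. cmod (y m x))"
    "\<eta> \<in> ell2 \<Longrightarrow> (\<lambda>m. ell2_inner \<eta> (y m)) sums ell2_inner \<eta> (\<lambda>x. \<Sum>m. y m x)"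
proof -
  have s0: "s m \<ge> 0" for m using y(2)[of m] ell2_norm_nonneg order_trans by blast
  have sm: "summable (\<lambda>m. cmod (y m x))" for x
    by (rule summable_comparison_test[OF _ s])
       (use order_trans[OF cmod_le_ell2_norm[OF y(1)] y(2)] in auto)
  show "summable (\<lambda>m. cmod (y m x))" by (rule sm)
  have sx: "(\<lambda>m. y m x) sums (\<Sum>m. y m x)" for x
    by (rule summable_sums[OF summable_norm_cancel[OF sm]])
  have part: "(\<lambda>x. \<Sum>m<M. y m x) \<in> ell2" "ell2_norm (\<lambda>x. \<Sum>m<M. y m x) \<le> (\<Sum>m<M. s m)" for M
  proof (induction M)
    case (Suc M)
    { case 1 show ?case using ell2_add[OF Suc(1) y(1)] by simp }
    { case 2 show ?case using ell2_add(2)[OF Suc(1) y(1), of M] Suc(2) y(2)[of M] by simp }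
  qed auto
  have part': "ell2_norm (\<lambda>x. \<Sum>m<M. y m x) \<le> suminf s" for M
    using part(2)[of M] sum_le_suminf[OF s, of "{..<M}"] s0 by fastforce
  have b: "L2_set (\<lambda>x. cmod (\<Sum>m. y m x)) F \<le> suminf s" if "finite F" for F
  proof (rule Lim_bounded[where M=0])
    show "(\<lambda>M. L2_set (\<lambda>x. cmod (\<Sum>m<M. y m x)) F) \<longlonglongrightarrow> L2_set (\<lambda>x. cmod (\<Sum>m. y m x)) F"
      unfolding L2_set_def
      by (intro tendsto_intros) (use sx in \<open>auto simp: sums_def\<close>)
    show "\<forall>M\<ge>0. L2_set (\<lambda>x. cmod (\<Sum>m<M. y m x)) F \<le> suminf s"
      using L2_set_le_ell2_norm[OF part(1) that] part' order_trans by blast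
  qed
  show mem: "(\<lambda>x. \<Sum>m. y m x) \<in> ell2" and "ell2_norm (\<lambda>x. \<Sum>m. y m x) \<le> suminf s"
    using ell2I_L2_set[of "\<lambda>x. \<Sum>m. y m x", OF b] by auto
  assume \<eta>: "\<eta> \<in> ell2"
  have "ell2_inner \<eta> (\<lambda>x. \<Sum>m<M. y m x) = (\<Sum>m<M. ell2_inner \<eta> (y m))" for M
  proof (induction M)
    case 0 show ?case by (simp add: ell2_inner_def)
  next
    case (Suc M) show ?case using ell2_inner_add[OF \<eta> part(1) y(1), of M M] Suc by simp
  qed
  moreover have "(\<lambda>M. ell2_inner \<eta> (\<lambda>x. \<Sum>m<M. y m x)) \<longlonglongrightarrow> ell2_inner \<eta> (\<lambda>x. \<Sum>m. y m x)"
    by (rule ell2_weak_convergence[OF \<eta> mem part(1) part']) (use sx in \<open>auto simp: sums_def\<close>)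
  ultimately show "(\<lambda>m. ell2_inner \<eta> (y m)) sums ell2_inner \<eta> (\<lambda>x. \<Sum>m. y m x)"
    by (simp add: sums_def)
qed

lemma summable_on_product_nonneg:
  fixes f :: "'a \<Rightarrow> real" and g :: "'b \<Rightarrow> real"
  assumes f: "f summable_on UNIV" "\<And>x. f x \<ge> 0" and g: "g summable_on UNIV" "\<And>y. g y \<ge> 0"
  shows "(\<lambda>(x, y). f x * g y) summable_on UNIV"
proof (rule nonneg_bdd_above_summable_on)
  show "bdd_above (sum (\<lambda>(x, y). f x * g y) ` {F. F \<subseteq> UNIV \<and> finite F})"
  proof (rule bdd_aboveI2)
    fix F :: "('a \<times> 'b) set" assume "F \<in> {F. F \<subseteq> UNIV \<and> finite F}"
    then have F: "finite F" by simp
    have "F \<subseteq> fst ` F \<times> snd ` F" by force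
    then have "(\<Sum>(x, y)\<in>F. f x * g y) \<le> (\<Sum>(x, y)\<in>fst ` F \<times> snd ` F. f x * g y)"
      using F f g by (intro sum_mono2) auto
    also have "\<dots> = (\<Sum>x\<in>fst ` F. f x) * (\<Sum>y\<in>snd ` F. g y)"
      by (simp add: sum_product sum.cartesian_product)
    also have "\<dots> \<le> (\<Sum>\<^sub>\<infinity>x. f x) * (\<Sum>\<^sub>\<infinity>y. g y)"
      using F f g by (intro mult_mono finite_sum_le_infsum sum_nonneg infsum_nonneg) auto
    finally show "(\<Sum>(x, y)\<in>F. f x * g y) \<le> (\<Sum>\<^sub>\<infinity>x. f x) * (\<Sum>\<^sub>\<infinity>y. g y)" .
  qed
qed (use f g in auto)

section \<open>Power series in a bounded adjacency operator\<close>

lemma adj_op_linear: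
  "adj_op G (\<lambda>x. a * \<xi> x + \<eta> x) = (\<lambda>x. a * adj_op G \<xi> x + adj_op G \<eta> x)"
  by (auto simp: adj_op_def sum.distrib sum_distrib_left)

lemma adj_op_pow_linear:
  "(adj_op G ^^ m) (\<lambda>x. a * \<xi> x + \<eta> x) = (\<lambda>x. a * (adj_op G ^^ m) \<xi> x + (adj_op G ^^ m) \<eta> x)"
  by (induction m) (auto simp: adj_op_linear)

lemma adj_op_zero: "adj_op G (\<lambda>x. 0) = (\<lambda>x. 0)"
  by (auto simp: adj_op_def)

text \<open>A positive supersolution \<open>v\<close> controls the norm even if it is not
  square-summable. Cauchy-Schwarz with the factors sqrt (v y) and |\<xi> y| / sqrt (v y) uses the
  inequality at \<open>x\<close>; after exchanging the sums, symmetry lets it be used again at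
  \<open>y\<close>.\<close>

lemma adj_op_Schur_test:
  fixes v :: "'a \<Rightarrow> real"
  assumes sym: "\<And>x y. (x, y) \<in> parcs G \<Longrightarrow> (y, x) \<in> parcs G"
    and fin: "\<And>x. finite {y. (x, y) \<in> parcs G}"
    and pos: "\<And>x. v x > 0"
    and le: "\<And>x. (\<Sum>y | (x, y) \<in> parcs G. v y) \<le> b * v x"
    and b: "b \<ge> 0" and \<xi>: "\<xi> \<in> ell2"
  shows "adj_op G \<xi> \<in> ell2" "ell2_norm (adj_op G \<xi>) \<le> b * ell2_norm \<xi>"
proof -
  let ?N = "\<lambda>x. {y. (x, y) \<in> parcs G}"
  have pt: "(cmod (adj_op G \<xi> x))\<^sup>2 \<le> b * v x * (\<Sum>y\<in>?N x. (cmod (\<xi> y))\<^sup>2 / v y)" for x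
  proof -
    have "cmod (adj_op G \<xi> x) \<le> (\<Sum>y\<in>?N x. \<bar>sqrt (v y)\<bar> * \<bar>cmod (\<xi> y) / sqrt (v y)\<bar>)"
      unfolding adj_op_def using pos by (intro order_trans[OF norm_sum] sum_mono) (simp add: less_imp_le less_imp_neq[symmetric])
    also have "\<dots> \<le> L2_set (\<lambda>y. sqrt (v y)) (?N x) * L2_set (\<lambda>y. cmod (\<xi> y) / sqrt (v y)) (?N x)"
      by (rule L2_set_mult_ineq)
    finally have "(cmod (adj_op G \<xi> x))\<^sup>2 \<le>
        (L2_set (\<lambda>y. sqrt (v y)) (?N x) * L2_set (\<lambda>y. cmod (\<xi> y) / sqrt (v y)) (?N x))\<^sup>2"
      by (intro power_mono) auto
    also have "\<dots> = (\<Sum>y\<in>?N x. v y) * (\<Sum>y\<in>?N x. (cmod (\<xi> y))\<^sup>2 / v y)"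
      using pos by (simp add: L2_set_def power_mult_distrib sum_nonneg less_imp_le power_divide)
    also have "\<dots> \<le> b * v x * (\<Sum>y\<in>?N x. (cmod (\<xi> y))\<^sup>2 / v y)"
      using pos by (intro mult_right_mono le sum_nonneg) (simp add: less_imp_le)
    finally show ?thesis .
  qed
  have bd: "(\<Sum>x\<in>F. (cmod (adj_op G \<xi> x))\<^sup>2) \<le> (b * ell2_norm \<xi>)\<^sup>2" if F: "finite F" for F
  proof -
    let ?U = "\<Union>x\<in>F. ?N x"
    have U: "finite ?U" using F fin by auto
    have "(\<Sum>x\<in>F. (cmod (adj_op G \<xi> x))\<^sup>2) \<le> (\<Sum>x\<in>F. b * v x * (\<Sum>y\<in>?N x. (cmod (\<xi> y))\<^sup>2 / v y))"
      by (intro sum_mono pt)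
    also have "\<dots> = (\<Sum>x\<in>F. \<Sum>y\<in>?U. if (x, y) \<in> parcs G then b * v x * ((cmod (\<xi> y))\<^sup>2 / v y) else 0)"
      unfolding sum_distrib_left using F U
      by (intro sum.cong refl sum.mono_neutral_cong_left) (auto simp: fin)
    also have "\<dots> = (\<Sum>y\<in>?U. \<Sum>x\<in>F. if (x, y) \<in> parcs G then b * v x * ((cmod (\<xi> y))\<^sup>2 / v y) else 0)"
      by (rule sum.swap)
    also have "\<dots> \<le> (\<Sum>y\<in>?U. b\<^sup>2 * (cmod (\<xi> y))\<^sup>2)"
    proof (rule sum_mono)
      fix y
      have "(\<Sum>x\<in>F. if (x, y) \<in> parcs G then b * v x * ((cmod (\<xi> y))\<^sup>2 / v y) else 0) =
          (\<Sum>x\<in>F \<inter> ?N y. b * v x * ((cmod (\<xi> y))\<^sup>2 / v y))"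
        using F sym by (intro sum.mono_neutral_cong_right) auto
      also have "\<dots> \<le> (\<Sum>x\<in>?N y. b * v x * ((cmod (\<xi> y))\<^sup>2 / v y))"
        using fin b pos by (intro sum_mono2) (auto simp: less_imp_le)
      also have "\<dots> = b * ((cmod (\<xi> y))\<^sup>2 / v y) * (\<Sum>x\<in>?N y. v x)"
        by (simp add: sum_distrib_left sum_divide_distrib mult_ac)
      also have "\<dots> \<le> b * ((cmod (\<xi> y))\<^sup>2 / v y) * (b * v y)"
        using pos b by (intro mult_left_mono le) (auto simp: less_imp_le)
      also have "\<dots> = b\<^sup>2 * (cmod (\<xi> y))\<^sup>2" using pos[of y] by (simp add: power2_eq_square)
      finally show "(\<Sum>x\<in>F. if (x, y) \<in> parcs G then b * v x * ((cmod (\<xi> y))\<^sup>2 / v y) else 0)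
          \<le> b\<^sup>2 * (cmod (\<xi> y))\<^sup>2" .
    qed
    also have "\<dots> \<le> b\<^sup>2 * (ell2_norm \<xi>)\<^sup>2"
      unfolding sum_distrib_left[symmetric] by (intro mult_left_mono ell2_sum_le \<xi> U) auto
    finally show ?thesis by (simp add: power_mult_distrib)
  qed
  from ell2I[OF bd] b show "adj_op G \<xi> \<in> ell2" "ell2_norm (adj_op G \<xi>) \<le> b * ell2_norm \<xi>"
    by auto
qed

text \<open>Functional calculus by power series. The coefficients form an \<open>fps\<close>, so
  that identities between scalar functions are proved in the ring of formal power series and then
  transferred to operators.\<close>

definition adj_series :: "'a pair_pre_digraph \<Rightarrow> complex fps \<Rightarrow> 'a operator" where
  "adj_series G c \<xi> = (\<lambda>x. \<Sum>m. fps_nth c m * (adj_op G ^^ m) \<xi> x)"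

text \<open>\<open>b\<close> is an upper bound and not the norm, so that one value serves all boxes
  and the infinite comb.\<close>

locale bounded_graph =
  fixes G :: "'a pair_pre_digraph" and b :: real
  assumes sym: "(x, y) \<in> parcs G \<Longrightarrow> (y, x) \<in> parcs G"
    and fin: "finite {y. (x, y) \<in> parcs G}"
    and b_nonneg: "b \<ge> 0"
    and adj_op_ell2: "\<xi> \<in> ell2 \<Longrightarrow> adj_op G \<xi> \<in> ell2"
    and adj_op_norm_le: "\<xi> \<in> ell2 \<Longrightarrow> ell2_norm (adj_op G \<xi>) \<le> b * ell2_norm \<xi>"
begin

lemma pow_ell2: "\<xi> \<in> ell2 \<Longrightarrow> (adj_op G ^^ m) \<xi> \<in> ell2"
  by (induction m) (auto intro: adj_op_ell2)

lemma pow_norm_le: "\<xi> \<in> ell2 \<Longrightarrow> ell2_norm ((adj_op G ^^ m) \<xi>) \<le> b ^ m * ell2_norm \<xi>"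
proof (induction m)
  case (Suc m)
  have "ell2_norm ((adj_op G ^^ Suc m) \<xi>) \<le> b * ell2_norm ((adj_op G ^^ m) \<xi>)"
    using adj_op_norm_le[OF pow_ell2[OF Suc(2)]] by simp
  also have "\<dots> \<le> b * (b ^ m * ell2_norm \<xi>)" using Suc b_nonneg by (intro mult_left_mono) auto
  finally show ?case by (simp add: mult.assoc)
qed auto

lemma pow_cmod_le: "\<xi> \<in> ell2 \<Longrightarrow> cmod ((adj_op G ^^ m) \<xi> x) \<le> b ^ m * ell2_norm \<xi>"
  using cmod_le_ell2_norm[OF pow_ell2] pow_norm_le order_trans by blast

text \<open>A weighted l1 algebra under the Cauchy product; membership makes the operator series
  converge absolutely in norm.\<close>

definition admissible :: "complex fps \<Rightarrow> bool" where
  "admissible c \<longleftrightarrow> summable (\<lambda>m. cmod (fps_nth c m) * b ^ m)"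

context
  fixes c and \<xi> :: "'a \<Rightarrow> complex" assumes c: "admissible c" and \<xi>: "\<xi> \<in> ell2"
begin

lemma series_term:
  "(\<lambda>x. fps_nth c m * (adj_op G ^^ m) \<xi> x) \<in> ell2"
  "ell2_norm (\<lambda>x. fps_nth c m * (adj_op G ^^ m) \<xi> x) \<le> cmod (fps_nth c m) * b ^ m * ell2_norm \<xi>"
  using ell2_scale[OF pow_ell2[OF \<xi>, of m]] mult_left_mono[OF pow_norm_le[OF \<xi>, of m]]
  by (auto simp: mult.assoc)

lemma series_summable_bound: "summable (\<lambda>m. cmod (fps_nth c m) * b ^ m * ell2_norm \<xi>)"
  using c unfolding admissible_def by (rule summable_mult2)

lemmas series_facts = ell2_suminf[OF series_term series_summable_bound]

lemma adj_series_ell2: "adj_series G c \<xi> \<in> ell2"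
  unfolding adj_series_def by (rule series_facts(1))

lemma adj_series_norm_le:
  "ell2_norm (adj_series G c \<xi>) \<le> (\<Sum>m. cmod (fps_nth c m) * b ^ m) * ell2_norm \<xi>"
  unfolding adj_series_def
  using series_facts(2) c unfolding admissible_def by (simp add: suminf_mult2)

lemma adj_series_summable: "summable (\<lambda>m. cmod (fps_nth c m * (adj_op G ^^ m) \<xi> x))"
  by (rule series_facts(3))

lemma adj_series_inner_sums:
  "\<eta> \<in> ell2 \<Longrightarrow>
    (\<lambda>m. fps_nth c m * ell2_inner \<eta> ((adj_op G ^^ m) \<xi>)) sums ell2_inner \<eta> (adj_series G c \<xi>)"
  unfolding adj_series_def using series_facts(4) by (simp add: ell2_inner_scale)

text \<open>Neighbour sums are finite and can be exchanged with the series.\<close>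

lemma adj_op_adj_series: "adj_op G (adj_series G c \<xi>) = adj_series G c (adj_op G \<xi>)"
proof
  fix x
  have "(\<lambda>m. \<Sum>y | (x, y) \<in> parcs G. fps_nth c m * (adj_op G ^^ m) \<xi> y) sums
      (\<Sum>y | (x, y) \<in> parcs G. \<Sum>m. fps_nth c m * (adj_op G ^^ m) \<xi> y)"
    by (intro sums_sum summable_sums summable_norm_cancel[OF adj_series_summable])
  moreover have "(\<Sum>y | (x, y) \<in> parcs G. fps_nth c m * (adj_op G ^^ m) \<xi> y) =
      fps_nth c m * (adj_op G ^^ m) (adj_op G \<xi>) x" for m
    unfolding funpow_swap1[symmetric] adj_op_def[of G "(adj_op G ^^ m) \<xi>"] sum_distrib_left ..
  ultimately show "adj_op G (adj_series G c \<xi>) x = adj_series G c (adj_op G \<xi>) x"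
    unfolding adj_series_def adj_op_def[of G "\<lambda>x. \<Sum>m. fps_nth c m * (adj_op G ^^ m) \<xi> x"]
    by (simp add: sums_iff)
qed

end

lemma pow_adj_series:
  assumes "admissible c" "\<xi> \<in> ell2"
  shows "(adj_op G ^^ k) (adj_series G c \<xi>) = adj_series G c ((adj_op G ^^ k) \<xi>)"
  using assms by (induction k) (auto simp: adj_op_adj_series pow_ell2)

lemma adj_series_add:
  assumes "admissible c" "admissible d" "\<xi> \<in> ell2"
  shows "adj_series G (c + d) \<xi> = (\<lambda>x. adj_series G c \<xi> x + adj_series G d \<xi> x)"
  unfolding adj_series_def
  using suminf_add[OF summable_norm_cancel[OF adj_series_summable[OF assms(1,3)]]
      summable_norm_cancel[OF adj_series_summable[OF assms(2,3)]]]
  by (auto simp: ring_distribs)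

lemma adj_series_scale:
  assumes "admissible c" "\<xi> \<in> ell2"
  shows "adj_series G (fps_const a * c) \<xi> = (\<lambda>x. a * adj_series G c \<xi> x)"
  unfolding adj_series_def
  using suminf_mult[OF summable_norm_cancel[OF adj_series_summable[OF assms]]]
  by (auto simp: mult.assoc)

lemma adj_series_linear:
  assumes "admissible c" "\<xi> \<in> ell2" "\<eta> \<in> ell2"
  shows "adj_series G c (\<lambda>x. a * \<xi> x + \<eta> x) = (\<lambda>x. a * adj_series G c \<xi> x + adj_series G c \<eta> x)"
proof
  fix x
  note s = adj_series_summable[OF assms(1,2), of x] adj_series_summable[OF assms(1,3), of x]
  have "(\<lambda>m. a * (fps_nth c m * (adj_op G ^^ m) \<xi> x) + fps_nth c m * (adj_op G ^^ m) \<eta> x) sums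
     (a * (\<Sum>m. fps_nth c m * (adj_op G ^^ m) \<xi> x) + (\<Sum>m. fps_nth c m * (adj_op G ^^ m) \<eta> x))"
    by (intro sums_add sums_mult summable_sums summable_norm_cancel[OF s(1)] summable_norm_cancel[OF s(2)])
  then show "adj_series G c (\<lambda>x. a * \<xi> x + \<eta> x) x = a * adj_series G c \<xi> x + adj_series G c \<eta> x"
    unfolding adj_series_def
    by (simp only: adj_op_pow_linear distrib_left mult.left_commute[of _ a] sums_iff)
qed

lemma adj_series_1: "adj_series G 1 \<xi> = \<xi>"
proof
  fix x
  have "(\<lambda>m. fps_nth 1 m * (adj_op G ^^ m) \<xi> x) sums (\<Sum>m\<in>{0}. fps_nth 1 m * (adj_op G ^^ m) \<xi> x)"
    by (rule sums_finite) auto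
  then show "adj_series G 1 \<xi> x = \<xi> x" by (simp add: adj_series_def sums_iff)
qed

lemma adj_series_X: "adj_series G fps_X \<xi> = adj_op G \<xi>"
proof
  fix x
  have "(\<lambda>m. fps_nth fps_X m * (adj_op G ^^ m) \<xi> x) sums
      (\<Sum>m\<in>{1}. fps_nth fps_X m * (adj_op G ^^ m) \<xi> x)"
    by (rule sums_finite) auto
  then show "adj_series G fps_X \<xi> x = adj_op G \<xi> x" by (simp add: adj_series_def sums_iff)
qed

lemma admissible_finite:
  assumes "\<And>m. m > k \<Longrightarrow> fps_nth c m = 0" shows "admissible c"
  unfolding admissible_def by (rule summable_finite[of "{..k}"]) (use assms in \<open>auto simp: not_le\<close>)

lemma admissible_1 [simp]: "admissible 1" by (rule admissible_finite[of 0]) auto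
lemma admissible_X [simp]: "admissible fps_X" by (rule admissible_finite[of 1]) auto
lemma admissible_const [simp]: "admissible (fps_const a)" by (rule admissible_finite[of 0]) auto

lemma admissible_add [simp]: "admissible c \<Longrightarrow> admissible d \<Longrightarrow> admissible (c + d)"
  unfolding admissible_def
  by (rule summable_comparison_test[OF _ summable_add[of "\<lambda>m. cmod (fps_nth c m) * b ^ m" "\<lambda>m. cmod (fps_nth d m) * b ^ m"]])
     (auto simp: abs_mult b_nonneg distrib_right[symmetric] intro!: mult_right_mono norm_triangle_ineq)

lemma admissible_mult [simp]:
  assumes "admissible c" "admissible d" shows "admissible (c * d)"
proof -
  have s: "summable (\<lambda>m. \<Sum>i\<le>m. (cmod (fps_nth c i) * b ^ i) * (cmod (fps_nth d (m - i)) * b ^ (m - i)))"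
    using assms unfolding admissible_def
    by (intro summable_Cauchy_product) (auto simp: abs_mult b_nonneg)
  have "cmod (fps_nth (c * d) m) * b ^ m \<le>
      (\<Sum>i\<le>m. (cmod (fps_nth c i) * b ^ i) * (cmod (fps_nth d (m - i)) * b ^ (m - i)))" for m
  proof -
    have "cmod (fps_nth (c * d) m) * b ^ m \<le> (\<Sum>i\<le>m. cmod (fps_nth c i * fps_nth d (m - i))) * b ^ m"
      unfolding fps_mult_nth atLeast0AtMost by (intro mult_right_mono norm_sum) (auto simp: b_nonneg)
    also have "\<dots> = (\<Sum>i\<le>m. (cmod (fps_nth c i) * b ^ i) * (cmod (fps_nth d (m - i)) * b ^ (m - i)))"
      unfolding sum_distrib_right
    proof (rule sum.cong[OF refl])
      fix i assume "i \<in> {..m}"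
      then have "b ^ m = b ^ i * b ^ (m - i)" by (simp flip: power_add)
      then show "cmod (fps_nth c i * fps_nth d (m - i)) * b ^ m =
        cmod (fps_nth c i) * b ^ i * (cmod (fps_nth d (m - i)) * b ^ (m - i))" by (simp add: norm_mult)
    qed
    finally show ?thesis .
  qed
  then show ?thesis unfolding admissible_def
    by (intro summable_comparison_test[OF _ s]) (auto simp: abs_mult b_nonneg)
qed

text \<open>Both sides sum one absolutely summable family over pairs (m, k): by rows it gives the
  iterated series, along the antidiagonals of constant m + k the Cauchy product.\<close>

lemma adj_series_mult:
  assumes c: "admissible c" and d: "admissible d" and \<xi>: "\<xi> \<in> ell2"
  shows "adj_series G (c * d) \<xi> = adj_series G c (adj_series G d \<xi>)"
proof
  fix x
  let ?t = "\<lambda>m. (adj_op G ^^ m) \<xi> x"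
  let ?f = "\<lambda>(m, k). fps_nth c m * fps_nth d k * ?t (m + k)"
  have rows: "((\<lambda>k. ?f (m, k)) has_sum fps_nth c m * (adj_op G ^^ m) (adj_series G d \<xi>) x) UNIV" for m
  proof -
    note s = adj_series_summable[OF d pow_ell2[OF \<xi>], of m x]
    have comm: "(adj_op G ^^ m) ((adj_op G ^^ k) \<xi>) = (adj_op G ^^ k) ((adj_op G ^^ m) \<xi>)" for k
      by (metis add.commute comp_apply funpow_add)
    have "((\<lambda>k. fps_nth d k * (adj_op G ^^ k) ((adj_op G ^^ m) \<xi>) x) has_sum
        adj_series G d ((adj_op G ^^ m) \<xi>) x) UNIV"
      unfolding adj_series_def
      by (rule norm_summable_imp_has_sum[OF s summable_sums[OF summable_norm_cancel[OF s]]])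
    from has_sum_cmult_right[OF this, of "fps_nth c m"] show ?thesis
      by (simp add: pow_adj_series[OF d \<xi>] mult.assoc funpow_add comm)
  qed
  have abs: "(\<lambda>p. cmod (?f p)) summable_on UNIV"
  proof -
    let ?p = "\<lambda>m. cmod (fps_nth c m) * b ^ m" and ?q = "\<lambda>m. cmod (fps_nth d m) * b ^ m"
    have pq: "?p summable_on UNIV" "?q summable_on UNIV"
      using c d unfolding admissible_def
      by (auto intro!: norm_summable_imp_summable_on simp: abs_mult b_nonneg)
    have "(\<lambda>(m, k). ?p m * ?q k) summable_on UNIV"
      by (rule summable_on_product_nonneg) (use pq b_nonneg in auto)
    from summable_on_cmult_left[OF this, of "ell2_norm \<xi>"]
    have "(\<lambda>(m, k). ?p m * ?q k * ell2_norm \<xi>) summable_on UNIV"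
      by (simp add: case_prod_unfold)
    then show ?thesis
    proof (rule Infinite_Sum.abs_summable_on_comparison_test')
      fix p :: "nat \<times> nat"
      obtain m k where p: "p = (m, k)" by force
      have "cmod (fps_nth c m * fps_nth d k) * cmod (?t (m + k)) \<le>
          cmod (fps_nth c m * fps_nth d k) * (b ^ (m + k) * ell2_norm \<xi>)"
        by (intro mult_left_mono pow_cmod_le \<xi>) auto
      then show "cmod (?f p) \<le> (\<lambda>(m, k). ?p m * ?q k * ell2_norm \<xi>) p"
        by (simp add: p norm_mult power_add mult_ac)
    qed
  qed
  have sum1: "infsum ?f UNIV = adj_series G c (adj_series G d \<xi>) x"
  proof -
    have sf: "?f summable_on UNIV \<times> UNIV"
      using Infinite_Sum.abs_summable_summable[OF abs] by simp
    have "infsum ?f (UNIV \<times> UNIV) = (\<Sum>\<^sub>\<infinity>m. \<Sum>\<^sub>\<infinity>k. ?f (m, k))"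
      using infsum_Sigma_banach[OF sf] by simp
    also have "\<dots> = (\<Sum>\<^sub>\<infinity>m. fps_nth c m * (adj_op G ^^ m) (adj_series G d \<xi>) x)"
      by (intro infsum_cong infsumI rows)
    also have "\<dots> = adj_series G c (adj_series G d \<xi>) x"
    proof -
      note s = adj_series_summable[OF c adj_series_ell2[OF d \<xi>], of x]
      show ?thesis unfolding adj_series_def[of G c]
        by (rule infsumI[OF norm_summable_imp_has_sum[OF s summable_sums[OF summable_norm_cancel[OF s]]]])
    qed
    finally show ?thesis by simp
  qed
  have "infsum ?f UNIV = (\<Sum>\<^sub>\<infinity>m. \<Sum>\<^sub>\<infinity>i\<in>{..m}. ?f (i, m - i))"
  proof -
    have bij: "bij_betw (\<lambda>(m, i). (i, m - i)) (Sigma UNIV (\<lambda>m::nat. {..m})) (UNIV :: (nat \<times> nat) set)"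
      by (rule bij_betwI[where g="\<lambda>(i, k). (i + k, i)"]) auto
    have s: "(\<lambda>p. ?f ((\<lambda>(m, i). (i, m - i)) p)) summable_on Sigma UNIV (\<lambda>m::nat. {..m})"
      using summable_on_reindex_bij_betw[OF bij, of ?f] Infinite_Sum.abs_summable_summable[OF abs] by simp
    have "infsum ?f UNIV = infsum (\<lambda>p. ?f ((\<lambda>(m, i). (i, m - i)) p)) (Sigma UNIV (\<lambda>m::nat. {..m}))"
      by (rule infsum_reindex_bij_betw[OF bij, symmetric])
    also have "\<dots> = (\<Sum>\<^sub>\<infinity>m. \<Sum>\<^sub>\<infinity>i\<in>{..m}. ?f (i, m - i))"
      using infsum_Sigma_banach[OF s] by simp
    finally show ?thesis .
  qed
  also have "\<dots> = (\<Sum>\<^sub>\<infinity>m. fps_nth (c * d) m * ?t m)"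
    by (intro infsum_cong) (simp add: fps_mult_nth atLeast0AtMost sum_distrib_right)
  also have "\<dots> = adj_series G (c * d) \<xi> x"
  proof -
    note s = adj_series_summable[OF admissible_mult[OF c d] \<xi>, of x]
    show ?thesis unfolding adj_series_def
      by (rule infsumI[OF norm_summable_imp_has_sum[OF s summable_sums[OF summable_norm_cancel[OF s]]]])
  qed
  finally show "adj_series G (c * d) \<xi> x = adj_series G c (adj_series G d \<xi>) x"
    using sum1 by simp
qed

end

section \<open>The Bose function minus its pole\<close>

text \<open>The zeros of exp (\<beta> * y) - 1 are the multiples of 2 * pi * i / \<beta>, and
  \<open>S\<close> is the plane without the two rays of the imaginary axis that start at the nonzero
  zeros nearest to 0. Let \<phi> be (exp (\<beta> * y) - 1) / y, continued by \<beta> at 0. The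
  remainder \<open>h\<close> is the difference quotient of 1 / \<phi> at 0, and
  \<open>pole_lemma\<close> removes both singularities.\<close>

lemma bose_minus_pole_holomorphic:
  fixes \<beta> :: real
  assumes "\<beta> > 0"
  defines "S \<equiv> {y. Re y \<noteq> 0} \<union> {y. \<bar>Im y\<bar> < 2 * pi / \<beta>}"
  obtains h where "open S" "h holomorphic_on S"
    "\<And>y. y \<in> S \<Longrightarrow> y \<noteq> 0 \<Longrightarrow> exp (of_real \<beta> * y) \<noteq> 1"
    "\<And>y. y \<in> S \<Longrightarrow> y \<noteq> 0 \<Longrightarrow> 1 / (exp (of_real \<beta> * y) - 1) = 1 / (of_real \<beta> * y) + h y"
proof -
  have open_S: "open S"
    unfolding S_def by (intro open_Un open_Collect_neq open_Collect_less continuous_intros)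
  have 0: "0 \<in> S" using assms by (simp add: S_def)
  have ne: "exp (of_real \<beta> * y) \<noteq> 1" if "y \<in> S" "y \<noteq> 0" for y
  proof
    assume "exp (of_real \<beta> * y) = 1"
    then obtain k :: int where k: "\<beta> * Re y = 0" "\<beta> * Im y = of_int (2 * k) * pi"
      by (auto simp: exp_eq_1)
    then have re: "Re y = 0" using assms by simp
    with that have "\<bar>Im y\<bar> < 2 * pi / \<beta>" by (simp add: S_def)
    then have "\<bar>\<beta> * Im y\<bar> < 2 * pi" using assms by (simp add: abs_mult field_simps)
    then have "\<bar>of_int k\<bar> < (1::real)" unfolding k using pi_gt_zero by (simp add: abs_mult)
    then have "k = 0" by linarith
    then have "Im y = 0" using k assms by simp
    with re that show False by (simp add: complex_eq_iff)
  qed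
  define f where "f = (\<lambda>y::complex. exp (of_real \<beta> * y) - 1)"
  define \<phi> where "\<phi> = (\<lambda>y. if y = 0 then deriv f 0 else (f y - f 0) / (y - 0))"
  have "\<phi> holomorphic_on S" unfolding \<phi>_def
    by (rule pole_lemma) (use 0 open_S in \<open>auto simp: f_def interior_open intro!: holomorphic_intros\<close>)
  moreover have df: "deriv f 0 = of_real \<beta>"
    unfolding f_def by (rule DERIV_imp_deriv) (auto intro!: derivative_eq_intros)
  moreover have "\<phi> y \<noteq> 0" if "y \<in> S" for y
    using ne[OF that] assms df by (auto simp: \<phi>_def f_def)
  ultimately have hol: "(\<lambda>y. 1 / \<phi> y) holomorphic_on S" by (intro holomorphic_intros) auto
  define h where "h = (\<lambda>y. if y = 0 then deriv (\<lambda>y. 1 / \<phi> y) 0 else (1 / \<phi> y - 1 / \<phi> 0) / (y - 0))"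
  have "h holomorphic_on S" unfolding h_def
    by (rule pole_lemma) (use 0 open_S hol in \<open>auto simp: interior_open\<close>)
  moreover have "1 / (exp (of_real \<beta> * y) - 1) = 1 / (of_real \<beta> * y) + h y" if "y \<in> S" "y \<noteq> 0" for y
  proof -
    have "exp (of_real \<beta> * y) - 1 \<noteq> 0" using ne[OF that] by simp
    then show ?thesis using that df assms by (simp add: h_def \<phi>_def f_def field_simps)
  qed
  ultimately show ?thesis using that open_S ne by blast
qed

section \<open>Taylor coefficients of the Bose function and of its pole\<close>

definition resolvent_fps :: "real \<Rightarrow> complex fps" where
  "resolvent_fps z = Abs_fps (\<lambda>m. 1 / of_real z ^ Suc m)"

lemma resolvent_fps_eq:
  assumes "z \<noteq> 0"
  shows "(fps_const (of_real z) - fps_X) * resolvent_fps z = 1"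
proof (rule fps_ext)
  fix m show "fps_nth ((fps_const (of_real z) - fps_X) * resolvent_fps z) m = fps_nth 1 m"
    using assms by (cases m) (auto simp: resolvent_fps_def left_diff_distrib)
qed

definition exp_hamiltonian_fps :: "real \<Rightarrow> real \<Rightarrow> complex fps" where
  "exp_hamiltonian_fps \<beta> z = fps_const (exp (of_real (\<beta> * z))) * fps_exp (- of_real \<beta>)"

text \<open>The Taylor coefficients of \<open>1 / (exp (\<beta> * (z - x)) - 1)\<close> split into those of the pole
  \<open>1 / (\<beta> * (z - x))\<close> and those of a function that is analytic up to \<open>z \<plusminus> 2 * pi * \<i> / \<beta>\<close>.
  These points have modulus greater than \<open>a\<close>, which makes the second part summable at \<open>a\<close>,
  uniformly in \<open>z\<close>.\<close>

lemma bose_coefficients: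
  fixes \<beta> a L :: real
  assumes \<beta>: "\<beta> > 0" and a: "a > 0"
  obtains g :: "real \<Rightarrow> complex fps" and C q where "0 \<le> q" "q < 1" "0 \<le> C"
    "\<And>z m. a \<le> z \<Longrightarrow> z \<le> L \<Longrightarrow> cmod (fps_nth (g z) m) * a ^ m \<le> C * q ^ m"
    "\<And>m. continuous_on {a..} (\<lambda>z. fps_nth (g z) m)"
    "\<And>z. a \<le> z \<Longrightarrow> (exp_hamiltonian_fps \<beta> z - 1) *
       (fps_const (1 / of_real \<beta>) * resolvent_fps z + g z) = 1"
proof -
  define S where "S = {y. Re y \<noteq> 0} \<union> {y. \<bar>Im y\<bar> < 2 * pi / \<beta>}"
  obtain h where S: "open S" and h: "h holomorphic_on S"
    and ne: "\<And>y. y \<in> S \<Longrightarrow> y \<noteq> 0 \<Longrightarrow> exp (of_real \<beta> * y) \<noteq> 1"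
    and heq: "\<And>y. y \<in> S \<Longrightarrow> y \<noteq> 0 \<Longrightarrow> 1 / (exp (of_real \<beta> * y) - 1) = 1 / (of_real \<beta> * y) + h y"
    by (rule bose_minus_pole_holomorphic[OF \<beta>, folded S_def]) (rule that; assumption)
  \<comment> \<open>The distance from 0 to the points a +- 2 * pi * i / \<beta>, the nearest
    singularities for z = a; larger z move them farther away.\<close>
  define \<rho> where "\<rho> = sqrt (a\<^sup>2 + (2 * pi / \<beta>)\<^sup>2)"
  have \<rho>: "a < \<rho>" unfolding \<rho>_def using a \<beta> by (intro real_less_rsqrt) auto
  \<comment> \<open>The room between \<open>a\<close> and \<open>\<rho>\<close> produces the ratio q
    = a / r < 1.\<close>
  obtain r where r: "a < r" "r < \<rho>" using dense[OF \<rho>] by blast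
  have inS: "of_real z - x \<in> S" if "a \<le> z" "cmod x < \<rho>" for z :: real and x
  proof (cases "Re x = z")
    case True
    have "(cmod x)\<^sup>2 < \<rho>\<^sup>2" using that by (intro power_strict_mono) auto
    then have "(Re x)\<^sup>2 + (Im x)\<^sup>2 < a\<^sup>2 + (2 * pi / \<beta>)\<^sup>2"
      by (simp add: cmod_power2 \<rho>_def)
    moreover have "a\<^sup>2 \<le> (Re x)\<^sup>2" using that True a by (intro power_mono) auto
    ultimately have "(Im x)\<^sup>2 < (2 * pi / \<beta>)\<^sup>2" by linarith
    then have "\<bar>Im x\<bar> < 2 * pi / \<beta>"
      using \<beta> by (intro power2_less_imp_less[of "\<bar>Im x\<bar>"]) auto
    then show ?thesis using True by (simp add: S_def)
  qed (auto simp: S_def)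
  define g where "g = (\<lambda>z::real. fps_expansion (\<lambda>x. h (of_real z - x)) 0)"
  have nth: "fps_nth (g z) m = (deriv ^^ m) (\<lambda>x. h (of_real z - x)) 0 / fact m" for z m
    by (simp add: g_def fps_expansion_def)
  have hol: "(\<lambda>x. h (of_real z - x)) holomorphic_on ball 0 \<rho>" if "a \<le> z" for z
  proof -
    have "(\<lambda>x. of_real z - x) holomorphic_on ball 0 \<rho>" by (intro holomorphic_intros)
    moreover have "(\<lambda>x. of_real z - x) ` ball 0 \<rho> \<subseteq> S" using inS[OF that] by auto
    ultimately show ?thesis using holomorphic_on_compose_gen[OF _ h] by (simp add: o_def)
  qed
  have r0: "r > 0" using a r by linarith
  \<comment> \<open>Cauchy's estimate needs one bound for all z: the differences z - x range over a
    compact subset of \<open>S\<close>. This is where the upper limit \<open>L\<close>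
    enters.\<close>
  obtain B where B: "B > 0" "\<And>z x. z \<in> {a..L} \<Longrightarrow> cmod x \<le> r \<Longrightarrow> cmod (h (of_real z - x)) \<le> B"
  proof -
    let ?K = "(\<lambda>(z, x). of_real z - x) ` ({a..L} \<times> cball (0::complex) r)"
    have "continuous_on ({a..L} \<times> cball 0 r) (\<lambda>(z, x). of_real z - x :: complex)"
      by (auto simp: case_prod_unfold intro!: continuous_intros)
    then have "compact ?K"
      by (rule compact_continuous_image) (auto intro!: compact_Times)
    moreover have "?K \<subseteq> S" using inS r by auto
    ultimately have "bounded (h ` ?K)"
      using compact_imp_bounded compact_continuous_image continuous_on_subset
        holomorphic_on_imp_continuous_on[OF h] by metis
    then obtain B where "B > 0" "\<forall>y \<in> h ` ?K. cmod y \<le> B" unfolding bounded_pos by blast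
    then show ?thesis by (intro that[of B]) (auto simp: dist_norm)
  qed
  show ?thesis
  proof (rule that[of "a / r" B g])
    show "0 \<le> a / r" "a / r < 1" "0 \<le> B" using r a B by auto
    fix z m assume z: "a \<le> z" "z \<le> L"
    have "cmod ((deriv ^^ m) (\<lambda>x. h (of_real z - x)) 0) \<le> fact m * B / r ^ m"
    proof (rule Cauchy_inequality[OF _ _ r0])
      show "(\<lambda>x. h (of_real z - x)) holomorphic_on ball 0 r"
        by (rule holomorphic_on_subset[OF hol[OF z(1)]]) (use r in auto)
      show "continuous_on (cball 0 r) (\<lambda>x. h (of_real z - x))"
        by (rule continuous_on_subset[OF holomorphic_on_imp_continuous_on[OF hol[OF z(1)]]]) (use r in auto)
      show "cmod (h (of_real z - x)) \<le> B" if "cmod (0 - x) = r" for x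
        using B(2)[of z x] z that by auto
    qed
    then have "cmod (fps_nth (g z) m) * a ^ m \<le> B / r ^ m * a ^ m"
      unfolding nth using a
      by (intro mult_right_mono) (auto simp: norm_divide field_simps)
    then show "cmod (fps_nth (g z) m) * a ^ m \<le> B * (a / r) ^ m" by (simp add: power_divide)
  next
    fix m
    \<comment> \<open>The chain rule moves the dependence on z from the function to the point of
      evaluation, where continuity of the derivatives of \<open>h\<close> is available.\<close>
    have eq: "fps_nth (g z) m = (-1) ^ m * (deriv ^^ m) h (of_real z) / fact m" if "z \<in> {a..}" for z
      using higher_deriv_compose_linear'[of h S "ball 0 \<rho>" 0 "-1" "of_real z" m] h S inS[of z] a \<rho> that
      unfolding nth by auto
    have co: "continuous_on {a..} (\<lambda>z. (-1) ^ m * (deriv ^^ m) h (of_real z) / fact m)"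
    proof -
      have "continuous_on S ((deriv ^^ m) h)"
        by (intro holomorphic_on_imp_continuous_on holomorphic_higher_deriv h S)
      then have "continuous_on {a..} (\<lambda>z. (deriv ^^ m) h (of_real z))"
        by (rule continuous_on_compose2) (use a in \<open>auto simp: S_def intro!: continuous_intros\<close>)
      then show ?thesis by (intro continuous_intros) auto
    qed
    show "continuous_on {a..} (\<lambda>z. fps_nth (g z) m)"
      by (rule iffD2[OF continuous_on_cong[OF refl eq] co])
  next
    fix z assume z: "a \<le> z"
    have ge: "(\<lambda>x. h (of_real z - x)) has_fps_expansion g z"
      unfolding g_def by (rule has_fps_expansion_fps_expansion[OF _ _ hol[OF z]]) (use a \<rho> in auto)
    have ex: "(\<lambda>x. exp (of_real (\<beta> * z)) * exp (- of_real \<beta> * x)) has_fps_expansion exp_hamiltonian_fps \<beta> z"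
      unfolding exp_hamiltonian_fps_def by (intro fps_expansion_intros)
    have re: "(\<lambda>x. inverse (of_real z - x)) has_fps_expansion resolvent_fps z"
    proof -
      have "resolvent_fps z = inverse (fps_const (of_real z) - fps_X)"
        using resolvent_fps_eq[of z] z a
        by (metis fps_inverse_unique less_le_trans less_numeral_extra(3))
      then show ?thesis
        using has_fps_expansion_inverse[of "\<lambda>x. of_real z - x" "fps_const (of_real z) - fps_X :: complex fps"] a z
        by (auto intro!: fps_expansion_intros)
    qed
    have e1: "(\<lambda>x. (exp (of_real (\<beta> * z)) * exp (- of_real \<beta> * x) - 1) *
        (1 / of_real \<beta> * inverse (of_real z - x) + h (of_real z - x))) has_fps_expansion
        (exp_hamiltonian_fps \<beta> z - 1) * (fps_const (1 / of_real \<beta>) * resolvent_fps z + g z)"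
      by (intro fps_expansion_intros ge ex re)
    \<comment> \<open>Near 0 the point z - x lies in \<open>S\<close> and differs from 0, so the
      scalar identity holds; uniqueness of expansions then turns it into an identity of formal power
      series.\<close>
    have e2: "eventually (\<lambda>x. (exp (of_real (\<beta> * z)) * exp (- of_real \<beta> * x) - 1) *
        (1 / of_real \<beta> * inverse (of_real z - x) + h (of_real z - x)) = 1) (nhds 0)"
    proof -
      have "eventually (\<lambda>x::complex. x \<in> ball 0 a) (nhds 0)"
        using a by (intro eventually_nhds_in_open) auto
      then show ?thesis
      proof eventually_elim
        case (elim x)
        have S: "of_real z - x \<in> S" using inS[OF z, of x] elim \<rho> by auto
        have n0: "of_real z - x \<noteq> 0"
          using elim z a by (metis abs_of_nonneg dual_order.strict_trans2 eq_iff_diff_eq_0 less_imp_le linorder_not_less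
              mem_ball_0 norm_of_real)
        have e: "exp (of_real (\<beta> * z)) * exp (- of_real \<beta> * x) = exp (of_real \<beta> * (of_real z - x))"
          by (simp add: algebra_simps flip: exp_add)
        have "1 / of_real \<beta> * inverse (of_real z - x) + h (of_real z - x) =
            1 / (exp (of_real \<beta> * (of_real z - x)) - 1)"
          using heq[OF S n0] by (simp add: divide_inverse)
        then show ?case unfolding e using ne[OF S n0] by simp
      qed
    qed
    have "(\<lambda>x. 1) has_fps_expansion
        (exp_hamiltonian_fps \<beta> z - 1) * (fps_const (1 / of_real \<beta>) * resolvent_fps z + g z)"
      by (rule iffD1[OF has_fps_expansion_cong[OF e2 refl] e1])
    then show "(exp_hamiltonian_fps \<beta> z - 1) * (fps_const (1 / of_real \<beta>) * resolvent_fps z + g z) = 1"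
      using fps_expansion_unique_complex has_fps_expansion_1 by metis
  qed
qed

section \<open>The Green kernel of the torus\<close>

lemma one_minus_cos_le: "1 - cos x \<le> x\<^sup>2 / 2" for x :: real
proof -
  have "\<bar>sin (x / 2)\<bar>\<^sup>2 \<le> \<bar>x / 2\<bar>\<^sup>2" by (intro power_mono abs_sin_x_le_abs_x) auto
  then show ?thesis using cos_double_sin[of "x / 2"] by (simp add: power_divide)
qed

lemma cmod_one_minus_cis: "(cmod (1 - cis x))\<^sup>2 = 2 * (1 - cos x)"
  unfolding cmod_power2 using sin_cos_squared_add[of x] by (simp add: power2_eq_square algebra_simps)

lemma cmod_one_minus_mult_le:
  assumes "cmod u \<le> 1" shows "cmod (1 - u * w) \<le> cmod (1 - u) + cmod (1 - w)"
proof -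
  have "1 - u * w = (1 - u) + u * (1 - w)" by (simp add: algebra_simps)
  then have "cmod (1 - u * w) \<le> cmod (1 - u) + cmod u * cmod (1 - w)"
    by (metis norm_mult norm_triangle_ineq)
  also have "cmod u * cmod (1 - w) \<le> 1 * cmod (1 - w)" using assms by (intro mult_right_mono) auto
  finally show ?thesis by simp
qed

text \<open>Telescoping: the distance to 1 is subadditive under multiplication on the unit
  circle.\<close>

lemma cmod_one_minus_cis_int_mult_le: "cmod (1 - cis (of_int k * x)) \<le> \<bar>of_int k\<bar> * cmod (1 - cis x)"
proof -
  have nat: "cmod (1 - cis (of_nat n * x)) \<le> of_nat n * cmod (1 - cis x)" for n x
  proof (induction n)
    case (Suc n)
    have "cis (of_nat (Suc n) * x) = cis x * cis (of_nat n * x)" by (simp add: cis_mult algebra_simps)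
    then have "cmod (1 - cis (of_nat (Suc n) * x)) \<le> cmod (1 - cis x) + cmod (1 - cis (of_nat n * x))"
      using cmod_one_minus_mult_le[of "cis x" "cis (of_nat n * x)"] by simp
    then show ?case using Suc by (simp add: algebra_simps)
  qed auto
  have neg: "cmod (1 - cis (- x)) = cmod (1 - cis x)" for x
    by (rule power2_eq_imp_eq) (simp_all only: cmod_one_minus_cis cos_minus norm_ge_zero)
  show ?thesis
  proof (cases "k \<ge> 0")
    case True
    then show ?thesis using nat[of "nat k" x] by simp
  next
    case False
    then show ?thesis using nat[of "nat (- k)" x] neg[of "of_int k * x"] by simp
  qed
qed

lemma cmod_one_minus_cis_sum_le:
  "finite I \<Longrightarrow> cmod (1 - cis (\<Sum>i\<in>I. f i)) \<le> (\<Sum>i\<in>I. cmod (1 - cis (f i)))"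
proof (induction I rule: finite_induct)
  case (insert i I)
  have "cis (sum f (insert i I)) = cis (f i) * cis (sum f I)" using insert by (simp add: cis_mult)
  then have "cmod (1 - cis (sum f (insert i I))) \<le> cmod (1 - cis (f i)) + cmod (1 - cis (sum f I))"
    using cmod_one_minus_mult_le[of "cis (f i)" "cis (sum f I)"] by simp
  then show ?case using insert by simp
qed auto

definition l1 :: "int ^ 'd::finite \<Rightarrow> real" where
  "l1 x = real_of_int (\<Sum>i\<in>UNIV. \<bar>x $ i\<bar>)"

lemma l1_nonneg: "l1 x \<ge> 0" unfolding l1_def of_int_sum by (intro sum_nonneg) auto

text \<open>The quadratic vanishing of the numerator cancels the singularity of the Green kernel at
  zero momentum.\<close>

lemma one_minus_cos_sum_le:
  fixes x :: "int ^ 'd::finite"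
  shows "1 - cos (\<Sum>i\<in>UNIV. \<theta> i * of_int (x $ i)) \<le> (l1 x)\<^sup>2 * (\<Sum>i\<in>UNIV. 1 - cos (\<theta> i))"
proof -
  define c where "c = (\<lambda>i. cmod (1 - cis (\<theta> i)))"
  have c2: "(c i)\<^sup>2 = 2 * (1 - cos (\<theta> i))" for i unfolding c_def by (rule cmod_one_minus_cis)
  define M where "M = sqrt (\<Sum>i\<in>UNIV. (c i)\<^sup>2)"
  have cM: "c i \<le> M" for i
    unfolding M_def by (intro real_le_rsqrt member_le_sum) auto
  have "cmod (1 - cis (\<Sum>i\<in>UNIV. \<theta> i * of_int (x $ i))) \<le> (\<Sum>i\<in>UNIV. \<bar>of_int (x $ i)\<bar> * c i)"
    using cmod_one_minus_cis_sum_le[of UNIV "\<lambda>i. \<theta> i * of_int (x $ i)"]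
      sum_mono[of UNIV "\<lambda>i. cmod (1 - cis (\<theta> i * of_int (x $ i)))" "\<lambda>i. \<bar>of_int (x $ i)\<bar> * c i"]
      cmod_one_minus_cis_int_mult_le[of "x $ i" "\<theta> i" for i]
    unfolding c_def by (simp add: mult.commute)
  also have "\<dots> \<le> (\<Sum>i\<in>UNIV. \<bar>of_int (x $ i)\<bar> * M)" by (intro sum_mono mult_left_mono cM) auto
  also have "\<dots> = l1 x * M" by (simp add: l1_def sum_distrib_right)
  finally have "(cmod (1 - cis (\<Sum>i\<in>UNIV. \<theta> i * of_int (x $ i))))\<^sup>2 \<le> (l1 x * M)\<^sup>2"
    by (intro power_mono) auto
  then have "2 * (1 - cos (\<Sum>i\<in>UNIV. \<theta> i * of_int (x $ i))) \<le> (l1 x)\<^sup>2 * M\<^sup>2"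
    by (simp only: cmod_one_minus_cis power_mult_distrib)
  moreover have "M\<^sup>2 = 2 * (\<Sum>i\<in>UNIV. 1 - cos (\<theta> i))"
    unfolding M_def using c2 by (simp add: sum_nonneg sum_distrib_left)
  ultimately show ?thesis by simp
qed

section \<open>Fourier analysis on the discrete torus\<close>

definition momenta :: "nat \<Rightarrow> (int ^ 'd::finite) set" where
  "momenta N = {p. \<forall>i. 0 \<le> p $ i \<and> p $ i < int N}"

definition wave :: "nat \<Rightarrow> int ^ 'd::finite \<Rightarrow> int ^ 'd \<Rightarrow> real" where
  "wave N p x = (\<Sum>i\<in>UNIV. 2 * pi * (of_int (p $ i) / real N) * of_int (x $ i))"

text \<open>Eigenvalue of the adjacency operator on the plane wave of momentum 2 * pi * s.\<close>

definition symbol :: "real ^ 'd::finite \<Rightarrow> real" where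
  "symbol s = (\<Sum>i\<in>UNIV. 2 * cos (2 * pi * s $ i))"

definition momentum_point :: "nat \<Rightarrow> int ^ 'd::finite \<Rightarrow> real ^ 'd" where
  "momentum_point N p = (\<chi> i. of_int (p $ i) / real N)"

text \<open>Kernel of the inverse of \<kappa> - A on the torus of side \<open>N\<close>, in its
  Fourier basis. The symbol is even in the momentum, so cosines replace exponentials and the kernel
  is real.\<close>

definition green :: "real \<Rightarrow> nat \<Rightarrow> int ^ 'd::finite \<Rightarrow> real" where
  "green \<kappa> N x = (\<Sum>p\<in>momenta N. cos (wave N p x) / (\<kappa> - symbol (momentum_point N p))) / real N ^ CARD('d)"

lemma symbol_le: "symbol (s :: real ^ 'd::finite) \<le> 2 * real CARD('d)"
  unfolding symbol_def using sum_mono[of UNIV "\<lambda>i. 2 * cos (2 * pi * s $ i)" "\<lambda>_. 2"] by simp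

lemma bij_betw_momenta:
  "bij_betw vec_lambda (PiE UNIV (\<lambda>_. {0..<int N})) (momenta N :: (int ^ 'd::finite) set)"
  by (rule bij_betwI[where g=vec_nth]) (auto simp: momenta_def PiE_def Pi_def)

lemma finite_momenta [simp]: "finite (momenta N :: (int ^ 'd::finite) set)"
  using bij_betw_finite[OF bij_betw_momenta[where 'd='d], of N] finite_PiE[of "UNIV :: 'd set" "\<lambda>_. {0..<int N}"]
  by simp

lemma card_momenta: "card (momenta N :: (int ^ 'd::finite) set) = N ^ CARD('d)"
  using bij_betw_same_card[OF bij_betw_momenta[where 'd='d], of N] by (simp add: card_PiE)

lemma sum_cis_period:
  assumes "N > 0"
  shows "(\<Sum>k\<in>{0..<int N}. cis (2 * pi * (of_int k / real N) * of_int m)) =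
    (if int N dvd m then of_nat N else 0)"
proof -
  define w where "w = cis (2 * pi * of_int m / real N)"
  have "(\<Sum>k\<in>{0..<int N}. cis (2 * pi * (of_int k / real N) * of_int m)) = (\<Sum>k<N. w ^ k)"
    by (rule sum.reindex_bij_witness[of _ int nat])
       (auto simp: w_def Complex.DeMoivre algebra_simps)
  moreover have "w ^ N = 1"
    using assms cis_multiple_2pi[of "of_int m"] by (simp add: w_def Complex.DeMoivre)
  moreover have "w = 1 \<longleftrightarrow> int N dvd m"
  proof
    assume "w = 1"
    then have "cos (2 * pi * of_int m / real N) = 1" unfolding w_def by (metis cis.sel(1) one_complex.sel(1))
    then obtain n :: int where "2 * pi * of_int m / real N = of_int n * (2 * pi)"
      using cos_one_2pi_int by (metis mult.assoc)
    then have "of_int m = real_of_int (int N * n)" using assms by (simp add: field_simps)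
    then have "m = int N * n" by (simp only: of_int_eq_iff)
    then show "int N dvd m" by simp
  next
    assume "int N dvd m"
    then obtain n where "m = int N * n" by blast
    then have "2 * pi * of_int m / real N = 2 * pi * of_int n" using assms by simp
    then show "w = 1" unfolding w_def using cis_multiple_2pi[of "of_int n"] by simp
  qed
  ultimately show ?thesis by (auto simp: sum_gp_strict)
qed

lemma cis_sum: "finite I \<Longrightarrow> cis (\<Sum>i\<in>I. f i) = (\<Prod>i\<in>I. cis (f i))"
  by (induction I rule: finite_induct) (auto simp flip: cis_mult)

text \<open>The sum over momenta factorises into one geometric sum per coordinate.\<close>

lemma sum_cos_wave:
  fixes x :: "int ^ 'd::finite"
  assumes "N > 0"
  shows "(\<Sum>p\<in>momenta N. cos (wave N p x)) = (if \<forall>i. int N dvd x $ i then real N ^ CARD('d) else 0)"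
proof -
  have "(\<Sum>p\<in>momenta N. cis (wave N p x)) =
      (\<Sum>g\<in>PiE UNIV (\<lambda>_. {0..<int N}). cis (wave N (vec_lambda g) x))"
    by (rule sum.reindex_bij_betw[OF bij_betw_momenta, symmetric])
  also have "\<dots> = (\<Sum>g\<in>PiE UNIV (\<lambda>_. {0..<int N}).
      \<Prod>i\<in>UNIV. cis (2 * pi * (of_int (g i) / real N) * of_int (x $ i)))"
    by (simp add: wave_def cis_sum)
  also have "\<dots> = (\<Prod>i\<in>UNIV. \<Sum>k\<in>{0..<int N}. cis (2 * pi * (of_int k / real N) * of_int (x $ i)))"
    by (rule prod_sum_PiE[symmetric]) auto
  also have "\<dots> = (\<Prod>i\<in>UNIV. if int N dvd x $ i then of_nat N else 0)"
    by (simp only: sum_cis_period[OF assms])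
  also have "\<dots> = (if \<forall>i. int N dvd x $ i then of_nat N ^ CARD('d) else 0)"
    by auto
  finally have "Re (\<Sum>p\<in>momenta N. cis (wave N p x)) =
    Re (if \<forall>i. int N dvd x $ i then of_nat N ^ CARD('d) else 0)" by simp
  then show ?thesis by (auto split: if_splits simp flip: of_nat_power)
qed

lemma green_periodic:
  assumes "N > 0" "\<And>i. int N dvd x $ i - y $ i"
  shows "green \<kappa> N x = green \<kappa> N y"
proof -
  have "cos (wave N p x) = cos (wave N p y)" for p
  proof -
    obtain m where m: "\<And>i. x $ i - y $ i = int N * m i" using assms(2) unfolding dvd_def by metis
    have "wave N p x - wave N p y = (\<Sum>i\<in>UNIV. 2 * pi * (of_int (p $ i) / real N) * of_int (x $ i - y $ i))"
      by (simp add: wave_def right_diff_distrib flip: sum_subtractf)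
    also have "\<dots> = 2 * of_int (\<Sum>i\<in>UNIV. p $ i * m i) * pi"
      using assms(1) by (simp add: m sum_distrib_left sum_distrib_right field_simps)
    finally show ?thesis using cos_eq_periodic_intro by blast
  qed
  then show ?thesis by (simp add: green_def)
qed

text \<open>Adding the two neighbours along an axis cancels the sines and multiplies each mode by
  twice the cosine of its momentum component. In total each mode is multiplied by \<kappa> - symbol,
  which cancels the denominator, and orthogonality leaves the periodic delta.\<close>

lemma green_equation:
  fixes x :: "int ^ 'd::finite"
  assumes N: "N > 0" and \<kappa>: "\<kappa> > 2 * real CARD('d)"
  shows "\<kappa> * green \<kappa> N x - (\<Sum>i\<in>UNIV. green \<kappa> N (x + axis i 1) + green \<kappa> N (x - axis i 1)) =
    of_bool (\<forall>i. int N dvd x $ i)"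
proof -
  let ?s = "\<lambda>p. symbol (momentum_point N p :: real ^ 'd)"
  have ax: "wave N p (x + axis i 1) = wave N p x + 2 * pi * (of_int (p $ i) / real N)"
    "wave N p (x - axis i 1) = wave N p x - 2 * pi * (of_int (p $ i) / real N)" for p i
  proof -
    have "(\<Sum>j\<in>UNIV. 2 * pi * (of_int (p $ j) / real N) * of_int (axis i 1 $ j)) = 2 * pi * (of_int (p $ i) / real N)"
      by (subst sum.remove[of _ i]) (auto simp: axis_def intro!: sum.neutral)
    then show "wave N p (x + axis i 1) = wave N p x + 2 * pi * (of_int (p $ i) / real N)"
      "wave N p (x - axis i 1) = wave N p x - 2 * pi * (of_int (p $ i) / real N)"
      by (simp_all add: wave_def distrib_left right_diff_distrib sum.distrib sum_subtractf)
  qed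
  have nz: "\<kappa> - ?s p \<noteq> 0" for p using symbol_le[of "momentum_point N p :: real ^ 'd"] \<kappa> by linarith
  have "(\<Sum>i\<in>UNIV. green \<kappa> N (x + axis i 1) + green \<kappa> N (x - axis i 1)) =
     (\<Sum>i\<in>UNIV. \<Sum>p\<in>momenta N. 2 * cos (wave N p x) * cos (2 * pi * (of_int (p $ i) / real N)) / (\<kappa> - ?s p) / real N ^ CARD('d))"
    unfolding green_def
    by (simp add: ax cos_add cos_diff sum_divide_distrib mult.assoc flip: sum.distrib add_divide_distrib)
  also have "\<dots> = (\<Sum>p\<in>momenta N. cos (wave N p x) * ?s p / (\<kappa> - ?s p) / real N ^ CARD('d))"
    by (subst sum.swap) (simp add: symbol_def momentum_point_def sum_distrib_left sum_divide_distrib mult_ac)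
  finally have "\<kappa> * green \<kappa> N x - (\<Sum>i\<in>UNIV. green \<kappa> N (x + axis i 1) + green \<kappa> N (x - axis i 1)) =
     (\<Sum>p\<in>momenta N. (\<kappa> * cos (wave N p x) / (\<kappa> - ?s p) - cos (wave N p x) * ?s p / (\<kappa> - ?s p)) / real N ^ CARD('d))"
    unfolding green_def by (simp add: sum_divide_distrib sum_distrib_left sum_subtractf diff_divide_distrib)
  also have "\<dots> = (\<Sum>p\<in>momenta N. cos (wave N p x) / real N ^ CARD('d))"
  proof (rule sum.cong[OF refl])
    fix p
    have "\<kappa> * cos (wave N p x) / (\<kappa> - ?s p) - cos (wave N p x) * ?s p / (\<kappa> - ?s p) =
      cos (wave N p x) * (\<kappa> - ?s p) / (\<kappa> - ?s p)"
      by (simp only: diff_divide_distrib[symmetric] right_diff_distrib mult.commute[of \<kappa>])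
    then show "(\<kappa> * cos (wave N p x) / (\<kappa> - ?s p) - cos (wave N p x) * ?s p / (\<kappa> - ?s p)) / real N ^ CARD('d) =
      cos (wave N p x) / real N ^ CARD('d)" using nz by simp
  qed
  also have "\<dots> = of_bool (\<forall>i. int N dvd x $ i)"
    using N by (simp add: sum_cos_wave[OF N] flip: sum_divide_distrib)
  finally show ?thesis .
qed

definition green_defect_integrand :: "real \<Rightarrow> int ^ 'd::finite \<Rightarrow> real ^ 'd \<Rightarrow> real" where
  "green_defect_integrand \<kappa> x s = (1 - cos (\<Sum>i\<in>UNIV. 2 * pi * s $ i * of_int (x $ i))) / (\<kappa> - symbol s)"

lemma green_defect_eq:
  fixes x :: "int ^ 'd::finite"
  shows "green \<kappa> N (0 :: int ^ 'd) - green \<kappa> N x =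
    (\<Sum>p\<in>momenta N. green_defect_integrand \<kappa> x (momentum_point N p)) / real N ^ CARD('d)"
proof -
  have "wave N p 0 = 0" for p :: "int ^ 'd" by (simp add: wave_def)
  then show ?thesis
    unfolding green_def green_defect_integrand_def
    by (simp add: wave_def momentum_point_def diff_divide_distrib sum_subtractf)
qed

text \<open>The bound is uniform in \<kappa>: twice the sum of the 1 - cos equals 2 * d - symbol,
  which lies below the denominator, and the same sum controls the numerator.\<close>

lemma green_defect_integrand_bounds:
  fixes x :: "int ^ 'd::finite"
  assumes "\<kappa> > 2 * real CARD('d)"
  shows "0 \<le> green_defect_integrand \<kappa> x s" "green_defect_integrand \<kappa> x s \<le> (l1 x)\<^sup>2 / 2"
proof -
  have pos: "\<kappa> - symbol s > 0" using symbol_le[of s] assms by linarith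
  show "0 \<le> green_defect_integrand \<kappa> x s"
    unfolding green_defect_integrand_def using pos by (intro divide_nonneg_pos) auto
  have "2 * (\<Sum>i\<in>UNIV. 1 - cos (2 * pi * s $ i)) = 2 * real CARD('d) - symbol s"
    by (simp add: symbol_def sum_subtractf sum_distrib_left)
  then have "2 * (\<Sum>i\<in>UNIV. 1 - cos (2 * pi * s $ i)) \<le> \<kappa> - symbol s" using assms by linarith
  then have "(l1 x)\<^sup>2 * (2 * (\<Sum>i\<in>UNIV. 1 - cos (2 * pi * s $ i))) \<le> (l1 x)\<^sup>2 * (\<kappa> - symbol s)"
    by (intro mult_left_mono) auto
  then have "1 - cos (\<Sum>i\<in>UNIV. 2 * pi * s $ i * of_int (x $ i)) \<le> (l1 x)\<^sup>2 / 2 * (\<kappa> - symbol s)"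
    using one_minus_cos_sum_le[of "\<lambda>i. 2 * pi * s $ i" x] by linarith
  then show "green_defect_integrand \<kappa> x s \<le> (l1 x)\<^sup>2 / 2"
    unfolding green_defect_integrand_def using pos by (simp add: pos_divide_le_eq)
qed

lemma green_defect_bounds:
  fixes x :: "int ^ 'd::finite"
  assumes N: "N > 0" and \<kappa>: "\<kappa> > 2 * real CARD('d)"
  shows "0 \<le> green \<kappa> N (0 :: int ^ 'd) - green \<kappa> N x" "green \<kappa> N (0 :: int ^ 'd) - green \<kappa> N x \<le> (l1 x)\<^sup>2 / 2"
proof -
  show "0 \<le> green \<kappa> N (0 :: int ^ 'd) - green \<kappa> N x" unfolding green_defect_eq
    using green_defect_integrand_bounds(1)[OF \<kappa>] by (intro divide_nonneg_nonneg sum_nonneg) auto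
  have "(\<Sum>p\<in>momenta N. green_defect_integrand \<kappa> x (momentum_point N p)) \<le>
    (\<Sum>p\<in>(momenta N :: (int ^ 'd) set). (l1 x)\<^sup>2 / 2)"
    by (intro sum_mono green_defect_integrand_bounds(2)[OF \<kappa>])
  also have "\<dots> = (l1 x)\<^sup>2 / 2 * real N ^ CARD('d)" by (simp add: card_momenta)
  finally show "green \<kappa> N (0 :: int ^ 'd) - green \<kappa> N x \<le> (l1 x)\<^sup>2 / 2"
    unfolding green_defect_eq using N by (simp add: pos_divide_le_eq)
qed

section \<open>Riemann sums over momenta\<close>

definition grid_point :: "nat \<Rightarrow> real ^ 'd::finite \<Rightarrow> real ^ 'd" where
  "grid_point N t = (\<chi> i. of_int \<lfloor>real N * t $ i\<rfloor> / real N)"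

text \<open>Cells are cut to the open cube. Only null sets are lost, and at each remaining point the
  symbol is strictly below its maximum.\<close>

definition grid_cell :: "nat \<Rightarrow> int ^ 'd::finite \<Rightarrow> (real ^ 'd) set" where
  "grid_cell N p = {t \<in> box 0 1. \<forall>i. \<lfloor>real N * t $ i\<rfloor> = p $ i}"

lemma grid_cell_measurable [measurable]: "grid_cell N p \<in> sets borel"
proof -
  have "grid_cell N p = box 0 1 \<inter>
      (\<Inter>i. {t. of_int (p $ i) \<le> real N * t $ i} \<inter> {t. real N * t $ i < of_int (p $ i) + 1})"
    by (auto simp: grid_cell_def floor_eq_iff)
  then show ?thesis
    by (auto intro!: sets.Int sets.finite_INT borel_closed closed_Collect_le borel_open open_Collect_less
        continuous_intros)
qed

lemma measure_grid_cell:
  fixes p :: "int ^ 'd::finite"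
  assumes N: "N > 0" and p: "p \<in> momenta N"
  shows "emeasure lborel (grid_cell N p) = ennreal (1 / real N ^ CARD('d))"
proof -
  let ?l = "momentum_point N p" and ?u = "momentum_point N p + (\<chi> i. 1 / real N)"
  have lu: "\<forall>b\<in>Basis. ?l \<bullet> b \<le> ?u \<bullet> b"
    by (auto simp: Basis_vec_def inner_axis momentum_point_def)
  have pr: "(\<Prod>b\<in>Basis. (?u - ?l) \<bullet> b) = 1 / real N ^ CARD('d)"
    by (simp add: Basis_vec_def inner_axis prod.UNION_disjoint power_divide) 
       (subst prod.UNION_disjoint; auto simp: axis_eq_axis inner_axis power_one_over)
  have e: "emeasure lborel (box ?l ?u) = ennreal (1 / real N ^ CARD('d))"
    "emeasure lborel (cbox ?l ?u) = ennreal (1 / real N ^ CARD('d))"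
    using lu pr by (auto simp: emeasure_lborel_box_eq emeasure_lborel_cbox_eq)
  \<comment> \<open>A cell is half-open and may lack a face, so its measure is squeezed between
    those of an open and a closed box.\<close>
  have "box ?l ?u \<subseteq> grid_cell N p"
  proof
    fix t assume "t \<in> box ?l ?u"
    then have t: "of_int (p $ i) / real N < t $ i" "t $ i < (of_int (p $ i) + 1) / real N" for i
      by (auto simp: mem_box_cart momentum_point_def add_divide_distrib)
    have t2: "of_int (p $ i) < real N * t $ i" "real N * t $ i < of_int (p $ i) + 1" for i
      using t[of i] N by (auto simp: field_simps)
    have p2: "0 \<le> p $ i" "p $ i + 1 \<le> int N" for i
      using p by (auto simp: momenta_def add1_zle_eq)
    have "0 < t $ i" for i
    proof -
      have "0 \<le> of_int (p $ i) / real N" using p2(1)[of i] by simp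
      then show ?thesis using t(1)[of i] by linarith
    qed
    moreover have "t $ i < 1" for i
    proof -
      have "real_of_int (p $ i + 1) \<le> real_of_int (int N)" using p2(2)[of i] by (simp only: of_int_le_iff)
      then have "real N * t $ i < real N * 1" using t2(2)[of i] by simp
      then show ?thesis using N by (simp only: mult_less_cancel_left_pos of_nat_0_less_iff)
    qed
    moreover have "\<lfloor>real N * t $ i\<rfloor> = p $ i" for i
      using t2[of i] by (intro floor_unique) auto
    ultimately show "t \<in> grid_cell N p" by (auto simp: grid_cell_def mem_box_cart)
  qed
  moreover have "grid_cell N p \<subseteq> cbox ?l ?u"
  proof
    fix t assume "t \<in> grid_cell N p"
    then have "\<lfloor>real N * t $ i\<rfloor> = p $ i" for i by (auto simp: grid_cell_def)
    then have "of_int (p $ i) \<le> real N * t $ i" "real N * t $ i < of_int (p $ i) + 1" for i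
      using floor_correct[of "real N * t $ i"] by auto
    then show "t \<in> cbox ?l ?u"
      using N by (auto simp: mem_box_cart momentum_point_def field_simps less_imp_le)
  qed
  ultimately show ?thesis
    using emeasure_mono[of "box ?l ?u" "grid_cell N p" lborel] emeasure_mono[of "grid_cell N p" "cbox ?l ?u" lborel] e
    by (intro antisym) auto
qed

lemma grid_expansion:
  fixes t :: "real ^ 'd::finite"
  assumes N: "N > 0"
  shows "indicator (box 0 1) t * F (grid_point N t) =
    (\<Sum>p\<in>momenta N. F (momentum_point N p) * indicator (grid_cell N p) t :: real)"
proof (cases "t \<in> box 0 1")
  case True
  define q where "q = (\<chi> i. \<lfloor>real N * t $ i\<rfloor>)"
  have t: "0 < t $ i" "t $ i < 1" for i using True by (auto simp: mem_box_cart)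
  have "0 \<le> \<lfloor>real N * t $ i\<rfloor>" "\<lfloor>real N * t $ i\<rfloor> < int N" for i
    using t[of i] N by (auto simp: floor_less_iff)
  then have q: "q \<in> momenta N" by (auto simp: momenta_def q_def)
  have "(\<Sum>p\<in>momenta N. F (momentum_point N p) * indicator (grid_cell N p) t) =
      (\<Sum>p\<in>{q}. F (momentum_point N p) * indicator (grid_cell N p) t)"
    using q by (intro sum.mono_neutral_right) (auto simp: grid_cell_def q_def vec_eq_iff indicator_def)
  also have "\<dots> = F (grid_point N t)"
    using True by (simp add: grid_cell_def q_def momentum_point_def grid_point_def)
  finally show ?thesis using True by simp
next
  case False
  then show ?thesis by (simp add: grid_cell_def)
qed

text \<open>Riemann sums become exact integrals of step functions. Dominated convergence and Fatou's
  lemma then apply, although the denominators of the limiting integrands vanish at the corners of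
  the cube.\<close>

lemma grid_integral:
  fixes F :: "real ^ 'd::finite \<Rightarrow> real"
  assumes N: "N > 0"
  shows "has_bochner_integral lborel (\<lambda>t. indicator (box 0 1) t * F (grid_point N t))
    ((\<Sum>p\<in>momenta N. F (momentum_point N p)) / real N ^ CARD('d))"
proof -
  have "has_bochner_integral lborel (\<lambda>t. F (momentum_point N p) * indicator (grid_cell N p) t)
      (F (momentum_point N p) * (1 / real N ^ CARD('d)))" if "p \<in> momenta N" for p
    using has_bochner_integral_real_indicator[of "grid_cell N p" lborel] measure_grid_cell[OF N that]
    by (intro has_bochner_integral_mult_right) (auto simp: measure_def)
  then have "has_bochner_integral lborel
      (\<lambda>t. \<Sum>p\<in>momenta N. F (momentum_point N p) * indicator (grid_cell N p) t)
      (\<Sum>p\<in>momenta N. F (momentum_point N p) * (1 / real N ^ CARD('d)))"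
    by (rule has_bochner_integral_sum)
  then show ?thesis by (simp add: grid_expansion[OF N] sum_divide_distrib)
qed

lemma grid_point_tendsto:
  assumes "filterlim N at_top sequentially"
  shows "(\<lambda>n. grid_point (N n) t) \<longlonglongrightarrow> t"
proof (rule vec_tendstoI)
  fix i
  have lim: "(\<lambda>n. 1 / real (N n)) \<longlonglongrightarrow> 0"
    using tendsto_inverse_0_at_top[OF filterlim_compose[OF filterlim_real_sequentially assms]]
    by (simp add: divide_inverse)
  have "eventually (\<lambda>n. norm (grid_point (N n) t $ i - t $ i) \<le> 1 / real (N n)) sequentially"
    using eventually_compose_filterlim[OF eventually_gt_at_top[of 0] assms]
  proof eventually_elim
    case (elim n)
    have "grid_point (N n) t $ i - t $ i = (of_int \<lfloor>real (N n) * t $ i\<rfloor> - real (N n) * t $ i) / real (N n)"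
      using elim by (simp add: grid_point_def field_simps)
    moreover have "\<bar>of_int \<lfloor>real (N n) * t $ i\<rfloor> - real (N n) * t $ i\<bar> \<le> 1" by linarith
    ultimately show ?case using elim by (simp add: divide_right_mono)
  qed
  then have "(\<lambda>n. grid_point (N n) t $ i - t $ i) \<longlonglongrightarrow> 0"
    by (rule Lim_null_comparison[OF _ lim])
  then show "(\<lambda>n. grid_point (N n) t $ i) \<longlonglongrightarrow> t $ i"
    by (simp add: LIM_zero_iff)
qed

lemma symbol_tendsto:
  assumes "(s \<longlongrightarrow> t) F" shows "((\<lambda>n. symbol (s n)) \<longlongrightarrow> symbol t) F"
  unfolding symbol_def
proof (intro tendsto_sum tendsto_mult tendsto_const)
  fix i
  have "((\<lambda>n. 2 * pi * s n $ i) \<longlongrightarrow> 2 * pi * t $ i) F"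
    by (intro tendsto_mult tendsto_const tendsto_vec_nth assms)
  then show "((\<lambda>n. cos (2 * pi * s n $ i)) \<longlongrightarrow> cos (2 * pi * t $ i)) F"
    by (rule isCont_tendsto_compose[OF isCont_cos])
qed

lemma symbol_less:
  fixes t :: "real ^ 'd::finite"
  assumes "t \<in> box 0 1" shows "symbol t < 2 * real CARD('d)"
proof -
  have "2 * cos (2 * pi * t $ i) < 2" for i
  proof -
    have t: "0 < t $ i" "t $ i < 1" using assms by (auto simp: mem_box_cart)
    then have "0 < sin (pi * t $ i)" by (intro sin_gt_zero) auto
    then show ?thesis using cos_double_sin[of "pi * t $ i"] by (simp add: mult.assoc)
  qed
  then have "symbol t < (\<Sum>i\<in>(UNIV :: 'd set). 2)"
    unfolding symbol_def by (intro sum_strict_mono) auto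
  then show ?thesis by simp
qed

text \<open>In every dimension a constant dominates the integrand uniformly in \<kappa>, so the
  Riemann sums converge even though the Green kernel itself may diverge.\<close>

lemma green_defect_converges:
  fixes x :: "int ^ 'd::finite"
  assumes \<kappa>: "\<And>n. \<kappa> n > 2 * real CARD('d)" "\<kappa> \<longlonglongrightarrow> 2 * real CARD('d)"
    and N: "\<And>n. N n > 0" "filterlim N at_top sequentially"
  shows "convergent (\<lambda>n. green (\<kappa> n) (N n) (0 :: int ^ 'd) - green (\<kappa> n) (N n) x)"
proof -
  let ?d = "2 * real CARD('d)"
  let ?f = "\<lambda>n t. indicator (box 0 1) t * green_defect_integrand (\<kappa> n) x (grid_point (N n) t)"
  let ?g = "\<lambda>t. indicator (box 0 1) t * green_defect_integrand ?d x t"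
  have lim: "(\<lambda>n. ?f n t) \<longlonglongrightarrow> ?g t" for t
  proof (cases "t \<in> box 0 1")
    case True
    have "(\<lambda>n. green_defect_integrand (\<kappa> n) x (grid_point (N n) t)) \<longlonglongrightarrow> green_defect_integrand ?d x t"
      unfolding green_defect_integrand_def
      using symbol_less[OF True]
      by (intro tendsto_intros symbol_tendsto grid_point_tendsto[OF N(2)] \<kappa>(2)) auto
    then show ?thesis using True by simp
  qed simp
  have "(\<lambda>n. integral\<^sup>L lborel (?f n)) \<longlonglongrightarrow> integral\<^sup>L lborel ?g"
  proof (rule integral_dominated_convergence[where w="\<lambda>t. indicator (box 0 1) t * ((l1 x)\<^sup>2 / 2)"])
    show "?f n \<in> borel_measurable lborel" for n
      by (rule borel_measurable_integrable) (use grid_integral[OF N(1)] in \<open>auto simp: has_bochner_integral_iff\<close>)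
    then show "?g \<in> borel_measurable lborel"
      by (rule borel_measurable_LIMSEQ_real[OF lim])
    show "integrable lborel (\<lambda>t::real ^ 'd. indicator (box 0 1) t * ((l1 x)\<^sup>2 / 2))"
      by (intro integrable_mult_left integrable_real_indicator) (auto simp: emeasure_lborel_box_eq)
    show "AE t in lborel. norm (?f n t) \<le> indicator (box 0 1) t * ((l1 x)\<^sup>2 / 2)" for n
      using green_defect_integrand_bounds[OF \<kappa>(1)] by (auto simp: indicator_def)
  qed (use lim in auto)
  moreover have "integral\<^sup>L lborel (?f n) = green (\<kappa> n) (N n) (0 :: int ^ 'd) - green (\<kappa> n) (N n) x" for n
    using grid_integral[OF N(1)] unfolding green_defect_eq by (auto simp: has_bochner_integral_iff)
  ultimately show ?thesis unfolding convergent_def by auto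
qed

text \<open>This is where \<open>d \<le> 2\<close> enters: each dyadic cube at distance about \<open>2\<^sup>-\<^sup>k\<close> from zero
  momentum has volume at least of order \<open>4\<^sup>-\<^sup>k\<close> and contributes at least a fixed amount.\<close>

lemma green_0_at_top:
  assumes d: "CARD('d::finite) \<le> 2"
    and \<kappa>: "\<And>n. \<kappa> n > 2 * real CARD('d)" "\<kappa> \<longlonglongrightarrow> 2 * real CARD('d)"
    and N: "\<And>n. N n > 0" "filterlim N at_top sequentially"
  shows "filterlim (\<lambda>n. green (\<kappa> n) (N n) (0 :: int ^ 'd)) at_top sequentially"
proof -
  let ?d = "2 * real CARD('d)"
  \<comment> \<open>The product of \<open>a k\<close>, the lower bound for the integrand on
    \<open>U k\<close>, and 4^-(k + 2), the lower bound for the volume of \<open>U k\<close>; the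
    dependence on k cancels.\<close>
  define c where "c = 1 / (16 * pi\<^sup>2 * real CARD('d))"
  have c: "c > 0" unfolding c_def by (auto intro!: divide_pos_pos mult_pos_pos)
  define F where "F = (\<lambda>\<kappa> (s :: real ^ 'd). 1 / (\<kappa> - symbol s))"
  let ?f = "\<lambda>n t. indicator (box 0 1) t * F (\<kappa> n) (grid_point (N n) t)"
  let ?g = "\<lambda>t. indicator (box 0 1) t * F ?d t"
  have F0: "F (\<kappa> n) s \<ge> 0" for n s
    using symbol_le[of s] \<kappa>(1)[of n] unfolding F_def by (intro divide_nonneg_nonneg) auto
  have green: "green (\<kappa> n) (N n) (0 :: int ^ 'd) =
      (\<Sum>p\<in>momenta (N n). F (\<kappa> n) (momentum_point (N n) p)) / real (N n) ^ CARD('d)" for n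
    by (simp add: green_def wave_def F_def)
  have int: "(\<integral>\<^sup>+t. ennreal (?f n t) \<partial>lborel) = ennreal (green (\<kappa> n) (N n) (0 :: int ^ 'd))" for n
    using grid_integral[OF N(1)[of n], of "F (\<kappa> n)"] F0
    by (subst nn_integral_eq_integral) (auto simp: has_bochner_integral_iff green)
  have meas: "?f n \<in> borel_measurable lborel" for n
    by (rule borel_measurable_integrable) (use grid_integral[OF N(1)] in \<open>auto simp: has_bochner_integral_iff\<close>)
  have lim: "(\<lambda>n. ?f n t) \<longlonglongrightarrow> ?g t" for t
  proof (cases "t \<in> box 0 1")
    case True
    have "(\<lambda>n. F (\<kappa> n) (grid_point (N n) t)) \<longlonglongrightarrow> F ?d t"
      unfolding F_def using symbol_less[OF True]
      by (intro tendsto_intros symbol_tendsto grid_point_tendsto[OF N(2)] \<kappa>(2)) auto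
    then show ?thesis using True by simp
  qed simp
  \<comment> \<open>Only a lower bound is wanted, and no integrable majorant can exist because the
    limiting integral is infinite; hence Fatou's lemma.\<close>
  have Fatou: "(\<integral>\<^sup>+t. ennreal (?g t) \<partial>lborel) \<le> liminf (\<lambda>n. ennreal (green (\<kappa> n) (N n) (0 :: int ^ 'd)))"
  proof -
    have "liminf (\<lambda>n. ennreal (?f n t)) = ennreal (?g t)" for t
      by (intro lim_imp_Liminf tendsto_ennrealI lim) auto
    then show ?thesis
      using nn_integral_liminf[of "\<lambda>n t. ennreal (?f n t)" lborel] meas by (simp add: int)
  qed
  \<comment> \<open>Cubes of side 2^-(k + 2) along the diagonal. Any single coordinate already
    separates them.\<close>
  define U where "U = (\<lambda>k::nat. box (\<chi> i. 1 / 2 ^ (k + 2)) (\<chi> i. 1 / 2 ^ (k + 1)) :: (real ^ 'd) set)"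
  define a where "a = (\<lambda>k::nat. 4 ^ (k + 1) / (4 * pi\<^sup>2 * real CARD('d)))"
  have a0: "a k > 0" for k unfolding a_def by (auto intro!: divide_pos_pos mult_pos_pos)
  have Umeas: "ennreal c \<le> ennreal (a k) * emeasure lborel (U k)" for k
  proof -
    have "(1 / 4 :: real) ^ (k + 2) = (1 / 2 ^ (k + 2)) ^ 2"
      by (simp add: power_divide power_mult[symmetric] power2_eq_square mult.commute power_mult_distrib[symmetric])
    \<comment> \<open>Here the dimension enters: for a side at most 1, its power with exponent d <=
      2 is at least its square.\<close>
    also have "\<dots> \<le> (1 / 2 ^ (k + 2)) ^ CARD('d)"
      using d one_le_power[of "2::real" "k + 2"] by (intro power_decreasing) (auto simp: divide_le_eq)
    finally have "c \<le> a k * (1 / 2 ^ (k + 2)) ^ CARD('d)"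
      using mult_left_mono[of "(1 / 4) ^ (k + 2)" "(1 / 2 ^ (k + 2)) ^ CARD('d)" "a k"] a0[of k]
      unfolding c_def a_def by (simp add: power_divide)
    moreover have "emeasure lborel (U k) = ennreal ((1 / 2 ^ (k + 2)) ^ CARD('d))"
    proof -
      have pr: "(\<Prod>b\<in>Basis. ((\<chi> i. 1 / 2 ^ (k + 1)) - (\<chi> i. 1 / 2 ^ (k + 2)) :: real ^ 'd) \<bullet> b)
          = (1 / 2 ^ (k + 2)) ^ CARD('d)"
        unfolding Basis_vec_def
        by (subst prod.UNION_disjoint) (auto simp: axis_eq_axis inner_axis field_simps)
      show ?thesis unfolding U_def emeasure_lborel_box_eq pr
        by (auto simp: Basis_vec_def inner_axis field_simps)
    qed
    ultimately show ?thesis using a0[of k] by (simp add: ennreal_mult[symmetric] less_imp_le)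
  qed
  have disj: "j = k" if "t \<in> U j" "t \<in> U k" for j k t
  proof -
    have *: "\<not> j < k" if "t \<in> U j" "t \<in> U k" for j k
    proof
      assume "j < k"
      \<comment> \<open>Any coordinate will do; the index type is nonempty.\<close>
      obtain i :: 'd where True by simp
      have "1 / 2 ^ (j + 2) < t $ i" "t $ i < 1 / 2 ^ (k + 1)"
        using that by (auto simp: U_def mem_box_cart)
      moreover have "(1 / 2 ^ (k + 1) :: real) \<le> 1 / 2 ^ (j + 2)"
        using \<open>j < k\<close> by (intro divide_left_mono power_increasing) auto
      ultimately show False by linarith
    qed
    show ?thesis using *[OF that] *[OF that(2,1)] by simp
  qed
  have lower: "a k \<le> ?g t" if "t \<in> U k" for k t
  proof -
    have t: "0 < t $ i" "t $ i < 1 / 2 ^ (k + 1)" for i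
    proof -
      have "1 / 2 ^ (k + 2) < t $ i" "t $ i < 1 / 2 ^ (k + 1)"
        using that by (auto simp: U_def mem_box_cart)
      moreover have "(0::real) < 1 / 2 ^ (k + 2)" by simp
      ultimately show "0 < t $ i" "t $ i < 1 / 2 ^ (k + 1)" by linarith+
    qed
    have "t $ i < 1" for i
    proof -
      have "(1 / 2 ^ (k + 1) :: real) \<le> 1"
        using one_le_power[of "2::real" "k + 1"] by (auto simp: divide_le_eq)
      then show ?thesis using t(2)[of i] by linarith
    qed
    then have box: "t \<in> box 0 1" using t(1) by (auto simp: mem_box_cart)
    have "?d - symbol t = (\<Sum>i\<in>UNIV. 2 * (1 - cos (2 * pi * t $ i)))"
      by (simp add: symbol_def sum_subtractf right_diff_distrib)
    also have "\<dots> \<le> (\<Sum>i\<in>(UNIV :: 'd set). 4 * pi\<^sup>2 / 4 ^ (k + 1))"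
    proof (rule sum_mono)
      fix i
      have "(t $ i)\<^sup>2 \<le> (1 / 2 ^ (k + 1))\<^sup>2" using t[of i] by (intro power_mono) auto
      also have "\<dots> = 1 / 4 ^ (k + 1)"
        by (simp add: power_divide power2_eq_square power_mult_distrib[symmetric])
      finally have "(2 * pi)\<^sup>2 * (t $ i)\<^sup>2 \<le> (2 * pi)\<^sup>2 * (1 / 4 ^ (k + 1))" by (intro mult_left_mono) auto
      then show "2 * (1 - cos (2 * pi * t $ i)) \<le> 4 * pi\<^sup>2 / 4 ^ (k + 1)"
        using one_minus_cos_le[of "2 * pi * t $ i"] by (simp add: power_mult_distrib)
    qed
    also have "\<dots> = 1 / a k" by (simp add: a_def field_simps)
    finally have "a k \<le> 1 / (?d - symbol t)"
      using symbol_less[OF box] a0[of k] by (simp add: field_simps)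
    then show ?thesis using box by (simp add: F_def)
  qed
  have "ennreal (real K * c) \<le> (\<integral>\<^sup>+t. ennreal (?g t) \<partial>lborel)" for K
  proof -
    have "ennreal (real K * c) = (\<Sum>k<K. ennreal c)"
      using c by (simp add: sum_constant ennreal_mult' ennreal_of_nat_eq_real_of_nat)
    also have "\<dots> \<le> (\<Sum>k<K. ennreal (a k) * emeasure lborel (U k))" by (intro sum_mono Umeas)
    also have "\<dots> = (\<integral>\<^sup>+t. (\<Sum>k<K. ennreal (a k) * indicator (U k) t) \<partial>lborel)"
      by (subst nn_integral_sum) (auto simp: nn_integral_cmult_indicator U_def)
    also have "\<dots> \<le> (\<integral>\<^sup>+t. ennreal (?g t) \<partial>lborel)"
    proof (rule nn_integral_mono)
      fix t
      show "(\<Sum>k<K. ennreal (a k) * indicator (U k) t) \<le> ennreal (?g t)"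
      proof (cases "\<exists>j<K. t \<in> U j")
        case True
        then obtain j where j: "j < K" "t \<in> U j" by blast
        have "(\<Sum>k<K. ennreal (a k) * indicator (U k) t) = (\<Sum>k\<in>{j}. ennreal (a k) * indicator (U k) t)"
          using j disj by (intro sum.mono_neutral_right) (auto simp: indicator_def)
        then show ?thesis using lower[OF j(2)] j by (simp add: ennreal_leI)
      next
        case False
        then have "(\<Sum>k<K. ennreal (a k) * indicator (U k) t) = 0" by (intro sum.neutral) auto
        then show ?thesis by simp
      qed
    qed
    finally show ?thesis .
  qed
  then have inf: "ennreal (real K * c) \<le> liminf (\<lambda>n. ennreal (green (\<kappa> n) (N n) (0 :: int ^ 'd)))" for K
    using Fatou order_trans by blast
  show ?thesis
    unfolding filterlim_at_top
  proof
    fix Z :: real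
    obtain K :: nat where K: "max Z 0 / c < real K" using reals_Archimedean2 by blast
    then have "max Z 0 < real K * c" using c by (simp add: pos_divide_less_eq)
    then have "ennreal (max Z 0) < ennreal (real K * c)" by (intro ennreal_lessI) auto
    then have "ennreal (max Z 0) < liminf (\<lambda>n. ennreal (green (\<kappa> n) (N n) (0 :: int ^ 'd)))"
      using inf less_le_trans by blast
    then have "eventually (\<lambda>n. ennreal (max Z 0) < ennreal (green (\<kappa> n) (N n) (0 :: int ^ 'd))) sequentially"
      using less_LiminfD by blast
    then show "eventually (\<lambda>n. Z \<le> green (\<kappa> n) (N n) (0 :: int ^ 'd)) sequentially"
      by eventually_elim (auto simp: ennreal_less_iff)
  qed
qed

section \<open>The Bose function of a bounded Hamiltonian\<close>

text \<open>For the powers of \<beta> * (z - A), whose exponential series is regrouped by powers of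
  A.\<close>

lemma linear_fps_power_nth:
  fixes u v :: complex
  shows "fps_nth ((fps_const v * fps_X + fps_const u) ^ k) m =
    (if m \<le> k then of_nat (k choose m) * v ^ m * u ^ (k - m) else 0)"
proof -
  have "(fps_const v * fps_X + fps_const u) ^ k =
      (\<Sum>i\<le>k. fps_const (of_nat (k choose i) * v ^ i * u ^ (k - i)) * fps_X ^ i)"
    unfolding binomial_ring
    by (simp add: power_mult_distrib fps_const_power fps_of_nat[symmetric] mult_ac)
  then have "fps_nth ((fps_const v * fps_X + fps_const u) ^ k) m =
      (\<Sum>i\<le>k. of_nat (k choose i) * v ^ i * u ^ (k - i) * (if m = i then 1 else 0))"
    by (simp add: fps_sum_nth fps_X_power_nth)
  then show ?thesis by (simp add: sum.delta' if_distrib[of "\<lambda>c. _ * c"] cong: if_cong)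
qed

context bounded_graph
begin

lemma admissible_diff: "admissible c \<Longrightarrow> admissible d \<Longrightarrow> admissible (c - d)"
  using admissible_add[OF _ admissible_mult[OF admissible_const[of "-1"]], of c d]
  by (simp flip: fps_const_neg)

lemma admissible_power: "admissible c \<Longrightarrow> admissible (c ^ k)"
  by (induction k) auto

lemma admissible_geometric:
  assumes "\<And>m. cmod (fps_nth c m) * b ^ m \<le> C * q ^ m" "0 \<le> q" "q < 1"
  shows "admissible c"
  unfolding admissible_def
  by (rule summable_comparison_test[OF _ summable_mult[OF summable_geometric[of q]], of _ C])
     (use assms b_nonneg in \<open>auto simp: abs_mult\<close>)

lemma admissible_resolvent:
  assumes "z > b" shows "admissible (resolvent_fps z)"
  by (rule admissible_geometric[of _ "1 / z" "b / z"])
     (use assms b_nonneg in \<open>auto simp: resolvent_fps_def norm_divide norm_power power_divide norm_mult\<close>)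

lemma admissible_exp_hamiltonian: "admissible (exp_hamiltonian_fps \<beta> z)"
  unfolding exp_hamiltonian_fps_def
proof (rule admissible_mult[OF admissible_const])
  have "summable (\<lambda>m. (\<bar>\<beta>\<bar> * b) ^ m /\<^sub>R fact m)" by (rule summable_exp_generic)
  then show "admissible (fps_exp (- of_real \<beta>))"
    unfolding admissible_def by (simp add: norm_mult norm_inverse norm_power power_mult_distrib divide_inverse mult_ac)
qed

lemma adj_series_diff:
  assumes "admissible c" "admissible d" "\<xi> \<in> ell2"
  shows "adj_series G (c - d) \<xi> = (\<lambda>x. adj_series G c \<xi> x - adj_series G d \<xi> x)"
proof -
  have eq: "c - d = c + fps_const (-1) * d" by (simp flip: fps_const_neg)
  show ?thesis unfolding eq using adj_series_add[OF assms(1) _ assms(3), of "fps_const (-1) * d"]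
      adj_series_scale[OF assms(2,3), of "-1"] assms by (simp del: fps_const_neg)
qed

lemma adj_series_const: "\<xi> \<in> ell2 \<Longrightarrow> adj_series G (fps_const a) \<xi> = (\<lambda>x. a * \<xi> x)"
  using adj_series_scale[of 1 \<xi> a] by (simp add: adj_series_1)

lemma adj_series_linear_poly:
  assumes "\<xi> \<in> ell2"
  shows "adj_series G (fps_const v * fps_X + fps_const u) \<xi> = (\<lambda>x. v * adj_op G \<xi> x + u * \<xi> x)"
  using assms by (simp add: adj_series_add adj_series_scale adj_series_X adj_series_const)

lemma resolvent_unique:
  assumes z: "z > b" and \<zeta>: "\<zeta> \<in> ell2"
  shows "adj_series G (resolvent_fps z) (\<lambda>x. of_real z * \<zeta> x - adj_op G \<zeta> x) = \<zeta>"
proof -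
  have "(\<lambda>x. of_real z * \<zeta> x - adj_op G \<zeta> x) = adj_series G (fps_const (of_real z) - fps_X) \<zeta>"
    using \<zeta> by (simp add: adj_series_diff adj_series_const adj_series_X)
  then have "adj_series G (resolvent_fps z) (\<lambda>x. of_real z * \<zeta> x - adj_op G \<zeta> x) =
      adj_series G (resolvent_fps z * (fps_const (of_real z) - fps_X)) \<zeta>"
    using adj_series_mult[OF admissible_resolvent[OF z] admissible_diff[OF admissible_const admissible_X] \<zeta>]
    by simp
  also have "resolvent_fps z * (fps_const (of_real z) - fps_X) = 1"
    using resolvent_fps_eq[of z] z b_nonneg by (simp add: mult.commute)
  finally show ?thesis by (simp add: adj_series_1)
qed

lemma resolvent_solves:
  assumes z: "z > b" and \<xi>: "\<xi> \<in> ell2"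
  shows "of_real z * adj_series G (resolvent_fps z) \<xi> x - adj_op G (adj_series G (resolvent_fps z) \<xi>) x = \<xi> x"
proof -
  have R: "adj_series G (resolvent_fps z) \<xi> \<in> ell2"
    by (rule adj_series_ell2[OF admissible_resolvent[OF z] \<xi>])
  have "(\<lambda>x. of_real z * adj_series G (resolvent_fps z) \<xi> x - adj_op G (adj_series G (resolvent_fps z) \<xi>) x) =
      adj_series G ((fps_const (of_real z) - fps_X) * resolvent_fps z) \<xi>"
    unfolding adj_series_mult[OF admissible_diff[OF admissible_const admissible_X] admissible_resolvent[OF z] \<xi>]
    using R by (simp add: adj_series_diff adj_series_const adj_series_X)
  then show ?thesis using resolvent_fps_eq[of z] z b_nonneg by (simp add: adj_series_1 fun_eq_iff)
qed

text \<open>Scalars commute with A, so the exponential of \<beta> * (z - A) is a scalar times an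
  operator exponential. At a fixed coordinate the binomial theorem turns the series of
  \<open>op_exp\<close> into the Cauchy product of these two.\<close>

lemma op_exp_hamiltonian:
  assumes \<xi>: "\<xi> \<in> ell2"
  shows "op_exp (\<lambda>\<phi> y. of_real \<beta> * (of_real z * \<phi> y - adj_op G \<phi> y)) \<xi> =
    adj_series G (exp_hamiltonian_fps \<beta> z) \<xi>"
proof
  fix x
  define u v where "u = complex_of_real \<beta> * of_real z" and "v = - complex_of_real \<beta>"
  let ?T = "\<lambda>\<phi> y. of_real \<beta> * (of_real z * \<phi> y - adj_op G \<phi> y)"
  let ?p = "fps_const v * fps_X + fps_const u"
  have p: "admissible ?p" by (intro admissible_add admissible_mult admissible_const admissible_X)
  have T: "?T \<phi> = adj_series G ?p \<phi>" if "\<phi> \<in> ell2" for \<phi>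
    using adj_series_linear_poly[OF that, of v u] by (auto simp: u_def v_def algebra_simps)
  have pow: "(?T ^^ k) \<xi> = adj_series G (?p ^ k) \<xi>" for k
  proof (induction k)
    case (Suc k)
    have "(?T ^^ Suc k) \<xi> = adj_series G ?p (adj_series G (?p ^ k) \<xi>)"
      using T[OF adj_series_ell2[OF admissible_power[OF p, of k] \<xi>]] Suc by simp
    also have "\<dots> = adj_series G (?p * ?p ^ k) \<xi>"
      by (rule adj_series_mult[OF p admissible_power[OF p] \<xi>, symmetric])
    finally show ?case by simp
  qed (simp add: adj_series_1)
  let ?a = "\<lambda>i. v ^ i / fact i * (adj_op G ^^ i) \<xi> x" and ?b = "\<lambda>j. u ^ j / fact j"
  have summand: "(?T ^^ k) \<xi> x / fact k = (\<Sum>i\<le>k. ?a i * ?b (k - i))" for k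
  proof -
    have "adj_series G (?p ^ k) \<xi> x = (\<Sum>i\<le>k. fps_nth (?p ^ k) i * (adj_op G ^^ i) \<xi> x)"
      unfolding adj_series_def by (rule suminf_finite) (auto simp: linear_fps_power_nth)
    then have "(?T ^^ k) \<xi> x / fact k =
        (\<Sum>i\<le>k. of_nat (k choose i) * v ^ i * u ^ (k - i) * (adj_op G ^^ i) \<xi> x / fact k)"
      unfolding pow by (simp add: linear_fps_power_nth sum_divide_distrib)
    also have "\<dots> = (\<Sum>i\<le>k. ?a i * ?b (k - i))"
      by (intro sum.cong refl) (auto simp: binomial_fact field_simps)
    finally show ?thesis .
  qed
  have adm: "admissible (fps_exp v)"
    using admissible_exp_hamiltonian[of \<beta> 0] by (simp add: exp_hamiltonian_fps_def v_def)
  have "summable (\<lambda>i. cmod (?a i))" using adj_series_summable[OF adm \<xi>, of x] by simp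
  moreover have "summable (\<lambda>j. cmod (?b j))"
    using summable_norm_exp[of u] by (simp add: divide_inverse mult.commute scaleR_conv_of_real)
  ultimately have "(\<lambda>k. \<Sum>i\<le>k. ?a i * ?b (k - i)) sums ((\<Sum>i. ?a i) * (\<Sum>j. ?b j))"
    by (rule Cauchy_product_sums)
  moreover have "(\<Sum>j. ?b j) = exp u" by (simp add: exp_def divide_inverse mult.commute scaleR_conv_of_real)
  moreover have "(\<Sum>i. ?a i) = adj_series G (fps_exp v) \<xi> x" by (simp add: adj_series_def)
  moreover have "adj_series G (exp_hamiltonian_fps \<beta> z) \<xi> x = exp u * adj_series G (fps_exp v) \<xi> x"
    unfolding exp_hamiltonian_fps_def u_def v_def
    using adj_series_scale[OF adm \<xi>] by (simp add: v_def)
  ultimately show "op_exp ?T \<xi> x = adj_series G (exp_hamiltonian_fps \<beta> z) \<xi> x"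
    unfolding op_exp_def summand by (simp add: sums_iff mult.commute)
qed

text \<open>An inverse in the ring of formal power series is a two-sided inverse on
  \<open>ell2\<close>. One side gives injectivity, which matters because \<open>op_inverse\<close>
  chooses a preimage; the other side exhibits the preimage.\<close>

lemma op_inverse_bose:
  assumes f: "admissible f" "(exp_hamiltonian_fps \<beta> z - 1) * f = 1" and \<xi>: "\<xi> \<in> ell2"
  shows "op_inverse (\<lambda>\<zeta> x. op_exp (\<lambda>\<phi> y. of_real \<beta> * (of_real z * \<phi> y - adj_op G \<phi> y)) \<zeta> x - \<zeta> x) \<xi> =
    adj_series G f \<xi>"
proof -
  let ?e = "exp_hamiltonian_fps \<beta> z - 1"
  let ?T = "\<lambda>\<zeta> x. op_exp (\<lambda>\<phi> y. of_real \<beta> * (of_real z * \<phi> y - adj_op G \<phi> y)) \<zeta> x - \<zeta> x"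
  have e: "admissible ?e" by (intro admissible_diff admissible_exp_hamiltonian admissible_1)
  have T: "?T \<zeta> = adj_series G ?e \<zeta>" if "\<zeta> \<in> ell2" for \<zeta>
    using that by (simp add: op_exp_hamiltonian adj_series_diff admissible_exp_hamiltonian adj_series_1)
  have left: "adj_series G f (?T \<zeta>) = \<zeta>" if "\<zeta> \<in> ell2" for \<zeta>
    using adj_series_mult[OF f(1) e that] f(2) unfolding T[OF that]
    by (simp add: mult.commute adj_series_1)
  have "?T (adj_series G f \<xi>) = \<xi>"
    using adj_series_mult[OF e f(1) \<xi>] f(2) unfolding T[OF adj_series_ell2[OF f(1) \<xi>]]
    by (simp add: adj_series_1)
  moreover have "inj_on ?T ell2" by (rule inj_on_inverseI[where g="adj_series G f"]) (rule left)
  ultimately show ?thesis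
    unfolding op_inverse_def by (intro inv_into_f_eq adj_series_ell2[OF f(1) \<xi>])
qed

lemma op_inverse_resolvent:
  assumes z: "z > b" and \<xi>: "\<xi> \<in> ell2"
  shows "op_inverse (\<lambda>\<zeta> x. of_real z * \<zeta> x - adj_op G \<zeta> x) \<xi> = adj_series G (resolvent_fps z) \<xi>"
proof -
  have "inj_on (\<lambda>\<zeta> x. of_real z * \<zeta> x - adj_op G \<zeta> x) ell2"
    by (rule inj_on_inverseI[where g="adj_series G (resolvent_fps z)"]) (rule resolvent_unique[OF z])
  then show ?thesis unfolding op_inverse_def
    by (intro inv_into_f_eq adj_series_ell2[OF admissible_resolvent[OF z] \<xi>]) (auto simp: resolvent_solves[OF z \<xi>])
qed

end

section \<open>Convergence of local graphs\<close>

text \<open>Local convergence: the neighbourhood of each fixed vertex stabilises. Hence for each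
  power of the adjacency operators the values at a fixed vertex eventually agree.\<close>

definition graph_converges :: "(nat \<Rightarrow> 'a pair_pre_digraph) \<Rightarrow> 'a pair_pre_digraph \<Rightarrow> bool" where
  "graph_converges H G \<longleftrightarrow>
     (\<forall>x. eventually (\<lambda>n. {y. (x, y) \<in> parcs (H n)} = {y. (x, y) \<in> parcs G}) sequentially)"

lemma adj_op_cong:
  assumes "{y. (x, y) \<in> parcs H} = {y. (x, y) \<in> parcs G}" "\<And>y. (x, y) \<in> parcs G \<Longrightarrow> f y = g y"
  shows "adj_op H f x = adj_op G g x"
  unfolding adj_op_def by (rule sum.cong) (use assms in auto)

lemma graph_converges_pow:
  assumes "graph_converges H G" "\<And>x. finite {y. (x, y) \<in> parcs G}"
  shows "eventually (\<lambda>n. (adj_op (H n) ^^ m) \<xi> x = (adj_op G ^^ m) \<xi> x) sequentially"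
proof (induction m arbitrary: x)
  case (Suc m)
  have "eventually (\<lambda>n. \<forall>y\<in>{y. (x, y) \<in> parcs G}. (adj_op (H n) ^^ m) \<xi> y = (adj_op G ^^ m) \<xi> y) sequentially"
    by (intro eventually_ball_finite assms(2)) (use Suc in auto)
  moreover have "eventually (\<lambda>n. {y. (x, y) \<in> parcs (H n)} = {y. (x, y) \<in> parcs G}) sequentially"
    using assms(1) by (auto simp: graph_converges_def)
  ultimately show ?case
    by eventually_elim (auto intro!: adj_op_cong)
qed auto

text \<open>Matrix elements converge for each power separately, and the common majorant
  \<open>M\<close> lets Tannery's theorem exchange the limit with the series.\<close>

lemma adj_series_weak_convergence:
  assumes H: "\<And>n. bounded_graph (H n) b" and G: "bounded_graph G b" and conv: "graph_converges H G"
    and c: "\<And>m. (\<lambda>n. fps_nth (c n) m) \<longlonglongrightarrow> fps_nth c' m"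
    and M: "summable M" "\<And>n m. cmod (fps_nth (c n) m) * b ^ m \<le> M m"
    and \<xi>: "\<xi> \<in> ell2" and \<eta>: "\<eta> \<in> ell2"
  shows "(\<lambda>n. ell2_inner \<eta> (adj_series (H n) (c n) \<xi>)) \<longlonglongrightarrow> ell2_inner \<eta> (adj_series G c' \<xi>)"
proof -
  interpret G: bounded_graph G b by (rule G)
  have M': "cmod (fps_nth c' m) * b ^ m \<le> M m" for m
    by (rule Lim_bounded[where M=0, OF tendsto_mult_right[OF tendsto_norm[OF c]]]) (use M(2) in auto)
  have admG: "G.admissible c'" unfolding G.admissible_def
    by (rule summable_comparison_test[OF _ M(1)]) (use M' G.b_nonneg in \<open>auto simp: abs_mult\<close>)
  have inner_bound: "cmod (fps_nth e m * ell2_inner \<eta> ((adj_op K ^^ m) \<xi>)) \<le> M m * (ell2_norm \<eta> * ell2_norm \<xi>)"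
    if K: "bounded_graph K b" and e: "cmod (fps_nth e m) * b ^ m \<le> M m" for K e m
  proof -
    interpret K: bounded_graph K b by (rule K)
    have "cmod (ell2_inner \<eta> ((adj_op K ^^ m) \<xi>)) \<le> ell2_norm \<eta> * (b ^ m * ell2_norm \<xi>)"
      by (rule order_trans[OF ell2_Cauchy_Schwarz[OF \<eta> K.pow_ell2[OF \<xi>]]])
         (intro mult_left_mono K.pow_norm_le \<xi> ell2_norm_nonneg)
    then have "cmod (fps_nth e m) * cmod (ell2_inner \<eta> ((adj_op K ^^ m) \<xi>)) \<le>
        cmod (fps_nth e m) * (ell2_norm \<eta> * (b ^ m * ell2_norm \<xi>))" by (intro mult_left_mono) auto
    also have "\<dots> = cmod (fps_nth e m) * b ^ m * (ell2_norm \<eta> * ell2_norm \<xi>)" by simp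
    also have "\<dots> \<le> M m * (ell2_norm \<eta> * ell2_norm \<xi>)" by (intro mult_right_mono e mult_nonneg_nonneg) auto
    finally show ?thesis by (simp add: norm_mult)
  qed
  have summand: "(\<lambda>n. fps_nth (c n) m * ell2_inner \<eta> ((adj_op (H n) ^^ m) \<xi>)) \<longlonglongrightarrow>
      fps_nth c' m * ell2_inner \<eta> ((adj_op G ^^ m) \<xi>)" for m
  proof (intro tendsto_mult c)
    show "(\<lambda>n. ell2_inner \<eta> ((adj_op (H n) ^^ m) \<xi>)) \<longlonglongrightarrow> ell2_inner \<eta> ((adj_op G ^^ m) \<xi>)"
    proof (rule ell2_weak_convergence[OF \<eta> G.pow_ell2[OF \<xi>]])
      fix n
      interpret K: bounded_graph "H n" b by (rule H)
      show "(adj_op (H n) ^^ m) \<xi> \<in> ell2" "ell2_norm ((adj_op (H n) ^^ m) \<xi>) \<le> b ^ m * ell2_norm \<xi>"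
        by (rule K.pow_ell2[OF \<xi>], rule K.pow_norm_le[OF \<xi>])
    next
      fix x
      show "(\<lambda>n. (adj_op (H n) ^^ m) \<xi> x) \<longlonglongrightarrow> (adj_op G ^^ m) \<xi> x"
        by (rule tendsto_eventually[OF graph_converges_pow[OF conv G.fin]])
    qed
  qed
  have "(\<lambda>n. \<Sum>m. fps_nth (c n) m * ell2_inner \<eta> ((adj_op (H n) ^^ m) \<xi>)) \<longlonglongrightarrow>
      (\<Sum>m. fps_nth c' m * ell2_inner \<eta> ((adj_op G ^^ m) \<xi>))"
    using tannerys_theorem[where M="\<lambda>m. M m * (ell2_norm \<eta> * ell2_norm \<xi>)", OF summand
        always_eventually summable_mult2[OF M(1)]] inner_bound[OF H M(2)] by auto
  moreover have "(\<Sum>m. fps_nth (c n) m * ell2_inner \<eta> ((adj_op (H n) ^^ m) \<xi>)) =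
      ell2_inner \<eta> (adj_series (H n) (c n) \<xi>)" for n
  proof -
    interpret K: bounded_graph "H n" b by (rule H)
    have "K.admissible (c n)" unfolding K.admissible_def
      by (rule summable_comparison_test[OF _ M(1)]) (use M(2) K.b_nonneg in \<open>auto simp: abs_mult\<close>)
    from K.adj_series_inner_sums[OF this \<xi> \<eta>] show ?thesis by (simp add: sums_iff)
  qed
  moreover have "(\<Sum>m. fps_nth c' m * ell2_inner \<eta> ((adj_op G ^^ m) \<xi>)) = ell2_inner \<eta> (adj_series G c' \<xi>)"
    using G.adj_series_inner_sums[OF admG \<xi> \<eta>] by (simp add: sums_iff)
  ultimately show ?thesis by simp
qed

text \<open>The geometric majorant requires the gap \<open>b < a\<close>. The teeth have it, with b
  = 2, but not the comb boxes, for which the parameter tends to the bound itself.\<close>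

lemma resolvent_weak_convergence:
  assumes H: "\<And>n. bounded_graph (H n) b" and G: "bounded_graph G b" and conv: "graph_converges H G"
    and a: "b < a" "\<And>n. a \<le> z n" "z \<longlonglongrightarrow> a"
    and \<xi>: "\<xi> \<in> ell2" and \<eta>: "\<eta> \<in> ell2"
  shows "(\<lambda>n. ell2_inner \<eta> (adj_series (H n) (resolvent_fps (z n)) \<xi>)) \<longlonglongrightarrow>
    ell2_inner \<eta> (adj_series G (resolvent_fps a) \<xi>)"
proof (rule adj_series_weak_convergence[OF H G conv _ _ _ \<xi> \<eta>, where M="\<lambda>m. 1 / a * (b / a) ^ m"])
  have b: "b \<ge> 0" using G by (simp add: bounded_graph_def)
  then have a0: "a > 0" using a(1) by linarith
  show "(\<lambda>n. fps_nth (resolvent_fps (z n)) m) \<longlonglongrightarrow> fps_nth (resolvent_fps a) m" for m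
    unfolding resolvent_fps_def using a0 by (auto intro!: tendsto_intros a(3))
  show "summable (\<lambda>m. 1 / a * (b / a) ^ m)"
    using a a0 b by (intro summable_mult summable_geometric) auto
  fix n m
  have "1 / (z n) ^ Suc m \<le> 1 / a ^ Suc m"
    using a(2)[of n] a0 by (intro divide_left_mono power_mono mult_pos_pos zero_less_power) auto
  then have "1 / (z n) ^ Suc m * b ^ m \<le> 1 / a ^ Suc m * b ^ m"
    by (rule mult_right_mono) (use b in auto)
  moreover have "cmod (fps_nth (resolvent_fps (z n)) m) = 1 / (z n) ^ Suc m"
    using a(2)[of n] a0 by (simp add: resolvent_fps_def norm_divide norm_mult norm_power)
  ultimately show "cmod (fps_nth (resolvent_fps (z n)) m) * b ^ m \<le> 1 / a * (b / a) ^ m"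
    by (simp add: power_divide)
qed

section \<open>Neighbourhoods in the lattice, the torus and the comb\<close>

abbreviation nbrs :: "'a pair_pre_digraph \<Rightarrow> 'a \<Rightarrow> 'a set" where
  "nbrs G x \<equiv> {y. (x, y) \<in> parcs G}"

abbreviation steps :: "('d::finite \<times> int) set" where
  "steps \<equiv> UNIV \<times> {1, -1}"

lemma sum_steps:
  fixes f :: "int ^ 'd::finite \<Rightarrow> 'b::comm_monoid_add"
  shows "(\<Sum>(i, s)\<in>steps. f (x + axis i s)) = (\<Sum>i\<in>UNIV. f (x + axis i 1) + f (x - axis i 1))"
proof -
  have "x + axis i (-1) = x - axis i 1" for i by (auto simp: vec_eq_iff axis_def)
  then show ?thesis by (simp add: sum.cartesian_product[symmetric])
qed

lemma lattice_nbrs: "nbrs lattice_graph x = (\<lambda>(i, s). x + axis i s) ` steps"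
proof (intro equalityI subsetI)
  fix y assume "y \<in> nbrs lattice_graph x"
  then obtain i where i: "\<bar>x $ i - y $ i\<bar> = 1" "\<And>j. j \<noteq> i \<Longrightarrow> x $ j = y $ j"
    by (auto simp: lattice_graph_def)
  have "y = x + axis i (y $ i - x $ i)" using i by (auto simp: vec_eq_iff axis_def)
  moreover have "y $ i - x $ i \<in> {1, -1}" using i(1) by auto
  ultimately show "y \<in> (\<lambda>(i, s). x + axis i s) ` steps"
    by (intro image_eqI[of _ _ "(i, y $ i - x $ i)"]) auto
next
  fix y assume "y \<in> (\<lambda>(i, s). x + axis i s) ` steps"
  then obtain i s where y: "y = x + axis i s" "s \<in> {1, -1}" by auto
  then have "\<bar>x $ i - y $ i\<bar> = 1 \<and> (\<forall>j. j \<noteq> i \<longrightarrow> x $ j = y $ j)" by (auto simp: axis_def)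
  then show "y \<in> nbrs lattice_graph x" by (auto simp: lattice_graph_def)
qed

lemma lattice_sum:
  fixes f :: "int ^ 'd::finite \<Rightarrow> 'b::comm_monoid_add"
  shows "(\<Sum>y\<in>nbrs lattice_graph x. f y) = (\<Sum>i\<in>UNIV. f (x + axis i 1) + f (x - axis i 1))"
proof -
  have "inj_on (\<lambda>(i, s). x + axis i s) steps" by (auto simp: inj_on_def axis_eq_axis)
  then show ?thesis unfolding lattice_nbrs sum_steps[symmetric]
    by (simp add: sum.reindex case_prod_unfold)
qed

lemma lattice_card: "card (nbrs lattice_graph (x :: int ^ 'd::finite)) = 2 * CARD('d)"
  using lattice_sum[of "\<lambda>_. 1::nat" x] by simp

section \<open>The torus as a quotient of the lattice\<close>

definition wrap :: "nat \<Rightarrow> int ^ 'd::finite \<Rightarrow> int ^ 'd" where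
  "wrap n x = (\<chi> i. (x $ i + int n) mod (2 * int n + 1) - int n)"

abbreviation cube :: "nat \<Rightarrow> (int ^ 'd::finite) set" where
  "cube n \<equiv> {x. \<forall>i. - int n \<le> x $ i \<and> x $ i \<le> int n}"

lemma pverts_lattice [simp]: "pverts lattice_graph = UNIV"
  by (simp add: lattice_graph_def)

lemma pverts_torus [simp]: "pverts (torus_graph n) = cube n"
  by (simp add: torus_graph_def Let_def)

lemma wrap_cong: "[wrap n x $ i = x $ i] (mod (2 * int n + 1))"
  by (simp add: wrap_def cong_def mod_simps)

lemma wrap_in_cube: "wrap n x \<in> cube n"
proof -
  have "0 \<le> (x $ i + int n) mod (2 * int n + 1) \<and> (x $ i + int n) mod (2 * int n + 1) \<le> 2 * int n" for i
    using pos_mod_sign[of "2 * int n + 1" "x $ i + int n"] pos_mod_bound[of "2 * int n + 1" "x $ i + int n"]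
    by linarith
  then show ?thesis by (force simp: wrap_def)
qed

lemma wrap_unique:
  assumes "- int n \<le> y \<and> y \<le> int n" "[y = x $ i] (mod (2 * int n + 1))"
  shows "wrap n x $ i = y"
proof -
  have "(y + int n) mod (2 * int n + 1) = (x $ i + int n) mod (2 * int n + 1)"
    using assms(2) by (metis cong_add_rcancel cong_def)
  moreover have "(y + int n) mod (2 * int n + 1) = y + int n"
    using assms(1) by (intro mod_pos_pos_trivial) auto
  ultimately show ?thesis by (simp add: wrap_def)
qed

lemma wrap_id: "x \<in> cube n \<Longrightarrow> wrap n x = x"
  using wrap_unique[of n "x $ i" x i for i] by (auto simp: vec_eq_iff)

text \<open>For n >= 1 the period is at least 3, so unit steps and differences of two of them vanish
  modulo the period only if they are zero. Hence the 2 * d torus neighbours are distinct and there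
  are no loops.\<close>

lemma small_multiple:
  fixes k :: int assumes "2 * int n + 1 dvd k" "\<bar>k\<bar> \<le> 2" "n \<ge> 1" shows "k = 0"
proof (rule ccontr)
  assume "k \<noteq> 0"
  then have "2 * int n + 1 \<le> \<bar>k\<bar>" using assms(1) by (intro zdvd_imp_le) auto
  then show False using assms by linarith
qed

lemma torus_nbrs:
  fixes x :: "int ^ 'd::finite"
  assumes n: "n \<ge> 1" and x: "x \<in> cube n"
  shows "nbrs (torus_graph n) x = (\<lambda>(i, s). wrap n (x + axis i s)) ` steps"
proof (intro equalityI subsetI)
  fix y assume "y \<in> nbrs (torus_graph n) x"
  then obtain i where y: "y \<in> cube n"
    and i: "[x $ i = y $ i + 1] (mod (2 * int n + 1)) \<or> [y $ i = x $ i + 1] (mod (2 * int n + 1))"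
      "\<And>j. j \<noteq> i \<Longrightarrow> x $ j = y $ j"
    by (auto simp: torus_graph_def Let_def)
  have "\<exists>s\<in>{1, -1}. [y $ i = x $ i + s] (mod (2 * int n + 1))"
  proof (rule disjE[OF i(1)])
    assume "[x $ i = y $ i + 1] (mod (2 * int n + 1))"
    from cong_diff[OF cong_sym[OF this] cong_refl[of 1]] show ?thesis by auto
  qed auto
  then obtain s where s: "s \<in> {1, -1}" "[y $ i = x $ i + s] (mod (2 * int n + 1))" by blast
  have "wrap n (x + axis i s) $ j = y $ j" for j
    by (rule wrap_unique) (use y s i(2)[of j] in \<open>auto simp: axis_def\<close>)
  then have "y = wrap n (x + axis i s)" by (simp add: vec_eq_iff)
  then show "y \<in> (\<lambda>(i, s). wrap n (x + axis i s)) ` steps" using s(1) by force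
next
  fix y assume "y \<in> (\<lambda>(i, s). wrap n (x + axis i s)) ` steps"
  then obtain i s where s: "y = wrap n (x + axis i s)" "s \<in> {1, -1}" by auto
  have c: "[y $ i = x $ i + s] (mod (2 * int n + 1))"
    using wrap_cong[of n "x + axis i s" i] s by (simp add: axis_def)
  have "wrap n (x + axis i s) $ j = x $ j" if "j \<noteq> i" for j
    by (rule wrap_unique) (use x that in \<open>auto simp: axis_def\<close>)
  then have j: "\<forall>j. j \<noteq> i \<longrightarrow> x $ j = y $ j" using s by simp
  have "x \<noteq> y"
  proof
    assume "x = y"
    then have "[0 = s] (mod (2 * int n + 1))"
      using c cong_add_lcancel[of "x $ i" 0 s] by simp
    then have "[s = 0] (mod (2 * int n + 1))" by (rule cong_sym)
    then have "2 * int n + 1 dvd s" by (simp only: cong_0_iff)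
    then show False using small_multiple[of n s] n s(2) by auto
  qed
  moreover have "[x $ i = y $ i + 1] (mod (2 * int n + 1)) \<or> [y $ i = x $ i + 1] (mod (2 * int n + 1))"
  proof (cases "s = 1")
    case False
    then have "s = -1" using s by auto
    from cong_add[OF c cong_refl[of 1]] show ?thesis unfolding \<open>s = -1\<close> by (simp add: cong_sym)
  qed (use c in auto)
  moreover have "y \<in> cube n" using wrap_in_cube s by blast
  ultimately show "y \<in> nbrs (torus_graph n) x" using x j by (auto simp: torus_graph_def Let_def)
qed

lemma torus_sum:
  fixes f :: "int ^ 'd::finite \<Rightarrow> 'b::comm_monoid_add"
  assumes n: "n \<ge> 1" and x: "x \<in> cube n"
  shows "(\<Sum>y\<in>nbrs (torus_graph n) x. f y) =
    (\<Sum>i\<in>UNIV. f (wrap n (x + axis i 1)) + f (wrap n (x - axis i 1)))"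
proof -
  have "inj_on (\<lambda>(i, s). wrap n (x + axis i s)) steps"
  proof (rule inj_onI, clarify)
    fix i j s t
    assume s: "s \<in> {1, -1::int}" and t: "t \<in> {1, -1::int}" and eq: "wrap n (x + axis i s) = wrap n (x + axis j t)"
    have "2 * int n + 1 dvd (x + axis i s) $ k - (x + axis j t) $ k" for k
      using cong_trans[OF cong_sym[OF wrap_cong[of n "x + axis i s" k, unfolded eq]] wrap_cong[of n "x + axis j t" k]]
      by (simp only: cong_iff_dvd_diff)
    then have dv: "2 * int n + 1 dvd axis i s $ k - axis j t $ k" for k by simp
    have ij: "i = j"
    proof (rule ccontr)
      assume "i \<noteq> j"
      then have "2 * int n + 1 dvd s" using dv[of i] by (simp add: axis_def)
      then show False using small_multiple[of n s] n s by auto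
    qed
    then have "2 * int n + 1 dvd s - t" using dv[of i] by (simp add: axis_def)
    then have "s - t = 0" using s t n by (intro small_multiple[of n]) auto
    then show "i = j \<and> s = t" using ij by simp
  qed
  then show ?thesis unfolding torus_nbrs[OF assms] sum_steps[of "\<lambda>y. f (wrap n y)", symmetric]
    by (simp add: sum.reindex case_prod_unfold)
qed

lemma torus_nbrs_outside: "x \<notin> cube n \<Longrightarrow> nbrs (torus_graph n) x = {}"
  by (auto simp: torus_graph_def Let_def)

lemma torus_arcs: "(x, y) \<in> parcs (torus_graph n) \<Longrightarrow> x \<in> cube n \<and> y \<in> cube n"
  by (auto simp: torus_graph_def Let_def)

lemma torus_nbrs_0: "nbrs (torus_graph 0) (x :: int ^ 'd::finite) = {}"
  by (auto simp: torus_graph_def Let_def vec_eq_iff intro: order_antisym)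

text \<open>The inequality is what the Schur test asks for, and it also covers the one-point torus
  and vertices outside the cube, which have no neighbours.\<close>

lemma torus_fin_card:
  fixes x :: "int ^ 'd::finite"
  shows "finite (nbrs (torus_graph n) x)" "card (nbrs (torus_graph n) x) \<le> 2 * CARD('d)"
proof -
  have "finite (nbrs (torus_graph n) x) \<and> card (nbrs (torus_graph n) x) \<le> 2 * CARD('d)"
  proof (cases "n \<ge> 1 \<and> x \<in> cube n")
    case True
    have "card (nbrs (torus_graph n) x) \<le> card (steps :: ('d \<times> int) set)"
      unfolding torus_nbrs[OF conjunct1[OF True] conjunct2[OF True]] by (rule card_image_le) auto
    then show ?thesis using True by (simp add: torus_nbrs card_cartesian_product)
  next
    case False
    then consider "n = 0" | "x \<notin> cube n" by linarith
    then have nb: "nbrs (torus_graph n) x = {}"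
      by cases (simp only: torus_nbrs_0, rule torus_nbrs_outside)
    show ?thesis unfolding nb by simp
  qed
  then show "finite (nbrs (torus_graph n) x)" "card (nbrs (torus_graph n) x) \<le> 2 * CARD('d)" by auto
qed

section \<open>Lines, paths and comb products\<close>

lemma line_nbrs: "nbrs line_graph h = {h + 1, h - 1}"
  by (auto simp: line_graph_def)

lemma path_nbrs: "nbrs (path_graph n) h = (if \<bar>h\<bar> \<le> int n then {h + 1, h - 1} \<inter> {- int n..int n} else {})"
  by (auto simp: path_graph_def)

lemma comb_product_nbrs:
  "nbrs (comb_product G K r) (g, h) =
    (if g \<in> pverts G then Pair g ` nbrs K h else {}) \<union> (if h = r then (\<lambda>g'. (g', r)) ` nbrs G g else {})"
  by (auto simp: comb_product_def)

lemma comb_product_finite: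
  assumes "finite (nbrs K h)" "finite (nbrs G g)"
  shows "finite (nbrs (comb_product G K r) (g, h))"
  unfolding comb_product_nbrs using assms by auto

lemma comb_product_sum:
  fixes f :: "'a \<times> 'b \<Rightarrow> 'c::comm_monoid_add"
  assumes "finite (nbrs K h)" "finite (nbrs G g)" "(r, r) \<notin> parcs K"
  shows "(\<Sum>y\<in>nbrs (comb_product G K r) (g, h). f y) =
    (if g \<in> pverts G then \<Sum>h'\<in>nbrs K h. f (g, h') else 0) +
    (if h = r then \<Sum>g'\<in>nbrs G g. f (g', r) else 0)"
  unfolding comb_product_nbrs using assms
  by (subst sum.union_disjoint) (auto simp: sum.reindex inj_on_def)

lemma adj_op_comb_product:
  assumes "finite (nbrs K h)" "finite (nbrs G g)" "(r, r) \<notin> parcs K"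
  shows "adj_op (comb_product G K r) \<xi> (g, h) =
    (if g \<in> pverts G then adj_op K (fiber \<xi> g) h else 0) +
    (if h = r then adj_op G (\<lambda>g'. \<xi> (g', r)) g else 0)"
  unfolding adj_op_def[of "comb_product G K r"] comb_product_sum[OF assms]
  by (simp add: adj_op_def fiber_def)

lemma comb_product_sym:
  assumes "sym (parcs G)" "sym (parcs K)" "\<And>g g'. (g, g') \<in> parcs G \<Longrightarrow> g \<in> pverts G \<and> g' \<in> pverts G"
  shows "sym (parcs (comb_product G K r))"
  using assms by (auto simp: comb_product_def sym_def)

lemma sym_lattice: "sym (parcs lattice_graph)"
  by (auto simp: lattice_graph_def sym_def) (metis abs_minus_commute)
lemma sym_torus: "sym (parcs (torus_graph n))"
  by (auto simp: torus_graph_def sym_def Let_def)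
lemma sym_line: "sym (parcs line_graph)"
  by (auto simp: line_graph_def sym_def)
lemma sym_path: "sym (parcs (path_graph n))"
  by (auto simp: path_graph_def sym_def)

text \<open>The box without its backbone edges, written as a comb over an edgeless base: a disjoint
  union of paths. It is the reference operator of the Schur complement.\<close>

definition teeth_graph :: "nat \<Rightarrow> ((int ^ 'd::finite) \<times> int) pair_pre_digraph" where
  "teeth_graph n = comb_product \<lparr> pverts = cube n, parcs = {} \<rparr> (path_graph n) 0"

definition all_teeth_graph :: "((int ^ 'd::finite) \<times> int) pair_pre_digraph" where
  "all_teeth_graph = comb_product \<lparr> pverts = UNIV, parcs = {} \<rparr> line_graph 0"

lemma sym_teeth: "sym (parcs K) \<Longrightarrow> sym (parcs (comb_product \<lparr> pverts = V, parcs = {} \<rparr> K r))"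
  by (auto simp: comb_product_def sym_def)

lemma bounded_graph_Schur:
  fixes v :: "'a \<Rightarrow> real"
  assumes "sym (parcs G)" "\<And>x. finite (nbrs G x)" "\<And>x. v x > 0"
    "\<And>x. (\<Sum>y\<in>nbrs G x. v y) \<le> b * v x" "b \<ge> 0"
  shows "bounded_graph G b"
proof
  fix \<xi> :: "'a \<Rightarrow> complex" assume \<xi>: "\<xi> \<in> ell2"
  show "adj_op G \<xi> \<in> ell2" "ell2_norm (adj_op G \<xi>) \<le> b * ell2_norm \<xi>"
    using adj_op_Schur_test[of G v b, OF _ assms(2-5) \<xi>] assms(1) by (auto simp: sym_def)
qed (use assms in \<open>auto simp: sym_def\<close>)

lemma path_sum_le:
  assumes "\<And>h. f h \<ge> (0::real)"
  shows "(\<Sum>h'\<in>nbrs (path_graph n) h. f h') \<le> f (h + 1) + f (h - 1)"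
proof -
  have "(\<Sum>h'\<in>nbrs (path_graph n) h. f h') \<le> (\<Sum>h'\<in>{h + 1, h - 1}. f h')"
    by (rule sum_mono2) (use assms in \<open>auto simp: path_nbrs\<close>)
  then show ?thesis by simp
qed

lemma path_finite: "finite (nbrs (path_graph n) h)" by (simp add: path_nbrs)
lemma line_finite: "finite (nbrs line_graph h)" by (simp add: line_nbrs)
lemma lattice_finite: "finite (nbrs lattice_graph x)" unfolding lattice_nbrs by auto
lemma path_no_loop: "(h, h) \<notin> parcs (path_graph n)" by (simp add: path_graph_def)
lemma line_no_loop: "(h, h) \<notin> parcs line_graph" by (simp add: line_graph_def)

lemma bounded_line: "bounded_graph line_graph 2"
  by (rule bounded_graph_Schur[where v="\<lambda>_. 1"]) (auto simp: sym_line line_nbrs)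

lemma bounded_path: "bounded_graph (path_graph n) 2"
proof (rule bounded_graph_Schur[where v="\<lambda>_. 1"])
  show "(\<Sum>y\<in>nbrs (path_graph n) h. 1) \<le> 2 * (1::real)" for h
    using path_sum_le[of "\<lambda>_. 1" h n] by simp
qed (auto simp: sym_path path_finite)

lemma bounded_teeth: "bounded_graph (teeth_graph n :: ((int ^ 'd::finite) \<times> int) pair_pre_digraph) 2"
proof (rule bounded_graph_Schur[where v="\<lambda>_. 1"])
  fix x :: "(int ^ 'd) \<times> int"
  obtain j h where x: "x = (j, h)" by force
  show "finite (nbrs (teeth_graph n) x)"
    unfolding x teeth_graph_def by (rule comb_product_finite) (auto simp: path_finite)
  show "(\<Sum>y\<in>nbrs (teeth_graph n) x. 1) \<le> 2 * (1::real)"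
    unfolding x teeth_graph_def using path_sum_le[of "\<lambda>_. 1" h n]
    by (subst comb_product_sum) (auto simp: path_finite path_no_loop)
qed (auto simp: teeth_graph_def sym_path sym_teeth)

lemma bounded_all_teeth: "bounded_graph (all_teeth_graph :: ((int ^ 'd::finite) \<times> int) pair_pre_digraph) 2"
proof (rule bounded_graph_Schur[where v="\<lambda>_. 1"])
  fix x :: "(int ^ 'd) \<times> int"
  obtain j h where x: "x = (j, h)" by force
  show "finite (nbrs all_teeth_graph x)"
    unfolding x all_teeth_graph_def by (rule comb_product_finite) (auto simp: line_finite)
  show "(\<Sum>y\<in>nbrs all_teeth_graph x. 1) \<le> 2 * (1::real)"
    unfolding x all_teeth_graph_def
    by (subst comb_product_sum) (auto simp: line_nbrs line_no_loop)
qed (auto simp: all_teeth_graph_def sym_line sym_teeth)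

text \<open>For an eigenfunction 1 \<otimes> t^|h| with eigenvalue a, the equation reads t + 1 / t =
  a off the backbone and 2 * t + 2 * d = a on it. Eliminating a gives 1 / t - t = 2 * d, whose
  positive root is \<open>comb_decay d\<close>, and then a = \<open>comb_norm d\<close>.\<close>

definition comb_norm :: "real \<Rightarrow> real" where "comb_norm d = 2 * sqrt (1 + d\<^sup>2)"

definition comb_decay :: "real \<Rightarrow> real" where "comb_decay d = sqrt (1 + d\<^sup>2) - d"

lemma comb_decay:
  assumes "d > 0"
  shows "0 < comb_decay d" "comb_decay d < 1" "comb_decay d + 1 / comb_decay d = comb_norm d"
    "2 * comb_decay d + 2 * d = comb_norm d" "comb_norm d > 2"
proof -
  have s: "sqrt (1 + d\<^sup>2) > d" using assms by (intro real_less_rsqrt) auto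
  then show t: "0 < comb_decay d" by (simp add: comb_decay_def)
  have "sqrt (1 + d\<^sup>2) < 1 + d" using assms by (intro real_less_lsqrt) (auto simp: power2_eq_square algebra_simps)
  then show "comb_decay d < 1" by (simp add: comb_decay_def)
  have "(sqrt (1 + d\<^sup>2))\<^sup>2 = 1 + d\<^sup>2" by simp
  then have "comb_decay d * (sqrt (1 + d\<^sup>2) + d) = 1"
    by (simp add: comb_decay_def power2_eq_square algebra_simps)
  then have "1 / comb_decay d = sqrt (1 + d\<^sup>2) + d" using t by (simp add: field_simps)
  then show "comb_decay d + 1 / comb_decay d = comb_norm d" by (simp add: comb_decay_def comb_norm_def)
  show "2 * comb_decay d + 2 * d = comb_norm d" by (simp add: comb_decay_def comb_norm_def)
  show "comb_norm d > 2" using assms unfolding comb_norm_def by simp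
qed

text \<open>The Perron--Frobenius equation of the comb for the function \<open>1 \<otimes> comb_decay d ^ \<bar>h\<bar>\<close>.\<close>

lemma comb_decay_equation:
  assumes "d > 0"
  shows "comb_decay d ^ nat \<bar>h + 1\<bar> + comb_decay d ^ nat \<bar>h - 1\<bar> + (if h = 0 then 2 * d else 0) =
    comb_norm d * comb_decay d ^ nat \<bar>h\<bar>"
proof (cases "h = 0")
  case True then show ?thesis using comb_decay(4)[OF assms] by simp
next
  case False
  define t where "t = comb_decay d"
  have t: "t > 0" "t + 1 / t = comb_norm d" using comb_decay[OF assms] by (auto simp: t_def)
  obtain k where k: "nat \<bar>h\<bar> = Suc k" using False by (metis nat_0_iff abs_le_zero_iff not0_implies_Suc)
  \<comment> \<open>One neighbour is farther from the backbone and the other nearer; stating this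
    for sets treats both signs of \<open>h\<close> at once.\<close>
  have "{nat \<bar>h + 1\<bar>, nat \<bar>h - 1\<bar>} = {Suc (Suc k), k} \<and> nat \<bar>h + 1\<bar> \<noteq> nat \<bar>h - 1\<bar>"
    using k False by (cases "h > 0") auto
  then have "t ^ nat \<bar>h + 1\<bar> + t ^ nat \<bar>h - 1\<bar> = t ^ Suc (Suc k) + t ^ k"
    by (auto simp: doubleton_eq_iff add.commute)
  also have "\<dots> = (t + 1 / t) * t ^ Suc k" using t(1) by (simp add: field_simps)
  finally show ?thesis using False t k unfolding t_def by simp
qed

text \<open>The Schur test with the Perron-Frobenius function, for which its inequality is an
  equality.\<close>

lemma bounded_comb:
  "bounded_graph (comb_graph :: ((int ^ 'd::finite) \<times> int) pair_pre_digraph) (comb_norm CARD('d))"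
proof (rule bounded_graph_Schur[where v="\<lambda>x. comb_decay CARD('d) ^ nat \<bar>snd x\<bar>"])
  have d: "real CARD('d) > 0" by simp
  fix x :: "(int ^ 'd) \<times> int"
  obtain j h where x: "x = (j, h)" by force
  show "finite (nbrs comb_graph x)"
    unfolding x comb_graph_def by (rule comb_product_finite) (auto simp: line_finite lattice_finite)
  show "(\<Sum>y\<in>nbrs comb_graph x. comb_decay CARD('d) ^ nat \<bar>snd y\<bar>) \<le>
      comb_norm CARD('d) * comb_decay CARD('d) ^ nat \<bar>snd x\<bar>"
    unfolding x comb_graph_def using comb_decay_equation[OF d, of h]
    by (subst comb_product_sum) (auto simp: line_finite lattice_finite line_no_loop line_nbrs lattice_card pverts_lattice)
  show "comb_decay CARD('d) ^ nat \<bar>snd x\<bar> > 0" using comb_decay(1)[OF d] by simp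
  show "comb_norm CARD('d) \<ge> 0" using comb_decay(5)[OF d] by simp
qed (auto simp: comb_graph_def sym_line sym_lattice intro!: comb_product_sym)

text \<open>The same weight works: truncating the teeth only removes neighbours, and the torus has
  at most 2 * d of them. So the resolvent series of every box converges above
  \<open>comb_norm\<close>.\<close>

lemma bounded_comb_box:
  "bounded_graph (comb_box n :: ((int ^ 'd::finite) \<times> int) pair_pre_digraph) (comb_norm CARD('d))"
proof (rule bounded_graph_Schur[where v="\<lambda>x. comb_decay CARD('d) ^ nat \<bar>snd x\<bar>"])
  have d: "real CARD('d) > 0" by simp
  show pos: "comb_decay CARD('d) ^ nat \<bar>snd x\<bar> > 0" for x :: "(int ^ 'd) \<times> int"
    using comb_decay(1)[OF d] by simp
  fix x :: "(int ^ 'd) \<times> int"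
  obtain j h where x: "x = (j, h)" by force
  show "finite (nbrs (comb_box n) x)"
    unfolding x comb_box_def by (rule comb_product_finite) (auto simp: path_finite torus_fin_card)
  have "(\<Sum>y\<in>nbrs (comb_box n) (j, h). comb_decay CARD('d) ^ nat \<bar>snd y\<bar>) \<le>
      (comb_decay CARD('d) ^ nat \<bar>h + 1\<bar> + comb_decay CARD('d) ^ nat \<bar>h - 1\<bar>) + (if h = 0 then 2 * CARD('d) else 0)"
    unfolding comb_box_def comb_product_sum[OF path_finite torus_fin_card(1) path_no_loop]
  proof (rule add_mono)
    have "0 \<le> comb_decay CARD('d) ^ nat \<bar>k\<bar>" for k using comb_decay(1)[OF d] by simp
    then show "(if j \<in> pverts (torus_graph n) then
        \<Sum>h'\<in>nbrs (path_graph n) h. comb_decay CARD('d) ^ nat \<bar>snd (j, h')\<bar> else 0)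
      \<le> comb_decay CARD('d) ^ nat \<bar>h + 1\<bar> + comb_decay CARD('d) ^ nat \<bar>h - 1\<bar>"
      using path_sum_le[of "\<lambda>k. comb_decay CARD('d) ^ nat \<bar>k\<bar>" h n] by auto
    show "(if h = 0 then \<Sum>g'\<in>nbrs (torus_graph n) j. comb_decay CARD('d) ^ nat \<bar>snd (g', 0::int)\<bar> else 0)
      \<le> real (if h = 0 then 2 * CARD('d) else 0)"
      using torus_fin_card(2)[of j n] by auto
  qed
  also have "\<dots> = comb_norm CARD('d) * comb_decay CARD('d) ^ nat \<bar>h\<bar>"
    using comb_decay_equation[OF d, of h] by (auto split: if_splits)
  finally show "(\<Sum>y\<in>nbrs (comb_box n) x. comb_decay CARD('d) ^ nat \<bar>snd y\<bar>) \<le>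
      comb_norm CARD('d) * comb_decay CARD('d) ^ nat \<bar>snd x\<bar>" by (simp add: x)
  show "comb_norm CARD('d) \<ge> 0" using comb_decay(5)[OF d] by simp
qed (auto simp: comb_box_def sym_path sym_torus dest: torus_arcs intro!: comb_product_sym)

section \<open>Local convergence of the finite graphs\<close>

lemma converges_path: "graph_converges path_graph line_graph"
  unfolding graph_converges_def
proof
  fix h
  show "eventually (\<lambda>n. nbrs (path_graph n) h = nbrs line_graph h) sequentially"
    by (rule eventually_sequentiallyI[of "nat \<bar>h\<bar> + 1"]) (auto simp: path_nbrs line_nbrs)
qed

lemma eventually_in_cube: "eventually (\<lambda>n. x \<in> cube n) sequentially"
proof (rule eventually_sequentiallyI)
  fix n assume n: "nat (\<Sum>j\<in>UNIV. \<bar>x $ j\<bar>) \<le> n"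
  have "- int n \<le> x $ j \<and> x $ j \<le> int n" for j
  proof -
    have "\<bar>x $ j\<bar> \<le> (\<Sum>j\<in>UNIV. \<bar>x $ j\<bar>)" by (rule member_le_sum) auto
    then show ?thesis using n by linarith
  qed
  then show "x \<in> cube n" by simp
qed

text \<open>Once a vertex and its lattice neighbours lie in the cube, wrapping does not move
  them.\<close>

lemma converges_torus: "eventually (\<lambda>n. nbrs (torus_graph n) x = nbrs lattice_graph x) sequentially"
proof -
  have "eventually (\<lambda>n. \<forall>p\<in>steps. x + axis (fst p) (snd p) \<in> cube n) sequentially"
    by (intro eventually_ball_finite) (auto simp del: mem_Collect_eq intro!: eventually_in_cube)
  moreover have "eventually (\<lambda>n. x \<in> cube n) sequentially"
    by (rule eventually_in_cube)
  ultimately show ?thesis using eventually_ge_at_top[of 1]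
  proof eventually_elim
    case (elim n)
    have "(\<lambda>(i, s). wrap n (x + axis i s)) ` steps = (\<lambda>(i, s). x + axis i s) ` steps"
      using elim(1) by (intro image_cong refl) (auto simp del: mem_Collect_eq intro!: wrap_id)
    then show ?case unfolding torus_nbrs[OF elim(3,2)] lattice_nbrs .
  qed
qed

lemma converges_comb_box: "graph_converges comb_box (comb_graph :: ((int ^ 'd::finite) \<times> int) pair_pre_digraph)"
  unfolding graph_converges_def
proof
  fix x :: "(int ^ 'd) \<times> int"
  obtain j h where x: "x = (j, h)" by force
  have "eventually (\<lambda>n. j \<in> cube n) sequentially"
    by (rule eventually_in_cube)
  then show "eventually (\<lambda>n. nbrs (comb_box n) x = nbrs comb_graph x) sequentially"
    using converges_torus[of j] converges_path[unfolded graph_converges_def, rule_format, of h]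
    unfolding x comb_box_def comb_graph_def
    by eventually_elim (simp add: comb_product_nbrs)
qed

lemma converges_teeth: "graph_converges teeth_graph (all_teeth_graph :: ((int ^ 'd::finite) \<times> int) pair_pre_digraph)"
  unfolding graph_converges_def
proof
  fix x :: "(int ^ 'd) \<times> int"
  obtain j h where x: "x = (j, h)" by force
  have "eventually (\<lambda>n. j \<in> cube n) sequentially"
    by (rule eventually_in_cube)
  then show "eventually (\<lambda>n. nbrs (teeth_graph n) x = nbrs all_teeth_graph x) sequentially"
    using converges_path[unfolded graph_converges_def, rule_format, of h]
    unfolding x teeth_graph_def all_teeth_graph_def
    by eventually_elim (simp add: comb_product_nbrs)
qed

section \<open>The norm of the comb and the tooth vector\<close>

lemma int_sum_le:
  fixes g :: "nat \<Rightarrow> real"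
  assumes g: "summable g" "\<And>m. g m \<ge> 0" and F: "finite F"
  shows "(\<Sum>h\<in>F. g (nat \<bar>h\<bar>)) \<le> 2 * suminf g"
proof -
  have nat: "(\<Sum>h\<in>F. g (nat \<bar>h\<bar>)) \<le> suminf g" if "finite F" "inj_on (\<lambda>h. nat \<bar>h\<bar>) F" for F
  proof -
    have "(\<Sum>h\<in>F. g (nat \<bar>h\<bar>)) = (\<Sum>m\<in>(\<lambda>h. nat \<bar>h\<bar>) ` F. g m)"
      using sum.reindex[OF that(2), of g] by simp
    also have "\<dots> \<le> suminf g" by (rule sum_le_suminf[OF g(1)]) (use that g(2) in auto)
    finally show ?thesis .
  qed
  have "(\<Sum>h\<in>F. g (nat \<bar>h\<bar>)) = (\<Sum>h\<in>F \<inter> {0..}. g (nat \<bar>h\<bar>)) + (\<Sum>h\<in>F \<inter> {..<0}. g (nat \<bar>h\<bar>))"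
    using F by (subst sum.union_disjoint[symmetric]) (auto intro!: sum.cong)
  also have "\<dots> \<le> suminf g + suminf g"
    using F by (intro add_mono nat) (auto simp: inj_on_def)
  finally show ?thesis by simp
qed

lemma int_power_ell2:
  assumes "0 \<le> t" "t < 1"
  shows "(\<lambda>h::int. complex_of_real (t ^ nat \<bar>h\<bar>)) \<in> ell2"
proof (rule ell2I_mem)
  let ?g = "\<lambda>m. (t\<^sup>2) ^ m"
  have t2: "t\<^sup>2 < 1" using assms by (simp add: power_less_one_iff abs_square_less_1)
  have s: "summable ?g" using t2 by (intro summable_geometric) auto
  have s0: "suminf ?g \<ge> 0" by (rule suminf_nonneg[OF s]) auto
  then show "0 \<le> sqrt (2 * suminf ?g)" by simp
  fix F :: "int set" assume F: "finite F"
  have "(\<Sum>h\<in>F. (cmod (complex_of_real (t ^ nat \<bar>h\<bar>)))\<^sup>2) = (\<Sum>h\<in>F. ?g (nat \<bar>h\<bar>))"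
    using assms by (intro sum.cong) (auto simp: power_mult[symmetric] mult.commute norm_power)
  also have "\<dots> \<le> 2 * suminf ?g" by (rule int_sum_le[OF s _ F]) simp
  also have "\<dots> = (sqrt (2 * suminf ?g))\<^sup>2" using s0 by simp
  finally show "(\<Sum>h\<in>F. (cmod (complex_of_real (t ^ nat \<bar>h\<bar>)))\<^sup>2) \<le> (sqrt (2 * suminf ?g))\<^sup>2" .
qed

text \<open>The Green function of the line at energy t + 1 / t is t^|h| / (1 / t - t), and t =
  \<open>comb_decay d\<close> makes the denominator 2 * d.\<close>

definition tooth :: "real \<Rightarrow> int \<Rightarrow> complex" where
  "tooth d h = of_real (comb_decay d ^ nat \<bar>h\<bar> / (2 * d))"

lemma tooth_ell2: "d > 0 \<Longrightarrow> tooth d \<in> ell2"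
  using ell2_scale(1)[OF int_power_ell2[of "comb_decay d"], of "1 / (2 * d)"] comb_decay[of d]
  unfolding tooth_def by (simp add: less_imp_le)

lemma tooth_equation:
  assumes "d > 0"
  shows "of_real (comb_norm d) * tooth d h - adj_op line_graph (tooth d) h = delta 0 h"
proof -
  have "comb_norm d * (comb_decay d ^ nat \<bar>h\<bar> / (2 * d)) -
      (comb_decay d ^ nat \<bar>h + 1\<bar> / (2 * d) + comb_decay d ^ nat \<bar>h - 1\<bar> / (2 * d)) = (if h = 0 then 1 else 0)"
    using comb_decay_equation[OF assms, of h] assms by (auto simp: field_simps split: if_splits)
  then have "complex_of_real (comb_norm d * (comb_decay d ^ nat \<bar>h\<bar> / (2 * d)) -
      (comb_decay d ^ nat \<bar>h + 1\<bar> / (2 * d) + comb_decay d ^ nat \<bar>h - 1\<bar> / (2 * d))) = of_real (if h = 0 then 1 else 0)"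
    by (rule arg_cong)
  then show ?thesis by (simp add: adj_op_def line_nbrs tooth_def delta_def)
qed

lemma tooth_resolvent:
  assumes "d > 0"
  shows "adj_series line_graph (resolvent_fps (comb_norm d)) (delta 0) = tooth d"
  using bounded_graph.resolvent_unique[OF bounded_line _ tooth_ell2[OF assms], of "comb_norm d"]
    comb_decay(5)[OF assms] by (simp add: tooth_equation[OF assms])

lemma tooth_vector_eq:
  assumes "d > 0"
  shows "tooth_vector (comb_norm d) h = tooth d h / of_real (ell2_norm (tooth d))"
  using bounded_graph.op_inverse_resolvent[OF bounded_line, of "comb_norm d" "delta 0"] comb_decay(5)[OF assms]
  by (simp add: tooth_vector_def Let_def tooth_resolvent[OF assms])

lemma tooth_norm_pos:
  assumes "d > 0" shows "ell2_norm (tooth d) > 0"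
proof -
  have "cmod (tooth d 0) > 0" using assms by (simp add: tooth_def)
  then show ?thesis using cmod_le_ell2_norm[OF tooth_ell2[OF assms], of 0] by linarith
qed

definition block :: "'a set \<Rightarrow> ('b \<Rightarrow> complex) \<Rightarrow> 'a \<times> 'b \<Rightarrow> complex" where
  "block S \<tau> = (\<lambda>(j, h). if j \<in> S then \<tau> h else 0)"

lemma block_ell2_norm:
  assumes S: "finite S" and \<tau>: "\<tau> \<in> ell2"
  shows "block S \<tau> \<in> ell2" "ell2_norm (block S \<tau>) = sqrt (card S) * ell2_norm \<tau>"
proof -
  define c where "c = (\<Sum>\<^sub>\<infinity>h. (cmod (\<tau> h))\<^sup>2)"
  have c: "((\<lambda>h. (cmod (\<tau> h))\<^sup>2) has_sum c) UNIV"
    using \<tau> unfolding c_def ell2_def by auto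
  have row: "((\<lambda>(j, h). (cmod (\<tau> h))\<^sup>2) has_sum c) ({j} \<times> UNIV)" for j :: 'a
  proof -
    have "inj (Pair j :: 'b \<Rightarrow> _)" by (auto simp: inj_on_def)
    moreover have "range (Pair j) = {j} \<times> (UNIV :: 'b set)" by auto
    ultimately show ?thesis
      using has_sum_reindex[of "Pair j" UNIV "\<lambda>(j, h). (cmod (\<tau> h))\<^sup>2" c] c by (simp add: o_def)
  qed
  from S have "((\<lambda>(j, h). (cmod (\<tau> h))\<^sup>2) has_sum (of_nat (card S) * c)) (S \<times> UNIV)"
  proof (induction S rule: finite_induct)
    case (insert j S)
    have "((\<lambda>(j, h). (cmod (\<tau> h))\<^sup>2) has_sum (c + of_nat (card S) * c)) ({j} \<times> UNIV \<union> S \<times> UNIV)"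
      by (rule has_sum_Un_disjoint[OF row insert.IH]) (use insert in auto)
    moreover have "{j} \<times> UNIV \<union> S \<times> UNIV = insert j S \<times> (UNIV :: 'b set)" by auto
    ultimately show ?case using insert by (simp add: algebra_simps)
  qed auto
  then have H: "((\<lambda>x. (cmod (block S \<tau> x))\<^sup>2) has_sum (of_nat (card S) * c)) UNIV"
    by (rule has_sum_cong_neutral[THEN iffD1, rotated -1]) (auto simp: block_def split: if_splits)
  then show "block S \<tau> \<in> ell2" "ell2_norm (block S \<tau>) = sqrt (card S) * ell2_norm \<tau>"
    using has_sum_imp_summable[OF H] infsumI[OF H] by (auto simp: ell2_def ell2_norm_def real_sqrt_mult c_def)
qed

lemma cube_finite_card: "finite (cube n :: (int ^ 'd::finite) set)"
  "card (cube n :: (int ^ 'd::finite) set) = (2 * n + 1) ^ CARD('d)"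
proof -
  have bij: "bij_betw vec_lambda (PiE UNIV (\<lambda>_. {- int n..int n})) (cube n :: (int ^ 'd::finite) set)"
    by (rule bij_betwI[where g=vec_nth]) (auto simp: PiE_def Pi_def)
  have fin: "finite (PiE (UNIV :: 'd set) (\<lambda>_. {- int n..int n}))" by (rule finite_PiE) auto
  show "finite (cube n :: (int ^ 'd::finite) set)" using bij_betw_finite[OF bij] fin by simp
  have "card {- int n..int n} = 2 * n + 1" by simp
  then show "card (cube n :: (int ^ 'd::finite) set) = (2 * n + 1) ^ CARD('d)"
    unfolding bij_betw_same_card[OF bij, symmetric] by (simp add: card_PiE)
qed

text \<open>The test function is the Perron-Frobenius function cut off at the cube of radius
  \<open>M\<close>. Over the smaller cube all neighbours are still present, so the operator
  multiplies by \<open>comb_norm\<close>; its values elsewhere can only add to the norm.\<close>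

lemma comb_block_lower:
  assumes "L < M"
  shows "comb_norm CARD('d::finite) * (sqrt ((2 * real L + 1) ^ CARD('d)) / sqrt ((2 * real M + 1) ^ CARD('d))) \<le> op_norm (adj_op (comb_graph :: ((int ^ 'd) \<times> int) pair_pre_digraph))"
proof -
  let ?A = "adj_op (comb_graph :: ((int ^ 'd) \<times> int) pair_pre_digraph)"
  let ?a = "comb_norm CARD('d)" and ?\<tau> = "tooth CARD('d)"
  interpret bounded_graph "comb_graph :: ((int ^ 'd) \<times> int) pair_pre_digraph" ?a by (rule bounded_comb)
  have d: "real CARD('d) > 0" by simp
  note \<tau> = tooth_ell2[OF d] tooth_norm_pos[OF d]
  let ?S = "cube M :: (int ^ 'd) set" and ?S' = "cube L :: (int ^ 'd) set"
  note b = block_ell2_norm[OF cube_finite_card(1)[of M, where 'd='d] \<tau>(1)]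
    and b' = block_ell2_norm[OF cube_finite_card(1)[of L, where 'd='d] \<tau>(1)]
  have pos: "sqrt (card ?S) > 0" by (simp add: cube_finite_card)
  have pt: "cmod (of_real ?a * block ?S' ?\<tau> x) \<le> cmod (?A (block ?S ?\<tau>) x)" for x
  proof -
    obtain j h where x: "x = (j, h)" by force
    show ?thesis
    proof (cases "j \<in> ?S'")
      case False
      then have "block ?S' ?\<tau> x = 0" by (simp only: block_def x prod.case if_False)
      then show ?thesis by (simp only: mult_zero_right norm_zero norm_ge_zero)
    next
      case True
      then have j: "- int L \<le> j $ i" "j $ i \<le> int L" for i by auto
      have j': "- int M < j $ i" "j $ i < int M" for i using j[of i] assms by linarith+
      then have jS: "j \<in> ?S" by (auto simp: less_imp_le)
      have nb: "j + axis i 1 \<in> ?S" "j - axis i 1 \<in> ?S" for i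
        using j' by (auto simp: axis_def less_imp_le intro: add_le_imp_le_diff) (smt (verit) j')+
      have "?A (block ?S ?\<tau>) x = adj_op line_graph ?\<tau> h + (if h = 0 then 2 * of_nat CARD('d) * ?\<tau> 0 else 0)"
      proof -
        have "fiber (block ?S ?\<tau>) j = ?\<tau>" using jS by (auto simp: fiber_def block_def)
        moreover have "adj_op lattice_graph (\<lambda>g'. block ?S ?\<tau> (g', 0)) j = 2 * of_nat CARD('d) * ?\<tau> 0"
          unfolding adj_op_def lattice_sum using nb by (simp add: block_def del: mem_Collect_eq)
        ultimately show ?thesis
          unfolding x comb_graph_def by (simp add: adj_op_comb_product line_finite lattice_finite line_no_loop)
      qed
      also have "(if h = 0 then 2 * of_nat CARD('d) * ?\<tau> 0 else 0) = delta 0 h"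
        by (auto simp: delta_def tooth_def)
      also have "adj_op line_graph ?\<tau> h + delta 0 h = of_real ?a * ?\<tau> h"
        using tooth_equation[OF d, of h] by (simp add: algebra_simps)
      also have "\<dots> = of_real ?a * block ?S' ?\<tau> x" using True by (simp add: block_def x)
      finally show ?thesis by simp
    qed
  qed
  let ?c = "1 / (sqrt (card ?S) * ell2_norm ?\<tau>)"
  let ?\<xi> = "\<lambda>x. of_real ?c * block ?S ?\<tau> x"
  have c0: "?c > 0" using pos \<tau>(2) by simp
  have \<xi>: "?\<xi> \<in> ell2" "ell2_norm ?\<xi> = 1"
    using ell2_scale[OF b(1), of "of_real ?c"] b(2) pos \<tau>(2) by (simp_all add: norm_mult norm_divide)
  have A\<xi>: "?A ?\<xi> = (\<lambda>x. of_real ?c * ?A (block ?S ?\<tau>) x)"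
    using adj_op_linear[of comb_graph "of_real ?c" "block ?S ?\<tau>" "\<lambda>x. 0"] by (simp add: adj_op_zero)
  have "?a * (sqrt (card ?S') * ell2_norm ?\<tau>) \<le> ell2_norm (?A (block ?S ?\<tau>))"
    using ell2_mono(2)[OF adj_op_ell2[OF b(1)] pt] ell2_scale(2)[OF b'(1), of "of_real ?a"] b'(2) b_nonneg
    by simp
  then have "?c * (?a * (sqrt (card ?S') * ell2_norm ?\<tau>)) \<le> ?c * ell2_norm (?A (block ?S ?\<tau>))"
    using c0 by (intro mult_left_mono) auto
  also have "\<dots> = ell2_norm (?A ?\<xi>)"
    unfolding A\<xi> using ell2_scale(2)[OF adj_op_ell2[OF b(1)], of "of_real ?c"] c0 by (simp add: norm_divide norm_mult)
  also have "\<dots> \<le> op_norm ?A"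
    unfolding op_norm_def
  proof (rule cSUP_upper)
    show "?\<xi> \<in> {\<xi> \<in> ell2. ell2_norm \<xi> \<le> 1}" using \<xi> by simp
    show "bdd_above ((\<lambda>\<xi>. ell2_norm (?A \<xi>)) ` {\<xi> \<in> ell2. ell2_norm \<xi> \<le> 1})"
    proof (rule bdd_aboveI2)
      fix \<xi> :: "(int ^ 'd) \<times> int \<Rightarrow> complex" assume "\<xi> \<in> {\<xi> \<in> ell2. ell2_norm \<xi> \<le> 1}"
      then have "\<xi> \<in> ell2" "ell2_norm \<xi> \<le> 1" by auto
      then show "ell2_norm (?A \<xi>) \<le> ?a * 1"
        by (intro order_trans[OF adj_op_norm_le mult_left_mono[OF _ b_nonneg]])
    qed
  qed
  finally show ?thesis using \<tau>(2) by (simp add: cube_finite_card field_simps)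
qed

lemma op_norm_comb:
  "op_norm (adj_op (comb_graph :: ((int ^ 'd::finite) \<times> int) pair_pre_digraph)) = comb_norm CARD('d)"
proof (rule antisym)
  interpret bounded_graph "comb_graph :: ((int ^ 'd) \<times> int) pair_pre_digraph" "comb_norm CARD('d)"
    by (rule bounded_comb)
  show "op_norm (adj_op (comb_graph :: ((int ^ 'd) \<times> int) pair_pre_digraph)) \<le> comb_norm CARD('d)"
    unfolding op_norm_def
  proof (rule cSUP_least)
    show "{\<xi> \<in> ell2. ell2_norm \<xi> \<le> 1} \<noteq> {}" using ell2_zero by fastforce
    fix \<xi> :: "(int ^ 'd) \<times> int \<Rightarrow> complex" assume "\<xi> \<in> {\<xi> \<in> ell2. ell2_norm \<xi> \<le> 1}"
    then show "ell2_norm (adj_op comb_graph \<xi>) \<le> comb_norm CARD('d)"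
      using order_trans[OF adj_op_norm_le mult_left_mono[OF _ b_nonneg]] by fastforce
  qed
  \<comment> \<open>With M = L + 1 the ratio of the cube volumes tends to 1: the backbone is
    amenable, so the Schur bound is attained in the limit.\<close>
  have "(\<lambda>L. (2 * real L + 1) / (2 * real (Suc L) + 1)) \<longlonglongrightarrow> 1" by real_asymp
  then have "(\<lambda>L. comb_norm CARD('d) * sqrt (((2 * real L + 1) / (2 * real (Suc L) + 1)) ^ CARD('d)))
      \<longlonglongrightarrow> comb_norm CARD('d) * sqrt (1 ^ CARD('d))"
    by (intro tendsto_intros)
  moreover have "comb_norm CARD('d) * sqrt (((2 * real L + 1) / (2 * real (Suc L) + 1)) ^ CARD('d)) \<le>
      op_norm (adj_op (comb_graph :: ((int ^ 'd) \<times> int) pair_pre_digraph))" for L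
    using comb_block_lower[of L "Suc L", where 'd='d] by (simp add: real_sqrt_divide power_divide)
  ultimately show "comb_norm CARD('d) \<le> op_norm (adj_op (comb_graph :: ((int ^ 'd) \<times> int) pair_pre_digraph))"
    using LIMSEQ_le_const2 by fastforce
qed

section \<open>The resolvent of a path at its centre\<close>

text \<open>Finite support of \<open>\<eta>\<close> makes all sums finite. The second claim keeps
  the support finite, so that the first can be iterated over powers.\<close>

lemma (in bounded_graph) adj_op_symmetric:
  assumes "finite S" "\<And>x. x \<notin> S \<Longrightarrow> \<eta> x = 0"
  shows "ell2_inner (adj_op G \<eta>) \<xi> = ell2_inner \<eta> (adj_op G \<xi>)"
    "\<And>x. x \<notin> (\<Union>y\<in>S. {x. (y, x) \<in> parcs G}) \<Longrightarrow> adj_op G \<eta> x = 0"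
proof -
  let ?U = "\<Union>y\<in>S. {x. (y, x) \<in> parcs G}"
  have U: "finite ?U" using assms(1) fin by auto
  show out: "adj_op G \<eta> x = 0" if "x \<notin> ?U" for x
    unfolding adj_op_def
  proof (rule sum.neutral, safe)
    fix y assume "(x, y) \<in> parcs G"
    then show "\<eta> y = 0" using that sym assms(2) by blast
  qed
  have "ell2_inner (adj_op G \<eta>) \<xi> = (\<Sum>x\<in>?U. cnj (adj_op G \<eta> x) * \<xi> x)"
    by (rule ell2_inner_finite[OF U]) (use out in auto)
  also have "\<dots> = (\<Sum>x\<in>?U. \<Sum>y\<in>S. if (x, y) \<in> parcs G then cnj (\<eta> y) * \<xi> x else 0)"
  proof (rule sum.cong[OF refl])
    fix x
    have "adj_op G \<eta> x = (\<Sum>y\<in>S. if (x, y) \<in> parcs G then \<eta> y else 0)"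
      unfolding adj_op_def using assms fin
      by (intro sum.mono_neutral_cong) (auto)
    then show "cnj (adj_op G \<eta> x) * \<xi> x = (\<Sum>y\<in>S. if (x, y) \<in> parcs G then cnj (\<eta> y) * \<xi> x else 0)"
      by (auto simp: sum_distrib_right intro!: sum.cong)
  qed
  also have "\<dots> = (\<Sum>y\<in>S. \<Sum>x\<in>?U. if (x, y) \<in> parcs G then cnj (\<eta> y) * \<xi> x else 0)" by (rule sum.swap)
  also have "\<dots> = (\<Sum>y\<in>S. cnj (\<eta> y) * adj_op G \<xi> y)"
  proof (rule sum.cong[OF refl])
    fix y assume y: "y \<in> S"
    have "adj_op G \<xi> y = (\<Sum>x\<in>?U. if (x, y) \<in> parcs G then \<xi> x else 0)"
      unfolding adj_op_def using U fin y sym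
      by (intro sum.mono_neutral_cong) auto
    then show "(\<Sum>x\<in>?U. if (x, y) \<in> parcs G then cnj (\<eta> y) * \<xi> x else 0) = cnj (\<eta> y) * adj_op G \<xi> y"
      by (auto simp: sum_distrib_left intro!: sum.cong)
  qed
  also have "\<dots> = ell2_inner \<eta> (adj_op G \<xi>)"
    by (rule ell2_inner_finite[OF assms(1), symmetric]) (use assms(2) in auto)
  finally show "ell2_inner (adj_op G \<eta>) \<xi> = ell2_inner \<eta> (adj_op G \<xi>)" .
qed

lemma (in bounded_graph) pow_symmetric:
  assumes "finite S" "\<And>x. x \<notin> S \<Longrightarrow> \<eta> x = 0"
  shows "ell2_inner ((adj_op G ^^ m) \<eta>) \<xi> = ell2_inner \<eta> ((adj_op G ^^ m) \<xi>)"
  using assms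
proof (induction m arbitrary: S \<eta>)
  case (Suc m)
  have "finite (\<Union>y\<in>S. {x. (y, x) \<in> parcs G})" using Suc(2) fin by auto
  from Suc.IH[OF this adj_op_symmetric(2)[OF Suc(2,3)]]
  have "ell2_inner ((adj_op G ^^ m) (adj_op G \<eta>)) \<xi> = ell2_inner (adj_op G \<eta>) ((adj_op G ^^ m) \<xi>)" by simp
  also have "\<dots> = ell2_inner \<eta> (adj_op G ((adj_op G ^^ m) \<xi>))" by (rule adj_op_symmetric(1)[OF Suc(2,3)])
  finally show ?case by (simp add: funpow_swap1)
qed auto

lemma ell2_inner_delta: "ell2_inner (delta x) \<xi> = \<xi> x"
  by (subst ell2_inner_finite[of "{x}"]) (auto simp: delta_def)

text \<open>Self-adjointness of the resolvent tested on a delta function; it holds term by term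
  because the coefficients are real.\<close>

lemma (in bounded_graph) resolvent_delta_inner:
  assumes z: "z > b" and \<xi>: "\<xi> \<in> ell2"
  shows "ell2_inner (adj_series G (resolvent_fps z) (delta x)) \<xi> = adj_series G (resolvent_fps z) \<xi> x"
proof -
  let ?R = "resolvent_fps z"
  note adm = admissible_resolvent[OF z]
  have "(\<lambda>m. fps_nth ?R m * ell2_inner \<xi> ((adj_op G ^^ m) (delta x))) sums
      ell2_inner \<xi> (adj_series G ?R (delta x))"
    by (rule adj_series_inner_sums[OF adm delta_ell2 \<xi>])
  then have "(\<lambda>m. cnj (fps_nth ?R m * ell2_inner \<xi> ((adj_op G ^^ m) (delta x)))) sums
      cnj (ell2_inner \<xi> (adj_series G ?R (delta x)))" by (simp only: sums_cnj)
  moreover have "cnj (fps_nth ?R m * ell2_inner \<xi> ((adj_op G ^^ m) (delta x))) =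
      fps_nth ?R m * (adj_op G ^^ m) \<xi> x" for m
  proof -
    have "ell2_inner ((adj_op G ^^ m) (delta x)) \<xi> = (adj_op G ^^ m) \<xi> x"
      using pow_symmetric[of "{x}" "delta x" m \<xi>] by (simp add: delta_def[of x] ell2_inner_delta[unfolded delta_def])
    then show ?thesis by (simp add: ell2_inner_cnj[of _ \<xi>] resolvent_fps_def)
  qed
  ultimately show ?thesis
    by (simp add: sums_iff adj_series_def[of G ?R \<xi>] ell2_inner_cnj[of _ \<xi>])
qed

definition path_resolvent :: "real \<Rightarrow> nat \<Rightarrow> int \<Rightarrow> complex" where
  "path_resolvent z n = adj_series (path_graph n) (resolvent_fps z) (delta 0)"

lemma path_resolvent_ell2: "z > 2 \<Longrightarrow> path_resolvent z n \<in> ell2"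
  unfolding path_resolvent_def
  using bounded_graph.adj_series_ell2[OF bounded_path bounded_graph.admissible_resolvent[OF bounded_path]] by simp

text \<open>Counting walks: those in the path are among those in the line.\<close>

lemma path_walks:
  "\<exists>p q. (adj_op (path_graph n) ^^ m) (delta 0) h = of_real p \<and>
    (adj_op line_graph ^^ m) (delta 0) h = of_real q \<and> 0 \<le> p \<and> p \<le> q \<and> (\<bar>h\<bar> > int n \<longrightarrow> p = 0)"
proof (induction m arbitrary: h)
  case 0 show ?case by (auto simp: delta_def)
next
  case (Suc m)
  then obtain p q where pq: "\<And>h. (adj_op (path_graph n) ^^ m) (delta 0) h = of_real (p h)"
    "\<And>h. (adj_op line_graph ^^ m) (delta 0) h = of_real (q h)" "\<And>h. 0 \<le> p h" "\<And>h. p h \<le> q h"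
    by metis
  have "(adj_op (path_graph n) ^^ Suc m) (delta 0) h = of_real (\<Sum>k\<in>nbrs (path_graph n) h. p k)"
    by (simp add: adj_op_def[of _ "(adj_op _ ^^ m) _"] pq)
  moreover have "(adj_op line_graph ^^ Suc m) (delta 0) h = of_real (\<Sum>k\<in>nbrs line_graph h. q k)"
    by (simp add: adj_op_def[of _ "(adj_op _ ^^ m) _"] pq)
  moreover have "0 \<le> (\<Sum>k\<in>nbrs (path_graph n) h. p k)" by (intro sum_nonneg pq)
  moreover have "(\<Sum>k\<in>nbrs (path_graph n) h. p k) \<le> (\<Sum>k\<in>nbrs line_graph h. q k)"
    using path_sum_le[of p h n] pq(3) pq(4)[of "h + 1"] pq(4)[of "h - 1"] by (simp add: line_nbrs)
  moreover have "\<bar>h\<bar> > int n \<longrightarrow> (\<Sum>k\<in>nbrs (path_graph n) h. p k) = 0" by (simp add: path_nbrs)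
  ultimately show ?case by blast
qed

lemma path_resolvent_outside: "\<bar>h\<bar> > int n \<Longrightarrow> path_resolvent z n h = 0"
proof -
  assume h: "\<bar>h\<bar> > int n"
  have "(adj_op (path_graph n) ^^ m) (delta 0) h = 0" for m using path_walks[of m n h] h by auto
  then show ?thesis by (simp add: path_resolvent_def adj_series_def)
qed

lemma path_resolvent_real:
  assumes "z > 2" shows "cnj (path_resolvent z n h) = path_resolvent z n h"
proof -
  let ?t = "\<lambda>m. fps_nth (resolvent_fps z) m * (adj_op (path_graph n) ^^ m) (delta 0) h"
  have t: "?t sums path_resolvent z n h"
    unfolding path_resolvent_def adj_series_def
    by (rule summable_sums[OF summable_norm_cancel[OF bounded_graph.adj_series_summable[OF bounded_path
        bounded_graph.admissible_resolvent[OF bounded_path assms] delta_ell2]]])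
  have "cnj (?t m) = ?t m" for m
    using path_walks[of m n h] by (auto simp: resolvent_fps_def)
  then have "(\<lambda>m. cnj (?t m)) sums path_resolvent z n h" using t by simp
  moreover have "(\<lambda>m. cnj (?t m)) sums cnj (path_resolvent z n h)" using t by (simp only: sums_cnj)
  ultimately show ?thesis by (rule sums_unique2[symmetric])
qed

text \<open>Termwise comparison with the line at energy \<open>comb_norm d\<close>, whose central
  entry is 1 / (2 * d). The path has no more closed walks and z is larger, strictly so in the term m
  = 0. Strictness keeps \<kappa> = 1 / g above 2 * d, the top of the torus spectrum, for every
  n.\<close>

lemma path_resolvent_0:
  assumes d: "d > 0" and z: "z > comb_norm d"
  obtains g where "path_resolvent z n 0 = of_real g" "0 < g" "g < 1 / (2 * d)"
proof -
  let ?a = "comb_norm d"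
  have a: "?a > 2" by (rule comb_decay(5)[OF d])
  obtain p q where pq: "\<And>m. (adj_op (path_graph n) ^^ m) (delta 0) 0 = complex_of_real (p m)"
    "\<And>m. (adj_op line_graph ^^ m) (delta 0) 0 = complex_of_real (q m)" "\<And>m. 0 \<le> p m" "\<And>m. p m \<le> q m"
    using path_walks[of _ n 0] by metis
  have p0: "p 0 = 1" "q 0 = 1" using pq(1)[of 0] pq(2)[of 0] by (auto simp: delta_def)
  let ?P = "\<lambda>m. p m / z ^ Suc m" and ?Q = "\<lambda>m. q m / ?a ^ Suc m"
  have sP: "(\<lambda>m. complex_of_real (?P m)) sums path_resolvent z n 0"
    using summable_sums[OF summable_norm_cancel[OF bounded_graph.adj_series_summable[OF bounded_path
        bounded_graph.admissible_resolvent[OF bounded_path, of z] delta_ell2]], of n 0 0] z a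
    unfolding path_resolvent_def adj_series_def by (simp add: pq resolvent_fps_def)
  have sQ: "(\<lambda>m. complex_of_real (?Q m)) sums tooth d 0"
    using summable_sums[OF summable_norm_cancel[OF bounded_graph.adj_series_summable[OF bounded_line
        bounded_graph.admissible_resolvent[OF bounded_line, of ?a] delta_ell2]], of 0 0] a
    unfolding tooth_resolvent[OF d, symmetric] adj_series_def by (simp add: pq resolvent_fps_def)
  define g where "g = Re (path_resolvent z n 0)"
  have g: "?P sums g" using sums_Re[OF sP] by (simp add: g_def)
  have Q: "?Q sums (1 / (2 * d))" using sums_Re[OF sQ] by (simp add: tooth_def)
  have gc: "path_resolvent z n 0 = of_real g"
    using sums_unique2[OF sP sums_of_real[OF g]] .
  have le: "?P m \<le> ?Q m" for m
    using pq(3,4)[of m] z a by (intro frac_le power_mono) auto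
  have "?P 0 \<le> g"
    using sum_le_suminf[of ?P "{0}"] g pq(3) z a by (auto simp: sums_iff)
  then have "g > 0" using p0 z a by (auto intro: less_le_trans[of _ "1 / z"])
  moreover have "g < 1 / (2 * d)"
  proof -
    have diff: "(\<lambda>m. ?Q m - ?P m) sums (1 / (2 * d) - g)" by (rule sums_diff[OF Q g])
    have "?Q 0 - ?P 0 \<le> 1 / (2 * d) - g"
      using sum_le_suminf[of "\<lambda>m. ?Q m - ?P m" "{0}"] diff le by (auto simp: sums_iff)
    moreover have "?Q 0 - ?P 0 > 0" using p0 z a by (simp add: frac_less2)
    ultimately show ?thesis by linarith
  qed
  ultimately show ?thesis using that gc by blast
qed

text \<open>Uniform in \<open>n\<close> and \<open>z\<close>, since all paths have norm at most 2 <
  a; this supplies the majorants along the backbone.\<close>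

lemma path_resolvent_norm_le:
  assumes a: "a > 2" and z: "z \<ge> a"
  shows "ell2_norm (path_resolvent z n) \<le> 1 / (a - 2) * ell2_norm (delta (0 :: int))"
proof -
  have z2: "z > 2" using a z by linarith
  have "(\<lambda>m. 1 / z * (2 / z) ^ m) sums (1 / z * (1 / (1 - 2 / z)))"
    using z2 by (intro sums_mult geometric_sums) auto
  moreover have "1 / z * (1 / (1 - 2 / z)) = 1 / (z - 2)" using z2 by (simp add: field_simps)
  moreover have "cmod (fps_nth (resolvent_fps z) m) * 2 ^ m = 1 / z * (2 / z) ^ m" for m
    using z2 by (simp add: resolvent_fps_def norm_divide norm_mult norm_power power_divide)
  ultimately have "(\<Sum>m. cmod (fps_nth (resolvent_fps z) m) * 2 ^ m) = 1 / (z - 2)"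
    by (simp add: sums_iff)
  then have "ell2_norm (path_resolvent z n) \<le> 1 / (z - 2) * ell2_norm (delta (0 :: int))"
    using bounded_graph.adj_series_norm_le[OF bounded_path bounded_graph.admissible_resolvent[OF bounded_path z2] delta_ell2]
    unfolding path_resolvent_def by metis
  also have "\<dots> \<le> 1 / (a - 2) * ell2_norm (delta (0 :: int))"
    using a z by (intro mult_right_mono divide_left_mono) auto
  finally show ?thesis .
qed

lemma path_resolvent_tendsto:
  assumes d: "d > 0" and z: "\<And>n. z n \<ge> comb_norm d" "z \<longlonglongrightarrow> comb_norm d" and f: "f \<in> ell2"
  shows "(\<lambda>n. ell2_inner (path_resolvent (z n) n) f) \<longlonglongrightarrow> ell2_inner (tooth d) f"
proof -
  have "(\<lambda>n. ell2_inner f (path_resolvent (z n) n)) \<longlonglongrightarrow> ell2_inner f (tooth d)"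
    unfolding path_resolvent_def tooth_resolvent[OF d, symmetric]
    by (rule resolvent_weak_convergence[OF bounded_path bounded_line converges_path comb_decay(5)[OF d] z delta_ell2 f])
  then have "(\<lambda>n. cnj (ell2_inner f (path_resolvent (z n) n))) \<longlonglongrightarrow> cnj (ell2_inner f (tooth d))"
    by (rule tendsto_cnj)
  then show ?thesis by (simp only: ell2_inner_cnj[symmetric])
qed

section \<open>The resolvent of the finite comb\<close>

lemma fiber_ell2:
  assumes "\<xi> \<in> ell2" shows "fiber \<xi> j \<in> ell2" "ell2_norm (fiber \<xi> j) \<le> ell2_norm \<xi>"
proof -
  have "(\<Sum>h\<in>F. (cmod (fiber \<xi> j h))\<^sup>2) \<le> (ell2_norm \<xi>)\<^sup>2" if "finite F" for F
  proof -
    have "(\<Sum>h\<in>F. (cmod (fiber \<xi> j h))\<^sup>2) = (\<Sum>x\<in>Pair j ` F. (cmod (\<xi> x))\<^sup>2)"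
      by (subst sum.reindex) (auto simp: fiber_def inj_on_def)
    also have "\<dots> \<le> (ell2_norm \<xi>)\<^sup>2" using that by (intro ell2_sum_le assms) auto
    finally show ?thesis .
  qed
  from ell2I[of "fiber \<xi> j", OF this] show "fiber \<xi> j \<in> ell2" "ell2_norm (fiber \<xi> j) \<le> ell2_norm \<xi>" by auto
qed

lemma adj_op_teeth:
  fixes j :: "int ^ 'd::finite"
  shows "adj_op (teeth_graph n) \<xi> (j, h) = (if j \<in> cube n then adj_op (path_graph n) (fiber \<xi> j) h else 0)"
  unfolding teeth_graph_def
  by (subst adj_op_comb_product) (auto simp: path_finite path_no_loop adj_op_def)

lemma teeth_pow:
  fixes j :: "int ^ 'd::finite"
  assumes "j \<in> cube n"
  shows "(adj_op (teeth_graph n) ^^ m) \<xi> (j, h) = (adj_op (path_graph n) ^^ m) (fiber \<xi> j) h"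
proof (induction m arbitrary: h)
  case 0 show ?case by (simp add: fiber_def)
next
  case (Suc m)
  have "fiber ((adj_op (teeth_graph n) ^^ m) \<xi>) j = (adj_op (path_graph n) ^^ m) (fiber \<xi> j)"
    using Suc by (auto simp: fiber_def)
  then show ?case using assms by (simp add: adj_op_teeth)
qed

text \<open>Over each \<open>j\<close> the resolvent acts on the fibre alone, and by
  self-adjointness its central value is a pairing with one vector that does not depend on
  \<open>j\<close>. This is how the rank-one structure arises.\<close>

lemma teeth_resolvent_centre:
  fixes j :: "int ^ 'd::finite"
  assumes "j \<in> cube n" "z > 2" "\<xi> \<in> ell2"
  shows "adj_series (teeth_graph n) (resolvent_fps z) \<xi> (j, 0) = ell2_inner (path_resolvent z n) (fiber \<xi> j)"
proof -
  have "adj_series (teeth_graph n) (resolvent_fps z) \<xi> (j, 0) =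
      adj_series (path_graph n) (resolvent_fps z) (fiber \<xi> j) 0"
    by (simp add: adj_series_def teeth_pow[OF assms(1)])
  then show ?thesis
    using bounded_graph.resolvent_delta_inner[OF bounded_path assms(2) fiber_ell2(1)[OF assms(3)]]
    by (simp add: path_resolvent_def)
qed

lemma path_resolvent_equation:
  assumes "z > 2"
  shows "of_real z * path_resolvent z n h - adj_op (path_graph n) (path_resolvent z n) h = delta 0 h"
  using bounded_graph.resolvent_solves[OF bounded_path assms delta_ell2] by (simp add: path_resolvent_def)

text \<open>The torus resolvent on functions on the cube. A difference j - k may leave the cube;
  periodicity of \<open>green\<close> identifies it with its wrapped value.\<close>

definition green_conv :: "real \<Rightarrow> nat \<Rightarrow> (int ^ 'd::finite \<Rightarrow> complex) \<Rightarrow> int ^ 'd \<Rightarrow> complex" where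
  "green_conv \<kappa> n \<phi> j = (\<Sum>k\<in>cube n. of_real (green \<kappa> (2 * n + 1) (j - k)) * \<phi> k)"

lemma green_conv_equation:
  fixes j :: "int ^ 'd::finite"
  assumes n: "n \<ge> 1" and \<kappa>: "\<kappa> > 2 * real CARD('d)" and j: "j \<in> cube n"
  shows "of_real \<kappa> * green_conv \<kappa> n \<phi> j - (\<Sum>y\<in>nbrs (torus_graph n) j. green_conv \<kappa> n \<phi> y) = \<phi> j"
proof -
  let ?K = "green \<kappa> (2 * n + 1) :: int ^ 'd \<Rightarrow> real"
  have e: "int (2 * n + 1) = 2 * int n + 1" by simp
  have wrap: "green_conv \<kappa> n \<phi> (wrap n x) = green_conv \<kappa> n \<phi> x" for x
  proof -
    have "int (2 * n + 1) dvd (wrap n x - k) $ i - (x - k) $ i" for i k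
    proof -
      have "(wrap n x - k) $ i - (x - k) $ i = wrap n x $ i - x $ i" by simp
      then show ?thesis unfolding e using wrap_cong[of n x i] by (simp only: cong_iff_dvd_diff)
    qed
    then have "?K (wrap n x - k) = ?K (x - k)" for k by (intro green_periodic) auto
    then show ?thesis by (simp add: green_conv_def)
  qed
  have eq: "?K (j - k + axis i 1) = ?K (j + axis i 1 - k)" "?K (j - k - axis i 1) = ?K (j - axis i 1 - k)" for k i
    by (simp_all add: algebra_simps)
  \<comment> \<open>Distinct points of the cube are incongruent, so the periodic delta reduces to j
    = k.\<close>
  have dvd: "(\<forall>i. int (2 * n + 1) dvd (j - k) $ i) \<longleftrightarrow> j = k" if k: "k \<in> cube n" for k
  proof
    assume "\<forall>i. int (2 * n + 1) dvd (j - k) $ i"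
    then have "[j $ i = k $ i] (mod (2 * int n + 1))" for i
      by (simp only: e cong_iff_dvd_diff vector_minus_component)
    then have "wrap n k $ i = j $ i" for i using j by (intro wrap_unique) auto
    then show "j = k" using wrap_id[OF k] by (simp add: vec_eq_iff)
  qed simp
  have "(\<Sum>y\<in>nbrs (torus_graph n) j. green_conv \<kappa> n \<phi> y) =
      (\<Sum>i\<in>UNIV. green_conv \<kappa> n \<phi> (j + axis i 1) + green_conv \<kappa> n \<phi> (j - axis i 1))"
    unfolding torus_sum[OF n j] wrap ..
  also have "\<dots> = (\<Sum>i\<in>UNIV. \<Sum>k\<in>cube n. of_real (?K (j - k + axis i 1) + ?K (j - k - axis i 1)) * \<phi> k)"
    unfolding green_conv_def eq by (simp add: sum.distrib[symmetric] distrib_right)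
  also have "\<dots> = (\<Sum>k\<in>cube n. of_real (\<Sum>i\<in>UNIV. ?K (j - k + axis i 1) + ?K (j - k - axis i 1)) * \<phi> k)"
    by (subst sum.swap) (simp add: sum_distrib_right)
  finally have "of_real \<kappa> * green_conv \<kappa> n \<phi> j - (\<Sum>y\<in>nbrs (torus_graph n) j. green_conv \<kappa> n \<phi> y) =
      (\<Sum>k\<in>cube n. of_real (\<kappa> * ?K (j - k) - (\<Sum>i\<in>UNIV. ?K (j - k + axis i 1) + ?K (j - k - axis i 1))) * \<phi> k)"
    unfolding green_conv_def sum_distrib_left
    by (simp add: sum_subtractf[symmetric] left_diff_distrib mult.assoc)
  also have "\<dots> = (\<Sum>k\<in>cube n. of_bool (j = k) * \<phi> k)"
  proof (rule sum.cong[OF refl])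
    fix k :: "int ^ 'd" assume k: "k \<in> cube n"
    show "of_real (\<kappa> * ?K (j - k) - (\<Sum>i\<in>UNIV. ?K (j - k + axis i 1) + ?K (j - k - axis i 1))) * \<phi> k =
      of_bool (j = k) * \<phi> k"
      by (subst green_equation[OF _ \<kappa>]) (simp_all only: dvd[OF k], auto)
  qed
  also have "\<dots> = \<phi> j"
    using j cube_finite_card(1)[of n, where 'd='d] by (simp add: of_bool_def if_distrib[of "\<lambda>c. c * _"] sum.delta' cong: if_cong del: mem_Collect_eq)
  finally show ?thesis .
qed

text \<open>Schur complement with respect to the backbone: the torus enters through
  \<open>A (1 - g A)\<^sup>-\<^sup>1 = - \<kappa> + \<kappa>\<^sup>2 (\<kappa> - A)\<^sup>-\<^sup>1\<close> with \<open>\<kappa> = 1 / g\<close>, where \<open>g\<close> is the central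
  matrix element of the resolvent of a tooth.\<close>

lemma comb_box_resolvent:
  fixes \<xi> :: "(int ^ 'd::finite) \<times> int \<Rightarrow> complex"
  assumes n: "n \<ge> 1" and z: "z > comb_norm CARD('d)" and \<xi>: "\<xi> \<in> ell2"
    and g: "path_resolvent z n 0 = of_real g" "g > 0" "g < 1 / (2 * real CARD('d))"
  defines "\<kappa> \<equiv> 1 / g" and "\<phi> \<equiv> \<lambda>j. ell2_inner (path_resolvent z n) (fiber \<xi> j)"
  defines "\<Phi> \<equiv> \<lambda>j. - of_real \<kappa> * \<phi> j + of_real \<kappa> ^ 2 * green_conv \<kappa> n \<phi> j"
  shows "adj_series (comb_box n) (resolvent_fps z) \<xi> =
    (\<lambda>x. adj_series (teeth_graph n) (resolvent_fps z) \<xi> x +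
      (if fst x \<in> cube n then \<Phi> (fst x) * path_resolvent z n (snd x) else 0))"
proof -
  let ?d = "real CARD('d)" and ?\<rho> = "path_resolvent z n"
  let ?S = "adj_series (teeth_graph n) (resolvent_fps z) \<xi>"
  let ?E = "\<lambda>x :: (int ^ 'd) \<times> int. if fst x \<in> cube n then \<Phi> (fst x) * ?\<rho> (snd x) else 0"
  let ?\<zeta> = "\<lambda>x. ?S x + ?E x"
  have z2: "z > 2" using comb_decay(5)[of ?d] z by simp
  have \<kappa>: "\<kappa> > 2 * ?d" "\<kappa> * g = 1" using g by (auto simp: \<kappa>_def field_simps)
  interpret T: bounded_graph "teeth_graph n :: ((int ^ 'd) \<times> int) pair_pre_digraph" 2 by (rule bounded_teeth)
  interpret B: bounded_graph "comb_box n :: ((int ^ 'd) \<times> int) pair_pre_digraph" "comb_norm CARD('d)"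
    by (rule bounded_comb_box)
  have S: "?S \<in> ell2" by (rule T.adj_series_ell2[OF T.admissible_resolvent[OF z2] \<xi>])
  have E: "?E \<in> ell2"
  proof (rule ell2_finite_support)
    show "finite ((cube n :: (int ^ 'd) set) \<times> {- int n..int n})" using cube_finite_card by auto
    fix x :: "(int ^ 'd) \<times> int"
    assume x: "x \<notin> cube n \<times> {- int n..int n}"
    show "?E x = 0"
    proof (cases "fst x \<in> cube n")
      case True
      then have "\<bar>snd x\<bar> > int n" using x by (cases x) auto
      then show ?thesis by (simp add: path_resolvent_outside)
    next
      case False
      then show ?thesis by (simp only: if_False)
    qed
  qed
  have \<zeta>: "?\<zeta> \<in> ell2" by (rule ell2_add(1)[OF S E])
  have "of_real z * ?\<zeta> x - adj_op (comb_box n) ?\<zeta> x = \<xi> x" for x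
  proof -
    obtain j h where x: "x = (j, h)" by force
    have box: "adj_op (comb_box n) ?\<zeta> (j, h) = (if j \<in> cube n then adj_op (path_graph n) (fiber ?\<zeta> j) h else 0) +
        (if h = 0 then \<Sum>y\<in>nbrs (torus_graph n) j. ?\<zeta> (y, 0) else 0)"
      unfolding comb_box_def
      by (subst adj_op_comb_product) (simp_all add: path_finite path_no_loop torus_fin_card adj_op_def[of "torus_graph n"])
    have Ssol: "of_real z * ?S (j, h) - adj_op (teeth_graph n) ?S (j, h) = \<xi> (j, h)"
      by (rule T.resolvent_solves[OF z2 \<xi>])
    show ?thesis
    proof (cases "j \<in> cube n")
      case False
      have nb: "nbrs (torus_graph n) j = {}" by (rule torus_nbrs_outside[OF False])
      show ?thesis
        unfolding x box nb using Ssol[unfolded adj_op_teeth] False by (simp del: mem_Collect_eq)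
    next
      case True
      have fib: "fiber ?\<zeta> j = (\<lambda>h. \<Phi> j * ?\<rho> h + fiber ?S j h)"
        using True by (auto simp: fiber_def)
      have path: "adj_op (path_graph n) (fiber ?\<zeta> j) h =
          \<Phi> j * adj_op (path_graph n) ?\<rho> h + adj_op (path_graph n) (fiber ?S j) h"
        unfolding fib adj_op_linear ..
      \<comment> \<open>Backbone values of the candidate: the teeth contribute \<phi>, and the
        correction contributes g times its amplitude.\<close>
      have nb: "?\<zeta> (y, 0) = \<phi> y + of_real g * \<Phi> y" if "y \<in> nbrs (torus_graph n) j" for y
      proof -
        have y: "y \<in> cube n" using that torus_arcs[of j y n] by simp
        then show ?thesis using teeth_resolvent_centre[OF y z2 \<xi>] by (simp add: \<phi>_def g(1))
      qed
      \<comment> \<open>By g * \<kappa> = 1 the two occurrences of \<phi> cancel. What is left is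
        \<kappa> times the torus Green potential, whose neighbour sum is known.\<close>
      have "(\<Sum>y\<in>nbrs (torus_graph n) j. ?\<zeta> (y, 0)) =
          (\<Sum>y\<in>nbrs (torus_graph n) j. of_real \<kappa> * green_conv \<kappa> n \<phi> y)"
      proof (rule sum.cong[OF refl])
        fix y assume y: "y \<in> nbrs (torus_graph n) j"
        have c: "complex_of_real g * of_real \<kappa> = 1"
          using \<kappa>(2) by (metis mult.commute of_real_1 of_real_mult)
        have "\<phi> y + of_real g * \<Phi> y =
            \<phi> y - (of_real g * of_real \<kappa>) * \<phi> y + (of_real g * of_real \<kappa>) * of_real \<kappa> * green_conv \<kappa> n \<phi> y"
          by (simp add: \<Phi>_def algebra_simps power2_eq_square)
        then show "?\<zeta> (y, 0) = of_real \<kappa> * green_conv \<kappa> n \<phi> y" unfolding nb[OF y] c by simp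
      qed
      also have "\<dots> = of_real \<kappa> * (of_real \<kappa> * green_conv \<kappa> n \<phi> j - \<phi> j)"
        unfolding sum_distrib_left[symmetric] using green_conv_equation[OF n \<kappa>(1) True, of \<phi>]
        by (simp add: algebra_simps)
      also have "\<dots> = \<Phi> j" by (simp add: \<Phi>_def algebra_simps power2_eq_square)
      finally have tor: "(\<Sum>y\<in>nbrs (torus_graph n) j. ?\<zeta> (y, 0)) = \<Phi> j" .
      \<comment> \<open>The tooth correction has residual \<Phi> at h = 0, and the neighbour sum
        along the backbone is exactly this \<Phi>.\<close>
      have "of_real z * ?\<zeta> (j, h) - adj_op (comb_box n) ?\<zeta> (j, h) =
          (of_real z * ?S (j, h) - adj_op (path_graph n) (fiber ?S j) h) +
          \<Phi> j * (of_real z * ?\<rho> h - adj_op (path_graph n) ?\<rho> h) - (if h = 0 then \<Phi> j else 0)"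
        unfolding box path tor using True by (simp add: algebra_simps)
      also have "\<dots> = \<xi> (j, h)"
        using Ssol True unfolding path_resolvent_equation[OF z2] adj_op_teeth by (simp add: delta_def)
      finally show ?thesis unfolding x .
    qed
  qed
  then show ?thesis using B.resolvent_unique[OF z \<zeta>] by simp
qed

lemma inner_tooth_block:
  fixes S :: "'a set"
  assumes S: "finite S"
  shows "ell2_inner (block S (path_resolvent z n)) \<xi> = (\<Sum>j\<in>S. ell2_inner (path_resolvent z n) (fiber \<xi> j))"
proof -
  let ?H = "{- int n..int n}"
  have "ell2_inner (block S (path_resolvent z n)) \<xi> = (\<Sum>x\<in>S \<times> ?H. cnj (block S (path_resolvent z n) x) * \<xi> x)"
    by (rule ell2_inner_finite) (use S path_resolvent_outside[of n] in \<open>force simp: block_def abs_if split: if_splits\<close>)+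
  also have "\<dots> = (\<Sum>j\<in>S. \<Sum>h\<in>?H. cnj (path_resolvent z n h) * fiber \<xi> j h)"
    unfolding sum.cartesian_product by (rule sum.cong) (auto simp: block_def fiber_def)
  also have "\<dots> = (\<Sum>j\<in>S. ell2_inner (path_resolvent z n) (fiber \<xi> j))"
    by (intro sum.cong refl ell2_inner_finite[symmetric]) (auto simp: path_resolvent_outside)
  finally show ?thesis .
qed

lemma inner_tooth_weights:
  fixes S :: "'a set"
  assumes S: "finite S" and z: "z > 2"
  shows "ell2_inner \<eta> (\<lambda>x. if fst x \<in> S then \<Phi> (fst x) * path_resolvent z n (snd x) else 0) =
    (\<Sum>j\<in>S. cnj (ell2_inner (path_resolvent z n) (fiber \<eta> j)) * \<Phi> j)"
proof -
  let ?H = "{- int n..int n}" and ?f = "\<lambda>x. if fst x \<in> S then \<Phi> (fst x) * path_resolvent z n (snd x) else 0"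
  have "ell2_inner \<eta> ?f = (\<Sum>x\<in>S \<times> ?H. cnj (\<eta> x) * ?f x)"
    by (rule ell2_inner_finite) (use S path_resolvent_outside[of n] in \<open>force simp: abs_if split: if_splits\<close>)+
  also have "\<dots> = (\<Sum>j\<in>S. \<Sum>h\<in>?H. cnj (\<eta> (j, h)) * (\<Phi> j * path_resolvent z n h))"
    unfolding sum.cartesian_product by (rule sum.cong) auto
  also have "\<dots> = (\<Sum>j\<in>S. cnj (ell2_inner (path_resolvent z n) (fiber \<eta> j)) * \<Phi> j)"
  proof (rule sum.cong[OF refl])
    fix j
    have "ell2_inner (path_resolvent z n) (fiber \<eta> j) = (\<Sum>h\<in>?H. cnj (path_resolvent z n h) * \<eta> (j, h))"
      by (subst ell2_inner_finite[of ?H]) (auto simp: path_resolvent_outside fiber_def)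
    then show "(\<Sum>h\<in>?H. cnj (\<eta> (j, h)) * (\<Phi> j * path_resolvent z n h)) =
        cnj (ell2_inner (path_resolvent z n) (fiber \<eta> j)) * \<Phi> j"
      using path_resolvent_real[OF z] by (simp add: sum_distrib_left sum_distrib_right mult_ac)
  qed
  finally show ?thesis .
qed

text \<open>The singular part of the resolvent is rank one: replacing the Green kernel by its value at
  \<open>0\<close> leaves the defect \<open>green \<kappa> N 0 - green \<kappa> N x\<close>, which stays bounded.\<close>

lemma comb_box_resolvent_inner:
  fixes \<xi> \<eta> :: "(int ^ 'd::finite) \<times> int \<Rightarrow> complex"
  assumes n: "n \<ge> 1" and z: "z > comb_norm CARD('d)" and \<xi>: "\<xi> \<in> ell2" and \<eta>: "\<eta> \<in> ell2"
    and g: "path_resolvent z n 0 = of_real g" "g > 0" "g < 1 / (2 * real CARD('d))"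
  defines "\<kappa> \<equiv> 1 / g" and "P \<equiv> \<lambda>\<xi> j. ell2_inner (path_resolvent z n) (fiber \<xi> (j :: int ^ 'd))"
  shows "ell2_inner \<eta> (adj_series (comb_box n) (resolvent_fps z) \<xi>) =
    ell2_inner \<eta> (adj_series (teeth_graph n) (resolvent_fps z) \<xi>)
    - of_real \<kappa> * (\<Sum>j\<in>cube n. cnj (P \<eta> j) * P \<xi> j)
    + of_real (\<kappa>\<^sup>2 * green \<kappa> (2 * n + 1) (0 :: int ^ 'd)) * (cnj (\<Sum>j\<in>cube n. P \<eta> j) * (\<Sum>j\<in>cube n. P \<xi> j))
    - of_real (\<kappa>\<^sup>2) * (\<Sum>(j, k)\<in>cube n \<times> cube n.
        of_real (green \<kappa> (2 * n + 1) (0 :: int ^ 'd) - green \<kappa> (2 * n + 1) (j - k)) * (cnj (P \<eta> j) * P \<xi> k))"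
proof -
  let ?K = "green \<kappa> (2 * n + 1) :: int ^ 'd \<Rightarrow> real"
  let ?\<Phi> = "\<lambda>j. - of_real \<kappa> * P \<xi> j + of_real \<kappa> ^ 2 * green_conv \<kappa> n (P \<xi>) j"
  let ?E = "\<lambda>x. if fst x \<in> cube n then ?\<Phi> (fst x) * path_resolvent z n (snd x) else 0"
  have z2: "z > 2" using comb_decay(5)[of "real CARD('d)"] z by simp
  let ?S = "adj_series (teeth_graph n) (resolvent_fps z) \<xi>"
  have S: "?S \<in> ell2"
    by (rule bounded_graph.adj_series_ell2[OF bounded_teeth bounded_graph.admissible_resolvent[OF bounded_teeth z2] \<xi>])
  have eq: "adj_series (comb_box n) (resolvent_fps z) \<xi> = (\<lambda>x. ?S x + ?E x)"
    unfolding \<kappa>_def P_def by (rule comb_box_resolvent[OF n z \<xi> g])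
  have "(\<lambda>x. ?S x + ?E x) \<in> ell2" unfolding eq[symmetric]
    by (rule bounded_graph.adj_series_ell2[OF bounded_comb_box bounded_graph.admissible_resolvent[OF bounded_comb_box z] \<xi>])
  from ell2_diff(1)[OF this S] have E: "?E \<in> ell2" by (simp del: mem_Collect_eq)
  have h1: "ell2_inner \<eta> (adj_series (comb_box n) (resolvent_fps z) \<xi>) = ell2_inner \<eta> ?S + ell2_inner \<eta> ?E"
    unfolding eq by (rule ell2_inner_add[OF \<eta> S E])
  have h2: "ell2_inner \<eta> ?E = (\<Sum>j\<in>cube n. cnj (P \<eta> j) * ?\<Phi> j)"
    using inner_tooth_weights[OF cube_finite_card(1) z2, where \<Phi>="?\<Phi>"] by (simp only: P_def)
  have h3: "(\<Sum>j\<in>cube n. cnj (P \<eta> j) * ?\<Phi> j) =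
      - of_real \<kappa> * (\<Sum>j\<in>cube n. cnj (P \<eta> j) * P \<xi> j) +
      of_real (\<kappa>\<^sup>2) * (\<Sum>j\<in>cube n. cnj (P \<eta> j) * green_conv \<kappa> n (P \<xi>) j)"
    unfolding sum_distrib_left sum.distrib[symmetric] by (intro sum.cong refl) (simp add: algebra_simps)
  have h4: "(\<Sum>j\<in>cube n. cnj (P \<eta> j) * green_conv \<kappa> n (P \<xi>) j) =
      (\<Sum>(j, k)\<in>cube n \<times> cube n. of_real (?K (j - k)) * (cnj (P \<eta> j) * P \<xi> k))"
    by (simp add: green_conv_def sum_distrib_left sum.cartesian_product mult_ac)
  have h5: "(\<Sum>(j, k)\<in>cube n \<times> cube n. of_real (?K (j - k)) * (cnj (P \<eta> j) * P \<xi> k)) =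
      of_real (?K 0) * (cnj (\<Sum>j\<in>cube n. P \<eta> j) * (\<Sum>j\<in>cube n. P \<xi> j)) -
      (\<Sum>(j, k)\<in>cube n \<times> cube n. of_real (?K 0 - ?K (j - k)) * (cnj (P \<eta> j) * P \<xi> k))"
  proof -
    have pr: "cnj (\<Sum>j\<in>cube n. P \<eta> j) * (\<Sum>j\<in>cube n. P \<xi> j) =
        (\<Sum>(j, k)\<in>cube n \<times> cube n. cnj (P \<eta> j) * P \<xi> k)"
      unfolding cnj_sum sum_product sum.cartesian_product ..
    show ?thesis unfolding pr unfolding sum_distrib_left sum_subtractf[symmetric]
      by (intro sum.cong refl) (auto simp: algebra_simps)
  qed
  have alg: "s + (- k * A + k2 * (K0 * c - D)) = s - k * A + k2 * K0 * c - k2 * D"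
    for s k A k2 K0 c D :: complex by (simp add: algebra_simps)
  show ?thesis unfolding h1 h2 h3 unfolding h4 unfolding h5 alg of_real_mult ..
qed

section \<open>Sums over the backbone\<close>

text \<open>A finite set of lattice points lies in a product of finite sets, over which the sum of
  products is a product of one-dimensional sums.\<close>

lemma summable_product_weight:
  fixes g :: "nat \<Rightarrow> real"
  assumes g: "summable g" "\<And>m. g m \<ge> 0"
  shows "(\<lambda>j::int ^ 'd::finite. \<Prod>i\<in>UNIV. g (nat \<bar>j $ i\<bar>)) summable_on UNIV"
proof (rule nonneg_bdd_above_summable_on)
  show "bdd_above (sum (\<lambda>j::int ^ 'd. \<Prod>i\<in>UNIV. g (nat \<bar>j $ i\<bar>)) ` {F. F \<subseteq> UNIV \<and> finite F})"
  proof (rule bdd_aboveI2)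
    fix F :: "(int ^ 'd) set" assume "F \<in> {F. F \<subseteq> UNIV \<and> finite F}"
    then have F: "finite F" by simp
    let ?B = "\<lambda>i. (\<lambda>j. j $ i) ` F"
    have fin: "finite (PiE UNIV ?B)" using F by (intro finite_PiE) auto
    have "F \<subseteq> vec_lambda ` PiE UNIV ?B"
    proof
      fix j assume "j \<in> F"
      then show "j \<in> vec_lambda ` PiE UNIV ?B" by (intro image_eqI[of _ _ "vec_nth j"]) auto
    qed
    then have "(\<Sum>j\<in>F. \<Prod>i\<in>UNIV. g (nat \<bar>j $ i\<bar>)) \<le> (\<Sum>j\<in>vec_lambda ` PiE UNIV ?B. \<Prod>i\<in>UNIV. g (nat \<bar>j $ i\<bar>))"
      using fin g(2) by (intro sum_mono2) (auto intro!: prod_nonneg)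
    also have "\<dots> = (\<Sum>f\<in>PiE UNIV ?B. \<Prod>i\<in>UNIV. g (nat \<bar>f i\<bar>))"
      by (subst sum.reindex) (auto simp: inj_on_def vec_lambda_inject)
    also have "\<dots> = (\<Prod>i\<in>UNIV. \<Sum>h\<in>?B i. g (nat \<bar>h\<bar>))"
      by (rule prod_sum_PiE[symmetric]) (use F in auto)
    also have "\<dots> \<le> (\<Prod>i\<in>(UNIV :: 'd set). 2 * suminf g)"
      using F g by (intro prod_mono) (auto intro!: sum_nonneg int_sum_le)
    finally show "(\<Sum>j\<in>F. \<Prod>i\<in>UNIV. g (nat \<bar>j $ i\<bar>)) \<le> (2 * suminf g) ^ CARD('d)" by simp
  qed
qed (use g in \<open>auto intro!: prod_nonneg\<close>)

lemma rapidly_decreasing_l1: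
  "rapidly_decreasing f \<longleftrightarrow> (\<forall>m. \<exists>B. \<forall>j. (1 + l1 j) ^ m * \<bar>f j\<bar> \<le> B)"
  by (simp add: rapidly_decreasing_def l1_def)

lemma rapidly_decreasing_summable:
  fixes f :: "int ^ 'd::finite \<Rightarrow> real"
  assumes "rapidly_decreasing f" "\<And>j. f j \<ge> 0"
  shows "(\<lambda>j. (1 + l1 j) ^ k * f j) summable_on UNIV"
proof -
  let ?g = "\<lambda>m::nat. 1 / (1 + real m)\<^sup>2"
  \<comment> \<open>The 2 * d extra powers pay for one factor (1 + |j_i|)^2 per coordinate, which is
    enough for summability.\<close>
  obtain B where B: "\<And>j. (1 + l1 j) ^ (k + 2 * CARD('d)) * \<bar>f j\<bar> \<le> B"
    using assms(1) unfolding rapidly_decreasing_l1 by blast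
  have "summable (\<lambda>m. inverse (real (Suc m) ^ 2))"
    using inverse_power_summable[of 2, where 'a=real] by (subst summable_Suc_iff) auto
  then have g: "summable ?g" by (simp add: divide_inverse add.commute)
  have "(\<lambda>j::int ^ 'd. B * (\<Prod>i\<in>UNIV. ?g (nat \<bar>j $ i\<bar>))) summable_on UNIV"
    by (intro summable_on_cmult_right summable_product_weight g) auto
  then have "(\<lambda>j. norm ((1 + l1 j) ^ k * f j)) summable_on UNIV"
  proof (rule Infinite_Sum.abs_summable_on_comparison_test')
    fix j :: "int ^ 'd"
    let ?P = "\<Prod>i\<in>(UNIV :: 'd set). (1 + real (nat \<bar>j $ i\<bar>))\<^sup>2"
    have P0: "?P > 0" by (intro prod_pos) auto
    have "?P \<le> (\<Prod>i\<in>(UNIV :: 'd set). (1 + l1 j)\<^sup>2)"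
    proof (intro prod_mono conjI power_mono)
      fix i
      have "\<bar>j $ i\<bar> \<le> (\<Sum>i\<in>UNIV. \<bar>j $ i\<bar>)" by (rule member_le_sum) auto
      then have "real_of_int \<bar>j $ i\<bar> \<le> l1 j" unfolding l1_def by (simp only: of_int_le_iff)
      then show "1 + real (nat \<bar>j $ i\<bar>) \<le> 1 + l1 j" by simp
    qed auto
    also have "\<dots> = (1 + l1 j) ^ (2 * CARD('d))" by (simp add: power_mult)
    finally have "(1 + l1 j) ^ k * f j * ?P \<le> (1 + l1 j) ^ k * f j * (1 + l1 j) ^ (2 * CARD('d))"
      using assms(2) l1_nonneg[of j] by (intro mult_left_mono) auto
    also have "\<dots> \<le> B" using B[of j] assms(2)[of j] by (simp add: power_add mult_ac)
    finally have "(1 + l1 j) ^ k * f j \<le> B / ?P" using P0 by (simp add: pos_le_divide_eq)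
    also have "\<dots> = B * (\<Prod>i\<in>UNIV. ?g (nat \<bar>j $ i\<bar>))" by (simp add: prod_dividef)
    finally show "norm ((1 + l1 j) ^ k * f j) \<le> B * (\<Prod>i\<in>UNIV. ?g (nat \<bar>j $ i\<bar>))"
      using assms(2)[of j] l1_nonneg[of j] by simp
  qed
  then show ?thesis by (rule Infinite_Sum.abs_summable_summable)
qed

lemma schwartz_vectorsD:
  assumes "\<xi> \<in> schwartz_vectors"
  shows "\<xi> \<in> ell2" "(\<lambda>j. (1 + l1 j) ^ k * ell2_norm (fiber \<xi> j)) summable_on UNIV"
    "(\<lambda>j. ell2_norm (fiber \<xi> j)) summable_on UNIV"
  using assms rapidly_decreasing_summable[of "\<lambda>j. ell2_norm (fiber \<xi> j)" k]
    rapidly_decreasing_summable[of "\<lambda>j. ell2_norm (fiber \<xi> j)" 0]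
  by (auto simp: schwartz_vectors_def)

lemma complex_subspace_ell2: "complex_subspace ell2"
  by (auto simp: complex_subspace_def intro!: ell2_add(1) ell2_scale(1))

lemma complex_subspace_schwartz: "complex_subspace (schwartz_vectors :: ((int ^ 'd::finite) \<times> int \<Rightarrow> complex) set)"
  unfolding complex_subspace_def
proof (intro conjI ballI allI)
  show "(\<lambda>x. 0) \<in> (schwartz_vectors :: ((int ^ 'd) \<times> int \<Rightarrow> complex) set)"
    by (auto simp: schwartz_vectors_def fiber_def rapidly_decreasing_def)
  fix \<xi> \<eta> :: "(int ^ 'd) \<times> int \<Rightarrow> complex" and a
  assume \<xi>: "\<xi> \<in> schwartz_vectors" and \<eta>: "\<eta> \<in> schwartz_vectors"
  note e = schwartz_vectorsD(1)[OF \<xi>] schwartz_vectorsD(1)[OF \<eta>]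
  have mem: "(\<lambda>x. a * \<xi> x + \<eta> x) \<in> ell2" by (intro ell2_add(1) ell2_scale(1) e)
  have le: "ell2_norm (fiber (\<lambda>x. a * \<xi> x + \<eta> x) j) \<le> cmod a * ell2_norm (fiber \<xi> j) + ell2_norm (fiber \<eta> j)" for j
    using ell2_add(2)[OF ell2_scale(1)[OF fiber_ell2(1)[OF e(1)]] fiber_ell2(1)[OF e(2)], of a j j]
      ell2_scale(2)[OF fiber_ell2(1)[OF e(1)], of a j] by (simp add: fiber_def)
  have "rapidly_decreasing (\<lambda>j. ell2_norm (fiber (\<lambda>x. a * \<xi> x + \<eta> x) j))"
    unfolding rapidly_decreasing_l1
  proof
    fix m
    obtain B where B: "\<And>j. (1 + l1 j) ^ m * \<bar>ell2_norm (fiber \<xi> j)\<bar> \<le> B"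
      using \<xi> unfolding schwartz_vectors_def rapidly_decreasing_l1 by blast
    obtain B' where B': "\<And>j. (1 + l1 j) ^ m * \<bar>ell2_norm (fiber \<eta> j)\<bar> \<le> B'"
      using \<eta> unfolding schwartz_vectors_def rapidly_decreasing_l1 by blast
    have "(1 + l1 j) ^ m * \<bar>ell2_norm (fiber (\<lambda>x. a * \<xi> x + \<eta> x) j)\<bar> \<le> cmod a * B + B'" for j
    proof -
      have "(1 + l1 j) ^ m * \<bar>ell2_norm (fiber (\<lambda>x. a * \<xi> x + \<eta> x) j)\<bar> \<le>
          (1 + l1 j) ^ m * (cmod a * ell2_norm (fiber \<xi> j) + ell2_norm (fiber \<eta> j))"
        using le[of j] l1_nonneg[of j] by (intro mult_left_mono) auto
      also have "\<dots> = cmod a * ((1 + l1 j) ^ m * ell2_norm (fiber \<xi> j)) + (1 + l1 j) ^ m * ell2_norm (fiber \<eta> j)"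
        by (simp add: algebra_simps)
      also have "\<dots> \<le> cmod a * B + B'"
        using B[of j] B'[of j] by (intro add_mono mult_left_mono) auto
      finally show ?thesis .
    qed
    then show "\<exists>B. \<forall>j. (1 + l1 j) ^ m * \<bar>ell2_norm (fiber (\<lambda>x. a * \<xi> x + \<eta> x) j)\<bar> \<le> B" by blast
  qed
  with mem show "(\<lambda>x. a * \<xi> x + \<eta> x) \<in> schwartz_vectors" by (simp add: schwartz_vectors_def)
qed

text \<open>Dominated convergence with the indicator of \<open>S n\<close> absorbed into the
  summand.\<close>

lemma sum_exhaustion_dominated:
  fixes f :: "nat \<Rightarrow> 'a \<Rightarrow> complex" and g :: "'a \<Rightarrow> real"
  assumes S: "\<And>n. finite (S n)" "\<And>x. eventually (\<lambda>n. x \<in> S n) sequentially"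
    and f: "\<And>x. (\<lambda>n. f n x) \<longlonglongrightarrow> l x" and g: "g summable_on UNIV" "\<And>n x. cmod (f n x) \<le> g x"
  shows "(\<lambda>n. \<Sum>x\<in>S n. f n x) \<longlonglongrightarrow> (\<Sum>\<^sub>\<infinity>x. l x)"
proof -
  have "(\<lambda>n. \<Sum>\<^sub>\<infinity>x. if x \<in> S n then f n x else 0) \<longlonglongrightarrow> (\<Sum>\<^sub>\<infinity>x. l x)"
  proof (rule infsum_dominated_convergence[OF _ g(1)])
    fix x
    have "eventually (\<lambda>n. f n x = (if x \<in> S n then f n x else 0)) sequentially"
      using S(2)[of x] by eventually_elim simp
    then show "(\<lambda>n. if x \<in> S n then f n x else 0) \<longlonglongrightarrow> l x"
      by (rule Lim_transform_eventually[OF f])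
  next
    fix n x
    have "0 \<le> g x" using g(2)[of n x] norm_ge_zero order_trans by blast
    then show "cmod (if x \<in> S n then f n x else 0) \<le> g x" using g(2) by simp
  qed
  moreover have "(\<Sum>\<^sub>\<infinity>x. if x \<in> S n then f n x else 0) = (\<Sum>x\<in>S n. f n x)" for n
  proof -
    have "(\<Sum>\<^sub>\<infinity>x. if x \<in> S n then f n x else 0) = (\<Sum>\<^sub>\<infinity>x\<in>S n. f n x)"
      by (rule infsum_cong_neutral) auto
    then show ?thesis using S(1) by simp
  qed
  ultimately show ?thesis by simp
qed

lemma l1_diff: "l1 (j - k) \<le> l1 j + l1 k"
proof -
  have "(\<Sum>i\<in>UNIV. \<bar>(j - k) $ i\<bar>) \<le> (\<Sum>i\<in>UNIV. \<bar>j $ i\<bar> + \<bar>k $ i\<bar>)"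
    by (intro sum_mono) auto
  then show ?thesis unfolding l1_def by (simp add: sum.distrib flip: of_int_add of_int_sum)
qed

text \<open>The product form splits the growth of the defect at j - k into one polynomial weight for
  each of the two vectors, so that the double sum factorises.\<close>

lemma l1_diff_sq_le: "(l1 (j - k))\<^sup>2 / 2 \<le> (1 + l1 j)\<^sup>2 * (1 + l1 k)\<^sup>2"
proof -
  have "l1 (j - k) \<le> (1 + l1 j) * (1 + l1 k)"
  proof -
    have "(1 + l1 j) * (1 + l1 k) = 1 + l1 j + l1 k + l1 j * l1 k" by (simp add: algebra_simps)
    then show ?thesis using l1_diff[of j k] mult_nonneg_nonneg[OF l1_nonneg[of j] l1_nonneg[of k]] by linarith
  qed
  then have "(l1 (j - k))\<^sup>2 \<le> ((1 + l1 j) * (1 + l1 k))\<^sup>2" by (intro power_mono l1_nonneg)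
  then show ?thesis using zero_le_power2[of "l1 (j - k)"] unfolding power_mult_distrib by linarith
qed

section \<open>Condensation\<close>

text \<open>Linear identities pass to pointwise limits; the forms live on \<open>E\<close>, while
  their limit is known only on \<open>D\<close>.\<close>

lemma sesquilinear_form_limit:
  assumes D: "complex_subspace D" "D \<subseteq> E" and C: "\<And>n. sesquilinear_form E (C n)"
    and lim: "\<And>\<xi> \<eta>. \<xi> \<in> D \<Longrightarrow> \<eta> \<in> D \<Longrightarrow> (\<lambda>n. C n \<xi> \<eta>) \<longlonglongrightarrow> L \<xi> \<eta>"
  shows "sesquilinear_form D L"
  unfolding sesquilinear_form_def
proof (intro conjI ballI allI D(1))
  fix \<xi> \<xi>' \<eta> and a :: complex assume m: "\<xi> \<in> D" "\<xi>' \<in> D" "\<eta> \<in> D"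
  then have "(\<lambda>x. a * \<xi> x + \<xi>' x) \<in> D" using D(1) by (simp add: complex_subspace_def)
  from lim[OF this m(3)] have "(\<lambda>n. C n (\<lambda>x. a * \<xi> x + \<xi>' x) \<eta>) \<longlonglongrightarrow> L (\<lambda>x. a * \<xi> x + \<xi>' x) \<eta>" .
  moreover have "C n (\<lambda>x. a * \<xi> x + \<xi>' x) \<eta> = a * C n \<xi> \<eta> + C n \<xi>' \<eta>" for n
    using C[of n] m D(2) unfolding sesquilinear_form_def by blast
  moreover have "(\<lambda>n. a * C n \<xi> \<eta> + C n \<xi>' \<eta>) \<longlonglongrightarrow> a * L \<xi> \<eta> + L \<xi>' \<eta>"
    by (intro tendsto_intros lim m)
  ultimately show "L (\<lambda>x. a * \<xi> x + \<xi>' x) \<eta> = a * L \<xi> \<eta> + L \<xi>' \<eta>" using LIMSEQ_unique by simp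
next
  fix \<xi> \<eta> \<eta>' and a :: complex assume m: "\<xi> \<in> D" "\<eta> \<in> D" "\<eta>' \<in> D"
  then have "(\<lambda>x. a * \<eta> x + \<eta>' x) \<in> D" using D(1) by (simp add: complex_subspace_def)
  from lim[OF m(1) this] have "(\<lambda>n. C n \<xi> (\<lambda>x. a * \<eta> x + \<eta>' x)) \<longlonglongrightarrow> L \<xi> (\<lambda>x. a * \<eta> x + \<eta>' x)" .
  moreover have "C n \<xi> (\<lambda>x. a * \<eta> x + \<eta>' x) = cnj a * C n \<xi> \<eta> + C n \<xi> \<eta>'" for n
    using C[of n] m D(2) unfolding sesquilinear_form_def by blast
  moreover have "(\<lambda>n. cnj a * C n \<xi> \<eta> + C n \<xi> \<eta>') \<longlonglongrightarrow> cnj a * L \<xi> \<eta> + L \<xi> \<eta>'"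
    by (intro tendsto_intros lim m)
  ultimately show "L \<xi> (\<lambda>x. a * \<eta> x + \<eta>' x) = cnj a * L \<xi> \<eta> + L \<xi> \<eta>'" using LIMSEQ_unique by simp
qed

text \<open>\<open>dim\<close> carries the dimension as a type, \<open>\<gamma> n\<close> is the
  critical number g of the teeth at stage n, and \<open>R\<close> bounds the norms of all
  \<open>path_resolvent\<close> vectors involved.\<close>

locale condensing_comb =
  fixes z :: "nat \<Rightarrow> real" and dim :: "'d::finite itself" and d a R :: real and \<gamma> \<kappa> :: "nat \<Rightarrow> real"
  defines "d \<equiv> real CARD('d)" and "a \<equiv> comb_norm d" and "R \<equiv> 1 / (a - 2) * ell2_norm (delta (0 :: int))"
    and "\<kappa> \<equiv> \<lambda>n. 1 / \<gamma> n"
  assumes z: "\<And>n. z n > a" "z \<longlonglongrightarrow> a"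
    and \<gamma>: "\<And>n. path_resolvent (z n) n 0 = of_real (\<gamma> n)" "\<And>n. \<gamma> n > 0" "\<And>n. \<gamma> n < 1 / (2 * d)"
begin

lemma d_pos: "d > 0" by (simp add: d_def)
lemma a_gt_2: "a > 2" unfolding a_def by (rule comb_decay(5)[OF d_pos])
lemma z_gt_2: "z n > 2" using z(1)[of n] a_gt_2 by linarith

definition coef :: "nat \<Rightarrow> ((int ^ 'd) \<times> int \<Rightarrow> complex) \<Rightarrow> int ^ 'd \<Rightarrow> complex" where
  "coef n \<xi> j = ell2_inner (path_resolvent (z n) n) (fiber \<xi> j)"

definition coef_lim :: "((int ^ 'd) \<times> int \<Rightarrow> complex) \<Rightarrow> int ^ 'd \<Rightarrow> complex" where
  "coef_lim \<xi> j = ell2_inner (tooth d) (fiber \<xi> j)"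

lemma R_nonneg: "R \<ge> 0" unfolding R_def using a_gt_2 by (intro mult_nonneg_nonneg) auto

lemma coef_bound:
  assumes "\<xi> \<in> ell2" shows "cmod (coef n \<xi> j) \<le> R * ell2_norm (fiber \<xi> j)"
proof -
  have "cmod (coef n \<xi> j) \<le> ell2_norm (path_resolvent (z n) n) * ell2_norm (fiber \<xi> j)"
    unfolding coef_def by (rule ell2_Cauchy_Schwarz[OF path_resolvent_ell2[OF z_gt_2] fiber_ell2(1)[OF assms]])
  also have "\<dots> \<le> R * ell2_norm (fiber \<xi> j)"
    unfolding R_def using z(1)[of n] by (intro mult_right_mono path_resolvent_norm_le a_gt_2) auto
  finally show ?thesis .
qed

lemma coef_tendsto: "\<xi> \<in> ell2 \<Longrightarrow> (\<lambda>n. coef n \<xi> j) \<longlonglongrightarrow> coef_lim \<xi> j"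
  unfolding coef_def coef_lim_def
  by (rule path_resolvent_tendsto[OF d_pos]) (use z fiber_ell2 in \<open>auto simp: a_def less_imp_le\<close>)

lemma coef_sum_tendsto:
  assumes "\<xi> \<in> schwartz_vectors"
  shows "(\<lambda>n. \<Sum>j\<in>cube n. coef n \<xi> j) \<longlonglongrightarrow> (\<Sum>\<^sub>\<infinity>j. coef_lim \<xi> j)"
  using schwartz_vectorsD(1,3)[OF assms]
  by (intro sum_exhaustion_dominated[where g="\<lambda>j. R * ell2_norm (fiber \<xi> j)"] cube_finite_card(1)
      eventually_in_cube coef_tendsto summable_on_cmult_right coef_bound)

lemma \<kappa>_gt: "\<kappa> n > 2 * real CARD('d)"
  using \<gamma>(2,3)[of n] d_pos unfolding \<kappa>_def d_def by (simp add: field_simps)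

text \<open>Up to conjugation \<open>\<gamma> n\<close> is the pairing of
  \<open>path_resolvent\<close> with \<open>delta 0\<close>, so it tends to
  \<open>tooth d 0\<close>, which is 1 / (2 * d).\<close>

lemma \<kappa>_tendsto: "\<kappa> \<longlonglongrightarrow> 2 * real CARD('d)"
proof -
  have "ell2_inner f (delta 0) = cnj (f 0)" for f :: "int \<Rightarrow> complex"
    using ell2_inner_cnj[of f "delta 0"] by (simp add: ell2_inner_delta)
  then have "(\<lambda>n. cnj (path_resolvent (z n) n 0)) \<longlonglongrightarrow> cnj (tooth d 0)"
    using path_resolvent_tendsto[OF d_pos _ _ delta_ell2, of z 0] z by (simp add: a_def less_imp_le)
  then have "(\<lambda>n. complex_of_real (\<gamma> n)) \<longlonglongrightarrow> of_real (1 / (2 * d))"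
    by (simp add: \<gamma>(1) tooth_def)
  then have "\<gamma> \<longlonglongrightarrow> 1 / (2 * d)" by (simp only: tendsto_of_real_iff)
  then have "(\<lambda>n. 1 / \<gamma> n) \<longlonglongrightarrow> 1 / (1 / (2 * d))"
    using d_pos by (intro tendsto_intros) auto
  then show ?thesis by (simp add: \<kappa>_def d_def)
qed

lemma size_at_top: "filterlim (\<lambda>n::nat. 2 * n + 1) at_top sequentially"
  by (rule filterlim_at_top_mono[OF filterlim_ident]) auto

definition defect :: "nat \<Rightarrow> int ^ 'd \<Rightarrow> real" where
  "defect n x = green (\<kappa> n) (2 * n + 1) (0 :: int ^ 'd) - green (\<kappa> n) (2 * n + 1) x"

lemma defect_abs_le: "\<bar>defect n x\<bar> \<le> (l1 x)\<^sup>2 / 2"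
  unfolding defect_def using green_defect_bounds[OF _ \<kappa>_gt, of "2 * n + 1" n x] by simp

text \<open>All that remains after the rank-one term: the teeth keep a gap, the diagonal sum is
  dominated by fibre norms, and rapid decrease of both vectors absorbs the quadratic growth of the
  defect.\<close>

lemma resolvent_remainder_converges:
  assumes \<xi>: "\<xi> \<in> schwartz_vectors" and \<eta>: "\<eta> \<in> schwartz_vectors"
  shows "convergent (\<lambda>n. ell2_inner \<eta> (adj_series (teeth_graph n) (resolvent_fps (z n)) \<xi>)
    - of_real (\<kappa> n) * (\<Sum>j\<in>cube n. cnj (coef n \<eta> j) * coef n \<xi> j)
    - of_real ((\<kappa> n)\<^sup>2) * (\<Sum>(j, k)\<in>cube n \<times> cube n. of_real (defect n (j - k)) * (cnj (coef n \<eta> j) * coef n \<xi> k)))"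
proof -
  note e = schwartz_vectorsD(1)[OF \<xi>] schwartz_vectorsD(1)[OF \<eta>]
  have 1: "(\<lambda>n. ell2_inner \<eta> (adj_series (teeth_graph n) (resolvent_fps (z n)) \<xi>))
      \<longlonglongrightarrow> ell2_inner \<eta> (adj_series all_teeth_graph (resolvent_fps a) \<xi>)"
    by (rule resolvent_weak_convergence[OF bounded_teeth bounded_all_teeth converges_teeth a_gt_2 _ z(2) e])
       (use z(1) in \<open>auto intro: less_imp_le\<close>)
  have 2: "(\<lambda>n. \<Sum>j\<in>cube n. cnj (coef n \<eta> j) * coef n \<xi> j) \<longlonglongrightarrow> (\<Sum>\<^sub>\<infinity>j. cnj (coef_lim \<eta> j) * coef_lim \<xi> j)"
  proof (rule sum_exhaustion_dominated[where g="\<lambda>j. R * ell2_norm \<eta> * (R * ell2_norm (fiber \<xi> j))"])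
    show "(\<lambda>j. R * ell2_norm \<eta> * (R * ell2_norm (fiber \<xi> j))) summable_on UNIV"
      by (intro summable_on_cmult_right schwartz_vectorsD(3) \<xi>)
    fix n j
    \<comment> \<open>One factor is bounded by the full norm of \<eta>, so the majorant only has to
      be summed over the fibres of \<xi>.\<close>
    have "cmod (coef n \<eta> j) \<le> R * ell2_norm \<eta>"
      by (rule order_trans[OF coef_bound[OF e(2)] mult_left_mono[OF fiber_ell2(2)[OF e(2)] R_nonneg]])
    then show "cmod (cnj (coef n \<eta> j) * coef n \<xi> j) \<le> R * ell2_norm \<eta> * (R * ell2_norm (fiber \<xi> j))"
      unfolding norm_mult complex_mod_cnj using R_nonneg
      by (intro mult_mono coef_bound e(1) mult_nonneg_nonneg) auto
  qed (intro cube_finite_card(1) eventually_in_cube tendsto_intros coef_tendsto e)+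
  \<comment> \<open>Up to a factor the limit \<open>D\<close> is the potential kernel of simple
    random walk on the lattice; its existence suffices.\<close>
  have "\<exists>D. \<forall>x. (\<lambda>n. defect n x) \<longlonglongrightarrow> D x"
  proof -
    have "convergent (\<lambda>n. defect n x)" for x
      unfolding defect_def by (rule green_defect_converges[OF \<kappa>_gt \<kappa>_tendsto _ size_at_top]) simp
    then show ?thesis unfolding convergent_def by metis
  qed
  then obtain D where D: "\<And>x. (\<lambda>n. defect n x) \<longlonglongrightarrow> D x" by blast
  let ?w = "\<lambda>\<zeta> j. (1 + l1 j)\<^sup>2 * ell2_norm (fiber \<zeta> j)"
  have 3: "(\<lambda>n. \<Sum>p\<in>cube n \<times> cube n. of_real (defect n (fst p - snd p)) * (cnj (coef n \<eta> (fst p)) * coef n \<xi> (snd p)))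
      \<longlonglongrightarrow> (\<Sum>\<^sub>\<infinity>p. of_real (D (fst p - snd p)) * (cnj (coef_lim \<eta> (fst p)) * coef_lim \<xi> (snd p)))"
  proof (rule sum_exhaustion_dominated[where g="\<lambda>p. R\<^sup>2 * (case p of (j, k) \<Rightarrow> ?w \<eta> j * ?w \<xi> k)"])
    show "finite (cube n \<times> cube n :: ((int ^ 'd) \<times> (int ^ 'd)) set)" for n
      by (intro finite_cartesian_product cube_finite_card(1))
    show "eventually (\<lambda>n. p \<in> cube n \<times> cube n) sequentially" for p :: "(int ^ 'd) \<times> (int ^ 'd)"
      using eventually_conj[OF eventually_in_cube[of "fst p"] eventually_in_cube[of "snd p"]]
      by (simp add: mem_Times_iff)
    show "(\<lambda>p. R\<^sup>2 * (case p of (j, k) \<Rightarrow> ?w \<eta> j * ?w \<xi> k)) summable_on UNIV"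
      by (intro summable_on_cmult_right summable_on_product_nonneg schwartz_vectorsD(2) \<xi> \<eta>) auto
    show "(\<lambda>n. of_real (defect n (fst p - snd p)) * (cnj (coef n \<eta> (fst p)) * coef n \<xi> (snd p))) \<longlonglongrightarrow>
        of_real (D (fst p - snd p)) * (cnj (coef_lim \<eta> (fst p)) * coef_lim \<xi> (snd p))" for p
      by (intro tendsto_intros D coef_tendsto e)
    fix n and p :: "(int ^ 'd) \<times> (int ^ 'd)"
    obtain j k where p: "p = (j, k)" by force
    have "\<bar>defect n (j - k)\<bar> * (cmod (coef n \<eta> j) * cmod (coef n \<xi> k)) \<le>
        ((1 + l1 j)\<^sup>2 * (1 + l1 k)\<^sup>2) * ((R * ell2_norm (fiber \<eta> j)) * (R * ell2_norm (fiber \<xi> k)))"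
      using order_trans[OF defect_abs_le l1_diff_sq_le] R_nonneg
      by (intro mult_mono coef_bound e mult_nonneg_nonneg) auto
    then show "cmod (of_real (defect n (fst p - snd p)) * (cnj (coef n \<eta> (fst p)) * coef n \<xi> (snd p))) \<le>
        R\<^sup>2 * (case p of (j, k) \<Rightarrow> ?w \<eta> j * ?w \<xi> k)"
      by (simp add: p norm_mult power2_eq_square mult_ac)
  qed
  show ?thesis
    unfolding case_prod_unfold
    by (rule convergentI[OF tendsto_diff[OF
          tendsto_diff[OF 1 tendsto_mult[OF tendsto_of_real[OF \<kappa>_tendsto] 2]]
          tendsto_mult[OF tendsto_of_real[OF tendsto_power[OF \<kappa>_tendsto, of 2]] 3]]])
qed

end

context condensing_comb
begin

text \<open>Constant along the backbone of the box, with the tooth profile at the actual energy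
  \<open>z n\<close>. The scalar uses the norm of the limiting profile, so that the limit is exactly
  \<open>pf_vector\<close>.\<close>

definition condensate :: "nat \<Rightarrow> (int ^ 'd) \<times> int \<Rightarrow> complex" where
  "condensate n = (\<lambda>x. of_real (1 / ell2_norm (tooth d)) * block (cube n) (path_resolvent (z n) n) x)"

text \<open>1 / \<beta> comes from the pole of the Bose function, \<kappa>^2 and the Green kernel
  from the Schur complement, and the squared norm undoes the normalisation of the two condensate
  factors.\<close>

definition occupation :: "real \<Rightarrow> nat \<Rightarrow> real" where
  "occupation \<beta> n = (ell2_norm (tooth d))\<^sup>2 / \<beta> * (\<kappa> n)\<^sup>2 * green (\<kappa> n) (2 * n + 1) (0 :: int ^ 'd)"

lemma condensate_ell2: "condensate n \<in> ell2"
  unfolding condensate_def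
  by (intro ell2_scale block_ell2_norm cube_finite_card path_resolvent_ell2 z_gt_2)

lemma condensate_ell2_on: "condensate n \<in> ell2_on (pverts (comb_box n))"
proof -
  have "condensate n x = 0" if "x \<notin> pverts (comb_box n)" for x
  proof -
    obtain j h where x: "x = (j, h)" by force
    have "j \<notin> cube n \<or> \<bar>h\<bar> > int n"
      using that unfolding x by (auto simp: comb_box_def comb_product_def path_graph_def)
    then show ?thesis using path_resolvent_outside[of n h] by (auto simp: condensate_def block_def x)
  qed
  then show ?thesis using condensate_ell2 by (auto simp: ell2_on_def)
qed

lemma condensate_inner:
  "ell2_inner (condensate n) \<xi> = of_real (1 / ell2_norm (tooth d)) * (\<Sum>j\<in>cube n. coef n \<xi> j)"
proof -
  let ?c = "complex_of_real (1 / ell2_norm (tooth d))"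
  have "ell2_inner (condensate n) \<xi> = cnj (ell2_inner \<xi> (condensate n))" by (rule ell2_inner_cnj)
  also have "\<dots> = cnj (?c * ell2_inner \<xi> (block (cube n) (path_resolvent (z n) n)))"
    unfolding condensate_def ell2_inner_scale ..
  also have "\<dots> = ?c * ell2_inner (block (cube n) (path_resolvent (z n) n)) \<xi>"
    unfolding ell2_inner_cnj[of "block (cube n) (path_resolvent (z n) n)"] by simp
  finally show ?thesis unfolding inner_tooth_block[OF cube_finite_card(1)] coef_def .
qed

lemma condensate_tendsto:
  assumes "\<eta> \<in> schwartz_vectors"
  shows "(\<lambda>n. ell2_inner (condensate n) \<eta>) \<longlonglongrightarrow> fiber_pairing pf_vector \<eta>"
proof -
  have pf: "fiber (pf_vector :: (int ^ 'd) \<times> int \<Rightarrow> complex) j = (\<lambda>h. of_real (1 / ell2_norm (tooth d)) * tooth d h)" for j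
    by (auto simp: fiber_def pf_vector_def op_norm_comb tooth_vector_eq[OF d_pos, unfolded d_def] d_def)
  have "ell2_inner (fiber (pf_vector :: (int ^ 'd) \<times> int \<Rightarrow> complex) j) (fiber \<eta> j) =
      of_real (1 / ell2_norm (tooth d)) * coef_lim \<eta> j" for j
    unfolding coef_lim_def ell2_inner_cnj[of _ "fiber \<eta> j"] pf ell2_inner_scale
    by (simp only: complex_cnj_mult complex_cnj_complex_of_real)
  then have "fiber_pairing pf_vector \<eta> = of_real (1 / ell2_norm (tooth d)) * (\<Sum>\<^sub>\<infinity>j. coef_lim \<eta> j)"
    unfolding fiber_pairing_def by (simp only: infsum_cmult_right')
  then show ?thesis unfolding condensate_inner by (simp only:) (intro tendsto_intros coef_sum_tendsto assms)
qed

lemma occupation_at_top: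
  assumes "CARD('d) \<le> 2" "\<beta> > 0"
  shows "filterlim (occupation \<beta>) at_top sequentially"
  unfolding occupation_def
proof (rule filterlim_tendsto_pos_mult_at_top)
  show "(\<lambda>n. (ell2_norm (tooth d))\<^sup>2 / \<beta> * (\<kappa> n)\<^sup>2) \<longlonglongrightarrow> (ell2_norm (tooth d))\<^sup>2 / \<beta> * (2 * real CARD('d))\<^sup>2"
    by (intro tendsto_intros \<kappa>_tendsto)
  show "0 < (ell2_norm (tooth d))\<^sup>2 / \<beta> * (2 * real CARD('d))\<^sup>2"
    using assms(2) tooth_norm_pos[OF d_pos] by simp
  show "filterlim (\<lambda>n. green (\<kappa> n) (2 * n + 1) (0 :: int ^ 'd)) at_top sequentially"
    by (rule green_0_at_top[OF assms(1) \<kappa>_gt \<kappa>_tendsto _ size_at_top]) simp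
qed

lemma occupation_condensate:
  assumes "\<beta> > 0"
  shows "of_real (occupation \<beta> n) * ell2_inner \<eta> (condensate n) * ell2_inner (condensate n) \<xi> =
    of_real (1 / \<beta>) * (of_real ((\<kappa> n)\<^sup>2 * green (\<kappa> n) (2 * n + 1) (0 :: int ^ 'd)) *
      (cnj (\<Sum>j\<in>cube n. coef n \<eta> j) * (\<Sum>j\<in>cube n. coef n \<xi> j)))"
proof -
  have T: "ell2_norm (tooth d) > 0" by (rule tooth_norm_pos[OF d_pos])
  show ?thesis
    unfolding ell2_inner_cnj[of \<eta>] condensate_inner occupation_def
    using T assms by (simp add: field_simps power2_eq_square del: cnj_sum)
qed

lemma remainder_converges:
  fixes f g :: "nat \<Rightarrow> complex fps"
  assumes \<beta>: "\<beta> > 0" and \<xi>: "\<xi> \<in> schwartz_vectors" and \<eta>: "\<eta> \<in> schwartz_vectors"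
    and f: "\<And>n. f n = fps_const (1 / of_real \<beta>) * resolvent_fps (z n) + g n"
    and g: "\<And>n. bounded_graph.admissible a (g n)"
    and conv: "convergent (\<lambda>n. ell2_inner \<eta> (adj_series (comb_box n) (g n) \<xi>))"
  shows "convergent (\<lambda>n. ell2_inner \<eta> (adj_series (comb_box n) (f n) \<xi>) -
    of_real (occupation \<beta> n) * ell2_inner \<eta> (condensate n) * ell2_inner (condensate n) \<xi>)"
proof -
  note e = schwartz_vectorsD(1)[OF \<xi>] schwartz_vectorsD(1)[OF \<eta>]
  let ?r = "\<lambda>n. ell2_inner \<eta> (adj_series (teeth_graph n) (resolvent_fps (z n)) \<xi>)
    - of_real (\<kappa> n) * (\<Sum>j\<in>cube n. cnj (coef n \<eta> j) * coef n \<xi> j)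
    - of_real ((\<kappa> n)\<^sup>2) * (\<Sum>(j, k)\<in>cube n \<times> cube n. of_real (defect n (j - k)) * (cnj (coef n \<eta> j) * coef n \<xi> k))"
  have "convergent (\<lambda>n. of_real (1 / \<beta>) * ?r n + ell2_inner \<eta> (adj_series (comb_box n) (g n) \<xi>))"
    by (intro convergent_add convergent_mult convergent_const conv resolvent_remainder_converges \<xi> \<eta>)
  \<comment> \<open>The closed form of the box resolvent is for n >= 1, since the one-point torus
    has no edges; convergence ignores n = 0.\<close>
  moreover have "eventually (\<lambda>n. of_real (1 / \<beta>) * ?r n + ell2_inner \<eta> (adj_series (comb_box n) (g n) \<xi>) =
      ell2_inner \<eta> (adj_series (comb_box n) (f n) \<xi>) -
      of_real (occupation \<beta> n) * ell2_inner \<eta> (condensate n) * ell2_inner (condensate n) \<xi>) sequentially"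
    using eventually_ge_at_top[of 1]
  proof eventually_elim
    case (elim n)
    interpret B: bounded_graph "comb_box n :: ((int ^ 'd) \<times> int) pair_pre_digraph" a
      unfolding a_def d_def by (rule bounded_comb_box)
    have adm: "B.admissible (resolvent_fps (z n))" by (rule B.admissible_resolvent[OF z(1)])
    have m: "adj_series (comb_box n) (resolvent_fps (z n)) \<xi> \<in> ell2" "adj_series (comb_box n) (g n) \<xi> \<in> ell2"
      by (rule B.adj_series_ell2[OF adm e(1)], rule B.adj_series_ell2[OF g e(1)])
    have eq: "adj_series (comb_box n) (f n) \<xi> = (\<lambda>x. 1 / of_real \<beta> *
        adj_series (comb_box n) (resolvent_fps (z n)) \<xi> x + adj_series (comb_box n) (g n) \<xi> x)"
      unfolding f B.adj_series_add[OF B.admissible_mult[OF B.admissible_const adm] g e(1)]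
        B.adj_series_scale[OF adm e(1)] ..
    have i1: "ell2_inner \<eta> (adj_series (comb_box n) (f n) \<xi>) = of_real (1 / \<beta>) *
        ell2_inner \<eta> (adj_series (comb_box n) (resolvent_fps (z n)) \<xi>) +
        ell2_inner \<eta> (adj_series (comb_box n) (g n) \<xi>)"
      unfolding eq of_real_divide of_real_1 by (rule ell2_inner_linear_right[OF e(2) m])
    have i2: "ell2_inner \<eta> (adj_series (comb_box n) (resolvent_fps (z n)) \<xi>) = ?r n +
        of_real ((\<kappa> n)\<^sup>2 * green (\<kappa> n) (2 * n + 1) (0 :: int ^ 'd)) *
          (cnj (\<Sum>j\<in>cube n. coef n \<eta> j) * (\<Sum>j\<in>cube n. coef n \<xi> j))"
      unfolding comb_box_resolvent_inner[OF elim z(1)[of n, unfolded a_def d_def] e \<gamma>(1,2) \<gamma>(3)[of n, unfolded d_def]]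
      unfolding coef_def defect_def \<kappa>_def by (simp only: diff_add_eq add_diff_eq diff_diff_add add.commute)
    have alg: "u * r + s = u * (r + x) + s - u * x" for u r s x :: complex by (simp add: algebra_simps)
    show ?case unfolding occupation_condensate[OF \<beta>] i1 i2 by (rule alg)
  qed
  ultimately show ?thesis by (rule convergent_cong[THEN iffD1, rotated])
qed

end

theorem theorem10p5:
  fixes \<beta> :: real and \<mu> :: "nat \<Rightarrow> real"
  assumes "CARD('d::finite) \<in> {1, 2}"
    and "\<beta> > 0"
    and "\<And>n. \<mu> n < 0"
    and "\<mu> \<longlonglongrightarrow> 0"
  shows "\<exists>(k' :: nat \<Rightarrow> real)
          (vn :: nat \<Rightarrow> (int ^ 'd) \<times> int \<Rightarrow> complex)
          (C :: nat \<Rightarrow> ((int ^ 'd) \<times> int \<Rightarrow> complex) \<Rightarrow> ((int ^ 'd) \<times> int \<Rightarrow> complex) \<Rightarrow> complex).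
      (\<forall>n. vn n \<in> ell2_on (pverts (comb_box n))) \<and>
      (\<forall>n. sesquilinear_form ell2 (C n)) \<and>
      (\<forall>n. \<forall>\<xi>\<in>schwartz_vectors. \<forall>\<eta>\<in>schwartz_vectors.
         gibbs_two_point \<beta> (hamiltonian (\<mu> n) n) \<xi> \<eta> =
           of_real (k' n) * ell2_inner \<eta> (vn n) * ell2_inner (vn n) \<xi> + C n \<xi> \<eta>) \<and>
      filterlim k' at_top sequentially \<and>
      (\<forall>\<eta>\<in>schwartz_vectors.
         (\<lambda>n. ell2_inner (vn n) \<eta>) \<longlonglongrightarrow> fiber_pairing pf_vector \<eta>) \<and>
      (\<exists>D C_lim. schwartz_vectors \<subseteq> D \<and> D \<subseteq> ell2 \<and> sesquilinear_form D C_lim \<and>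
         (\<forall>\<xi>\<in>D. \<forall>\<eta>\<in>D. (\<lambda>n. C n \<xi> \<eta>) \<longlonglongrightarrow> C_lim \<xi> \<eta>))"
proof -
  define d where "d = real CARD('d)"
  have d: "d > 0" by (simp add: d_def)
  define a where "a = comb_norm d"
  have a: "a > 2" unfolding a_def by (rule comb_decay(5)[OF d])
  \<comment> \<open>The scalar part of the Hamiltonian, which becomes z - A. As \<mu> is negative, z
    lies strictly above the norm, and the resolvent series converges for each n.\<close>
  define z where "z = (\<lambda>n. a - \<mu> n)"
  have z_above: "z n > a" for n using assms(3)[of n] by (simp add: z_def)
  have z_lim: "z \<longlonglongrightarrow> a" using tendsto_diff[OF tendsto_const assms(4), of a] by (simp add: z_def)
  \<comment> \<open>The coefficient estimate for the Bose remainder is uniform only on bounded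
    ranges of z; a convergent sequence provides one.\<close>
  obtain L where L: "\<And>n. z n \<le> L"
    using Bseq_bdd_above[OF convergent_imp_Bseq[OF convergentI[OF z_lim]]] by (auto simp: bdd_above_def)
  obtain g C q where q: "0 \<le> q" "q < 1" "0 \<le> C"
    and g_bound: "\<And>z m. a \<le> z \<Longrightarrow> z \<le> L \<Longrightarrow> cmod (fps_nth (g z) m) * a ^ m \<le> C * q ^ m"
    and g_cont: "\<And>m. continuous_on {a..} (\<lambda>z. fps_nth (g z) m)"
    and g_eq: "\<And>z. a \<le> z \<Longrightarrow> (exp_hamiltonian_fps \<beta> z - 1) *
       (fps_const (1 / of_real \<beta>) * resolvent_fps z + g z) = 1"
  proof (rule bose_coefficients[OF assms(2), of a L])
    show "a > 0" using a by simp
  qed (rule that; assumption)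
  have "\<exists>\<gamma>. path_resolvent (z n) n 0 = of_real \<gamma> \<and> 0 < \<gamma> \<and> \<gamma> < 1 / (2 * d)" for n
    using path_resolvent_0[OF d, of "z n" n] z_above[of n] unfolding a_def by metis
  then obtain \<gamma> where \<gamma>: "\<And>n. path_resolvent (z n) n 0 = of_real (\<gamma> n)" "\<And>n. 0 < \<gamma> n" "\<And>n. \<gamma> n < 1 / (2 * d)"
    by metis
  interpret condensing_comb z "TYPE('d)" d a "1 / (a - 2) * ell2_norm (delta (0 :: int))" \<gamma> "\<lambda>n. 1 / \<gamma> n"
    by unfold_locales (use z_above z_lim \<gamma> in \<open>simp_all add: a_def d_def\<close>)
  define f where "f = (\<lambda>n. fps_const (1 / of_real \<beta>) * resolvent_fps (z n) + g (z n))"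
  have box: "bounded_graph (comb_box n :: ((int ^ 'd) \<times> int) pair_pre_digraph) a" for n
    unfolding a_def d_def by (rule bounded_comb_box)
  have g_bound': "cmod (fps_nth (g (z n)) m) * a ^ m \<le> C * q ^ m" for n m
    using z_above[of n] L[of n] by (intro g_bound) auto
  have adm_g: "bounded_graph.admissible a (g (z n))" for n
    by (rule bounded_graph.admissible_geometric[OF box g_bound' q(1,2)])
  have adm_f: "bounded_graph.admissible a (f n)" for n
    unfolding f_def
    by (intro bounded_graph.admissible_add[OF box] bounded_graph.admissible_mult[OF box]
        bounded_graph.admissible_const[OF box] bounded_graph.admissible_resolvent[OF box] z_above adm_g)
  have f_eq: "(exp_hamiltonian_fps \<beta> (z n) - 1) * f n = 1" for n
    unfolding f_def using z_above[of n] by (intro g_eq) simp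
  have gibbs: "gibbs_two_point \<beta> (hamiltonian (\<mu> n) n) \<xi> \<eta> = ell2_inner \<eta> (adj_series (comb_box n) (f n) \<xi>)"
    if "\<xi> \<in> ell2" for n and \<xi> \<eta> :: "(int ^ 'd) \<times> int \<Rightarrow> complex"
    using bounded_graph.op_inverse_bose[OF box[of n] adm_f[of n] f_eq[of n] that]
    by (simp add: gibbs_two_point_def hamiltonian_def op_norm_comb z_def a_def d_def)
  \<comment> \<open>With the remainder defined as a difference, the decomposition holds by
    construction; the content lies in its convergence.\<close>
  define F where "F = (\<lambda>n \<xi> \<eta>. gibbs_two_point \<beta> (hamiltonian (\<mu> n) n) \<xi> \<eta> -
    of_real (occupation \<beta> n) * ell2_inner \<eta> (condensate n) * ell2_inner (condensate n) \<xi>)"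
  have sesq: "sesquilinear_form ell2 (F n)" for n
    unfolding sesquilinear_form_def
  proof (intro conjI ballI allI complex_subspace_ell2)
    fix \<xi> \<xi>' \<eta> :: "(int ^ 'd) \<times> int \<Rightarrow> complex" and c
    assume m: "\<xi> \<in> ell2" "\<xi>' \<in> ell2" "\<eta> \<in> ell2"
    have m': "(\<lambda>x. c * \<xi> x + \<xi>' x) \<in> ell2" by (intro ell2_add(1) ell2_scale(1) m)
    note s = bounded_graph.adj_series_ell2[OF box adm_f]
    show "F n (\<lambda>x. c * \<xi> x + \<xi>' x) \<eta> = c * F n \<xi> \<eta> + F n \<xi>' \<eta>"
      unfolding F_def gibbs[OF m'] gibbs[OF m(1)] gibbs[OF m(2)]
        bounded_graph.adj_series_linear[OF box adm_f m(1,2)]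
        ell2_inner_linear_right[OF m(3) s[OF m(1)] s[OF m(2)]]
        ell2_inner_linear_right[OF condensate_ell2 m(1,2)]
      by (simp add: algebra_simps)
  next
    fix \<xi> \<eta> \<eta>' :: "(int ^ 'd) \<times> int \<Rightarrow> complex" and c
    assume m: "\<xi> \<in> ell2" "\<eta> \<in> ell2" "\<eta>' \<in> ell2"
    note s = bounded_graph.adj_series_ell2[OF box adm_f]
    show "F n \<xi> (\<lambda>x. c * \<eta> x + \<eta>' x) = cnj c * F n \<xi> \<eta> + F n \<xi> \<eta>'"
      unfolding F_def gibbs[OF m(1)] ell2_inner_linear_left[OF s[OF m(1)] m(2,3)]
        ell2_inner_linear_left[OF condensate_ell2 m(2,3)]
      by (simp add: algebra_simps)
  qed
  have conv: "convergent (\<lambda>n. F n \<xi> \<eta>)" if \<xi>: "\<xi> \<in> schwartz_vectors" and \<eta>: "\<eta> \<in> schwartz_vectors" for \<xi> \<eta>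
  proof -
    note e = schwartz_vectorsD(1)[OF \<xi>] schwartz_vectorsD(1)[OF \<eta>]
    \<comment> \<open>Although \<open>a\<close> is the full norm of the comb, the coefficients of
      the regular part, multiplied by a^m, are at most C * q^m. Membership in \<open>ell2\<close> is
      enough here; rapid decrease is used for the pole part.\<close>
    have "(\<lambda>n. ell2_inner \<eta> (adj_series (comb_box n) (g (z n)) \<xi>)) \<longlonglongrightarrow> ell2_inner \<eta> (adj_series comb_graph (g a) \<xi>)"
    proof (rule adj_series_weak_convergence[OF box _ converges_comb_box _ _ g_bound' e])
      show "bounded_graph (comb_graph :: ((int ^ 'd) \<times> int) pair_pre_digraph) a"
        unfolding a_def d_def by (rule bounded_comb)
      show "(\<lambda>n. fps_nth (g (z n)) m) \<longlonglongrightarrow> fps_nth (g a) m" for m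
        by (rule continuous_on_tendsto_compose[OF g_cont z_lim])
          (use z_above in \<open>auto intro!: always_eventually less_imp_le\<close>)
      show "summable (\<lambda>m. C * q ^ m)" using q by (intro summable_mult summable_geometric) auto
    qed
    then have "convergent (\<lambda>n. ell2_inner \<eta> (adj_series (comb_box n) (g (z n)) \<xi>))" by (rule convergentI)
    from remainder_converges[OF assms(2) \<xi> \<eta> _ adm_g this, of f] show ?thesis
      unfolding F_def gibbs[OF e(1)] by (simp add: f_def)
  qed
  have lim: "(\<lambda>n. F n \<xi> \<eta>) \<longlonglongrightarrow> lim (\<lambda>n. F n \<xi> \<eta>)" if "\<xi> \<in> schwartz_vectors" "\<eta> \<in> schwartz_vectors" for \<xi> \<eta>
    using conv[OF that] by (simp add: convergent_LIMSEQ_iff)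
  have sub: "schwartz_vectors \<subseteq> (ell2 :: ((int ^ 'd) \<times> int \<Rightarrow> complex) set)"
    using schwartz_vectorsD(1) by blast
  \<comment> \<open>The rapidly decreasing vectors themselves serve as the domain of the limit
    form.\<close>
  have "sesquilinear_form schwartz_vectors (\<lambda>\<xi> \<eta>. lim (\<lambda>n. F n \<xi> \<eta>))"
    by (rule sesquilinear_form_limit[OF complex_subspace_schwartz sub sesq lim])
  moreover have "CARD('d) \<le> 2" using assms(1) by auto
  ultimately show ?thesis
    using condensate_ell2_on sesq occupation_at_top[OF _ assms(2)] condensate_tendsto lim sub
    by (intro exI[of _ "occupation \<beta>"] exI[of _ condensate] exI[of _ F] conjI exI[of _ schwartz_vectors]
        exI[of _ "\<lambda>\<xi> \<eta>. lim (\<lambda>n. F n \<xi> \<eta>)"]) (auto simp: F_def)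
qed

end
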